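(* Let $\alpha\in(0,1)$, and let $G\subset\mathbb C$ be a Jordan domain whose boundary $\Gamma$ is of class $C^{1,\alpha}$. Then, for every real $\tau$ with $0\leqslant\tau<1$, the domain $G$ is not $\mathcal L_\tau$-regular; that is, there exists a function $\psi\in C(\partial G)$ for which there is no function $f\in C(\overline G)$ that satisfies $\mathcal L_\tau f=0$ in $G$ and $f|_{\partial G}=\psi$.
   Context: Write $z=x+iy$ and $\overline\partial=\frac12(\partial_x+i\partial_y)$, $\partial=\frac12(\partial_x-i\partial_y)$. For $\tau\in[0,1)$ put $\partial_\tau=\overline\partial+\tau\partial$ and $\mathcal L_\tau=\overline\partial\,\partial_\tau$, a second-order elliptic operator with constant coefficients. Functions are complex-valued, and the equation $\mathcal L_\tau f=0$ in an open set is understood in the classical sense. (For a continuous function this is equivalent to the equation in the sense of distributions.) $C(X)$ is the space of bounded continuous complex-valued functions on a closed set $X\subset\mathbb C$. A bounded domain $G$ is called $\mathcal L_\tau$-regular if for every $\psi\in C(\partial G)$ there exists $f\in C(\overline G)$ with $\mathcal L_\tau f=0$ in $G$ and $f|_{\partial G}=\psi$. A Jordan curve is a homeomorphic image of the unit circle. A Jordan domain is the bounded component of the complement of a Jordan curve. A Jordan curve $\Gamma$ is of class $C^{1,\alpha}$ if it has a parametrization $w(\xi)$, $0\leqslant\xi\leqslant1$, as a closed curve, that is continuously differentiable, satisfies $w'(\xi)\ne0$ on $[0,1]$, and satisfies $|w'(\xi_1)-w'(\xi_2)|\leqslant C|\xi_1-\xi_2|^\alpha$ for all $\xi_1,\xi_2\in[0,1]$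 with some constant $C$. *)

theory Defs
  imports "HOL-Analysis.Analysis"
begin

definition partial_x :: "(complex \<Rightarrow> complex) \<Rightarrow> complex \<Rightarrow> complex" where
  "partial_x f z = vector_derivative (\<lambda>t. f (z + of_real t)) (at 0)"

definition partial_y :: "(complex \<Rightarrow> complex) \<Rightarrow> complex \<Rightarrow> complex" where
  "partial_y f z = vector_derivative (\<lambda>t. f (z + \<i> * of_real t)) (at 0)"

text \<open>Continuous differentiability is meant in the real sense (existence and continuity
  of the partial derivatives), for sets \<open>U\<close> that are open.\<close>

definition C1_on :: "complex set \<Rightarrow> (complex \<Rightarrow> complex) \<Rightarrow> bool" where
  "C1_on U f \<longleftrightarrow>
     (\<forall>z\<in>U. (\<lambda>t::real. f (z + of_real t)) differentiable (at 0)) \<and>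
     (\<forall>z\<in>U. (\<lambda>t::real. f (z + \<i> * of_real t)) differentiable (at 0)) \<and>
     continuous_on U (partial_x f) \<and> continuous_on U (partial_y f)"

definition C2_on :: "complex set \<Rightarrow> (complex \<Rightarrow> complex) \<Rightarrow> bool" where
  "C2_on U f \<longleftrightarrow> C1_on U f \<and> C1_on U (partial_x f) \<and> C1_on U (partial_y f)"

definition dbar :: "(complex \<Rightarrow> complex) \<Rightarrow> complex \<Rightarrow> complex" where
  "dbar f z = (partial_x f z + \<i> * partial_y f z) / 2"

definition del :: "(complex \<Rightarrow> complex) \<Rightarrow> complex \<Rightarrow> complex" where
  "del f z = (partial_x f z - \<i> * partial_y f z) / 2"

definition del_tau :: "real \<Rightarrow> (complex \<Rightarrow> complex) \<Rightarrow> complex \<Rightarrow> complex" where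
  "del_tau \<tau> f z = dbar f z + of_real \<tau> * del f z"

definition L_op :: "real \<Rightarrow> (complex \<Rightarrow> complex) \<Rightarrow> complex \<Rightarrow> complex" where
  "L_op \<tau> f = dbar (del_tau \<tau> f)"

definition L_solution_on :: "real \<Rightarrow> complex set \<Rightarrow> (complex \<Rightarrow> complex) \<Rightarrow> bool" where
  "L_solution_on \<tau> U f \<longleftrightarrow> C2_on U f \<and> (\<forall>z\<in>U. L_op \<tau> f z = 0)"

text \<open>Elements of the function space over \<open>X\<close> are represented by total functions;
  their values off \<open>X\<close> are irrelevant.\<close>

definition bounded_continuous :: "complex set \<Rightarrow> (complex \<Rightarrow> complex) set" where
  "bounded_continuous X = {f. continuous_on X f \<and> bounded (f ` X)}"

text \<open>Meant for bounded domains \<open>G\<close>; being a bounded domain is deliberately not part of the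
  definition, so that the negation of regularity has content.\<close>

definition L_regular :: "real \<Rightarrow> complex set \<Rightarrow> bool" where
  "L_regular \<tau> G \<longleftrightarrow>
     (\<forall>\<psi>\<in>bounded_continuous (frontier G).
        \<exists>f\<in>bounded_continuous (closure G).
          L_solution_on \<tau> G f \<and> (\<forall>z\<in>frontier G. f z = \<psi> z))"

definition jordan_curve :: "complex set \<Rightarrow> bool" where
  "jordan_curve \<Gamma> \<longleftrightarrow> \<Gamma> homeomorphic sphere (0::complex) 1"

definition jordan_domain :: "complex set \<Rightarrow> bool" where
  "jordan_domain G \<longleftrightarrow> (\<exists>\<Gamma>. jordan_curve \<Gamma> \<and> G \<in> components (- \<Gamma>) \<and> bounded G)"

text \<open>The parametrization is continuously differentiable as a closed curve: derivatives at the
  end points are one-sided, and they agree, so the curve has no corner or cusp at its base point.\<close>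

definition C1_holder_curve :: "real \<Rightarrow> complex set \<Rightarrow> bool" where
  "C1_holder_curve \<alpha> \<Gamma> \<longleftrightarrow> jordan_curve \<Gamma> \<and>
     (\<exists>w w'. simple_path w \<and> pathfinish w = pathstart w \<and> path_image w = \<Gamma> \<and>
        (\<forall>\<xi>\<in>{0..1}. (w has_vector_derivative w' \<xi>) (at \<xi> within {0..1})) \<and>
        continuous_on {0..1} w' \<and> w' 0 = w' 1 \<and>
        (\<forall>\<xi>\<in>{0..1}. w' \<xi> \<noteq> 0) \<and>
        (\<exists>C. \<forall>\<xi>1\<in>{0..1}. \<forall>\<xi>2\<in>{0..1}.
           norm (w' \<xi>1 - w' \<xi>2) \<le> C * \<bar>\<xi>1 - \<xi>2\<bar> powr \<alpha>))"

end

theory Submission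
  imports Defs
begin

text \<open>
  The solutions of \<open>\<L>\<^sub>\<tau> f = 0\<close> are locally sums \<open>g(z) + h(z - \<tau> z\<^sup>*)\<close> with \<open>z\<^sup>*\<close> the conjugate of
  \<open>z\<close> and \<open>g\<close>, \<open>h\<close> holomorphic (with the obvious limit for \<open>\<tau> = 0\<close>). Since \<open>\<tau> < 1\<close>, both variables run
  around the boundary in the same sense, so a sum of this kind has, up to a smoothing error, only
  the boundary values of one holomorphic function. Hence the boundary values of a bounded solution
  must satisfy a condition that most continuous functions violate. The proof makes this concrete at
  one boundary point and tests the condition on one explicit function.

  Let \<open>p\<close> be a lowest point of the boundary. Taking \<open>p\<close> as the origin, the boundary near \<open>p\<close> is a graph
  \<open>y = \<phi>(x)\<close> with \<open>\<phi>(0) = \<phi>'(0) = 0 \<le> \<phi>\<close> and \<open>\<phi>'\<close> Hoelder continuous, and the domain lies above it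
  (\<open>boundary_graph_at_lowest_point\<close>). With \<open>c = (1-\<tau>)/2\<close>, \<open>d = (1+\<tau>)/2\<close> and
  \<open>m = (\<i> - \<phi>') (c + \<i> d \<phi>')\<close>, consider for \<open>s > 0\<close> the integrals
  \<open>\<integral> m(x) f(x + \<i> \<phi>(x)) / (x + \<i> (\<phi>(x) + s)) dx\<close> over \<open>[-r, r]\<close>. If \<open>f\<close> is a solution that is continuous
  up to the boundary, they stay bounded as \<open>s\<close> tends to \<open>0\<close> (\<open>norm_J0_le\<close>). But if \<open>f\<close> equals the
  conjugate of \<open>m(x)\<close> times \<open>1 / (1 - ln (x/r))\<close> for \<open>x > 0\<close> and \<open>0\<close> for \<open>x \<le> 0\<close>, they grow like
  \<open>ln (ln (1/s))\<close> (\<open>boundary_functional_unbounded\<close>). So these boundary values have no solution.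

  The bound comes from Green's formula. For a straight boundary \<open>\<phi> = 0\<close> put \<open>d = c (1 + \<beta>)\<close>,
  \<open>t = y - \<phi>(x)\<close> and \<open>w = z + \<i> \<beta> t\<close>. Then \<open>w\<close> is a function of the second characteristic variable,
  \<open>N = (ln (z + \<i> s) - ln (w + \<i> s)) / \<beta>\<close> (its limit if \<open>\<beta> = 0\<close>) solves \<open>\<L>\<^sub>\<tau> N = 0\<close> and vanishes
  on the boundary, and Green's formula with \<open>f\<close> and \<open>N\<close> moves the boundary integral of
  \<open>f \<partial>\<^sub>\<tau> N\<close> into the interior. For a curved boundary the same \<open>N\<close> gives
  \<open>\<partial>\<^sub>\<tau> N = c / (z + \<i> s) + \<i> d \<phi>' / (w + \<i> s)\<close>, and one more derivative would need \<open>\<phi>''\<close>. Therefore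
  \<open>\<phi>'(x)\<close> is replaced by the divided difference \<open>q(x,t) = (\<phi>(x+t) - \<phi>(x)) / t\<close>. It has derivatives of
  order \<open>t\<^bsup>\<alpha>-1\<^esup>\<close> and differs from \<open>\<phi>'\<close> by \<open>O(t\<^bsup>\<alpha>\<^esup>)\<close>, which compensates the possible growth
  \<open>O(1/t)\<close> of the derivative of \<open>f\<close> conjugate to \<open>z\<close> (\<open>elliptic_gradient_bound\<close>). All error terms
  are then at most a constant times \<open>t\<^bsup>\<alpha>/2-1\<^esup> (|x| + t)\<^bsup>\<alpha>/2-1\<^esup>\<close>, uniformly in \<open>s\<close> (\<open>norm_E_le\<close>), and
  this is integrable.
\<close>

section \<open>Real gradients and mixed partial derivatives\<close>

text \<open>Total differentiability in the real sense, with the derivative given by its values on \<open>1\<close> and \<open>\<i>\<close>.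
  In contrast to the partial derivatives it obeys the chain rule along curves.\<close>

definition has_grad :: "(complex \<Rightarrow> complex) \<Rightarrow> complex \<Rightarrow> complex \<Rightarrow> complex \<Rightarrow> bool" where
  "has_grad f gx gy z \<longleftrightarrow> (f has_derivative (\<lambda>h. Re h *\<^sub>R gx + Im h *\<^sub>R gy)) (at z)"

lemma has_grad_along_curve:
  assumes "has_grad f gx gy (c t)" and "(c has_vector_derivative c') (at t within S)"
  shows "((\<lambda>t. f (c t)) has_vector_derivative (Re c' *\<^sub>R gx + Im c' *\<^sub>R gy)) (at t within S)"
proof -
  have "((\<lambda>t. f (c t)) has_derivative (\<lambda>h. Re (h *\<^sub>R c') *\<^sub>R gx + Im (h *\<^sub>R c') *\<^sub>R gy)) (at t within S)"
    using has_derivative_compose[OF assms(2)[unfolded has_vector_derivative_def]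
        assms(1)[unfolded has_grad_def]] .
  then show ?thesis
    by (simp add: has_vector_derivative_def algebra_simps)
qed

lemma has_grad_imp_continuous: "has_grad f gx gy z \<Longrightarrow> isCont f z"
  unfolding has_grad_def using has_derivative_continuous by blast

lemma has_grad_linear:
  assumes "has_grad f fx fy z" "has_grad g gx gy z"
  shows "has_grad (\<lambda>z. a * f z + b * g z) (a * fx + b * gx) (a * fy + b * gy) z"
proof -
  have "((\<lambda>z. a * f z + b * g z) has_derivative
     (\<lambda>h. a * (Re h *\<^sub>R fx + Im h *\<^sub>R fy) + b * (Re h *\<^sub>R gx + Im h *\<^sub>R gy))) (at z)"
    using assms unfolding has_grad_def by (intro derivative_intros) auto
  then show ?thesis unfolding has_grad_def by (simp add: algebra_simps)
qed

lemma has_grad_minus_const: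
  assumes "has_grad f fx fy z"
  shows "has_grad (\<lambda>z. f z - c) fx fy z"
  using has_derivative_diff[OF assms[unfolded has_grad_def] has_derivative_const[of c]]
  unfolding has_grad_def by simp

lemma partials_of_has_grad:
  assumes "has_grad f fx fy z"
  shows "partial_x f z = fx" and "partial_y f z = fy"
proof -
  have "((\<lambda>t. f (z + of_real t)) has_vector_derivative (Re 1 *\<^sub>R fx + Im 1 *\<^sub>R fy)) (at 0)"
    by (rule has_grad_along_curve) (use assms in \<open>auto intro!: derivative_eq_intros\<close>)
  then show "partial_x f z = fx" unfolding partial_x_def by (simp add: vector_derivative_at)
  have "((\<lambda>t. f (z + \<i> * of_real t)) has_vector_derivative (Re \<i> *\<^sub>R fx + Im \<i> *\<^sub>R fy)) (at 0)"
    by (rule has_grad_along_curve) (use assms in \<open>auto intro!: derivative_eq_intros\<close>)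
  then show "partial_y f z = fy" unfolding partial_y_def by (simp add: vector_derivative_at)
qed

lemma shift_has_vector_derivative: "((\<lambda>x'. x' - x) has_vector_derivative 1) (at (x::real))"
  unfolding has_real_derivative_iff_has_vector_derivative[symmetric]
  by (auto intro!: derivative_eq_intros)

lemma partial_x_works:
  assumes "C1_on U f" "Complex x y \<in> U"
  shows "((\<lambda>x. f (Complex x y)) has_vector_derivative partial_x f (Complex x y)) (at x within S)"
proof -
  have "((\<lambda>t. f (Complex x y + of_real t)) has_vector_derivative partial_x f (Complex x y)) (at 0)"
    unfolding partial_x_def using assms unfolding C1_on_def
    by (simp add: vector_derivative_works[symmetric])
  then have "((\<lambda>t. f (Complex (x + t) y)) has_vector_derivative partial_x f (Complex x y)) (at 0)"
    by (simp add: complex_eq_iff Complex_eq algebra_simps)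
  then have "((\<lambda>x'. f (Complex x' y)) has_vector_derivative partial_x f (Complex x y)) (at x)"
    using vector_diff_chain_at[of "\<lambda>x'. x' - x" 1 x "\<lambda>t. f (Complex (x + t) y)"] shift_has_vector_derivative
    by (simp add: o_def)
  then show ?thesis by (rule has_vector_derivative_at_within)
qed

lemma partial_y_works:
  assumes "C1_on U f" "Complex x y \<in> U"
  shows "((\<lambda>y. f (Complex x y)) has_vector_derivative partial_y f (Complex x y)) (at y within S)"
proof -
  have "((\<lambda>t. f (Complex x y + \<i> * of_real t)) has_vector_derivative partial_y f (Complex x y)) (at 0)"
    unfolding partial_y_def using assms unfolding C1_on_def
    by (simp add: vector_derivative_works[symmetric])
  then have "((\<lambda>t. f (Complex x (y + t))) has_vector_derivative partial_y f (Complex x y)) (at 0)"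
    by (simp add: complex_eq_iff Complex_eq algebra_simps)
  then have "((\<lambda>y'. f (Complex x y')) has_vector_derivative partial_y f (Complex x y)) (at y)"
    using vector_diff_chain_at[of "\<lambda>y'. y' - y" 1 y "\<lambda>t. f (Complex x (y + t))"] shift_has_vector_derivative
    by (simp add: o_def)
  then show ?thesis by (rule has_vector_derivative_at_within)
qed

lemma open_contains_rectangle:
  assumes "open U" "Complex x y \<in> U"
  obtains e where "e > 0" "\<And>x' y'. x' \<in> {x-e..x+e} \<Longrightarrow> y' \<in> {y-e..y+e} \<Longrightarrow> Complex x' y' \<in> U"
proof -
  obtain d where d: "d > 0" "ball (Complex x y) d \<subseteq> U" using assms open_contains_ball by blast
  have "Complex x' y' \<in> U" if "x' \<in> {x-d/3..x+d/3}" "y' \<in> {y-d/3..y+d/3}" for x' y'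
  proof -
    have "dist (Complex x y) (Complex x' y') \<le> \<bar>x - x'\<bar> + \<bar>y - y'\<bar>"
      unfolding dist_norm using cmod_le[of "Complex x y - Complex x' y'"] by simp
    also have "\<dots> < d" using that d by (auto simp: abs_if)
    finally show ?thesis using d by auto
  qed
  then show ?thesis using that[of "d/3"] d by auto
qed

lemma C1_on_has_grad:
  assumes "C1_on U f" "open U" "z \<in> U"
  shows "has_grad f (partial_x f z) (partial_y f z) z"
proof -
  obtain x y where z: "z = Complex x y" using complex.exhaust by blast
  obtain e where e: "e > 0" and sub: "\<And>x' y'. x' \<in> {x-e..x+e} \<Longrightarrow> y' \<in> {y-e..y+e} \<Longrightarrow> Complex x' y' \<in> U"
    using open_contains_rectangle assms z by metis
  define X where "X = {x-e<..<x+e}"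
  define Y where "Y = {y-e<..<y+e}"
  have inU: "Complex x' y' \<in> U" if "x' \<in> X" "y' \<in> Y" for x' y'
    using sub that by (auto simp: X_def Y_def)
  have cy: "continuous (at (x,y) within X \<times> Y) (\<lambda>(x,y). blinfun_scaleR_left (partial_y f (Complex x y)))"
  proof -
    have "continuous_on U (partial_y f)" using assms unfolding C1_on_def by simp
    then have "continuous_on (X \<times> Y) (\<lambda>p. partial_y f (Complex (fst p) (snd p)))"
      by (rule continuous_on_compose2) (auto simp: inU intro!: continuous_intros)
    then have "continuous_on (X \<times> Y) (\<lambda>(x,y). blinfun_scaleR_left (partial_y f (Complex x y)))"
      by (auto simp: split_beta intro!: continuous_intros)
    then show ?thesis using e by (auto simp: X_def Y_def continuous_on_eq_continuous_within)
  qed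
  have "((\<lambda>(x,y). f (Complex x y)) has_derivative
     (\<lambda>(tx,ty). tx *\<^sub>R partial_x f (Complex x y) + blinfun_scaleR_left (partial_y f (Complex x y)) ty)) (at (x,y) within X \<times> Y)"
  proof (rule has_derivative_partialsI[OF _ _ cy])
    show "((\<lambda>x. f (Complex x y)) has_derivative (\<lambda>tx. tx *\<^sub>R partial_x f (Complex x y))) (at x within X)"
      using partial_x_works[OF assms(1), of x y X] assms(3) z
      unfolding has_vector_derivative_def by simp
    show "((\<lambda>y. f (Complex x y)) has_derivative blinfun_apply (blinfun_scaleR_left (partial_y f (Complex x y)))) (at y within Y)"
      if "x \<in> X" "y \<in> Y" for x y
      using partial_y_works[OF assms(1), of x y Y] inU that
      unfolding has_vector_derivative_def by simp
  qed (use e in \<open>auto simp: Y_def\<close>)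
  moreover have "at (x,y) within X \<times> Y = at (x,y)"
    by (rule at_within_open) (use e in \<open>auto simp: X_def Y_def open_Times\<close>)
  ultimately have D: "((\<lambda>(x,y). f (Complex x y)) has_derivative
     (\<lambda>(tx,ty). tx *\<^sub>R partial_x f z + ty *\<^sub>R partial_y f z)) (at (Re z, Im z))"
    using z by simp
  have "((\<lambda>w. (Re w, Im w)) has_derivative (\<lambda>w. (Re w, Im w))) (at z)"
    by (auto intro!: derivative_eq_intros)
  from has_derivative_compose[OF this D]
  show ?thesis unfolding has_grad_def by simp
qed

text \<open>The divergence theorem on a thin horizontal strip, in differential form: the flux of the field
  \<open>(A, B)\<close> through a horizontal segment changes with the height by the integrated divergence,
  corrected by what leaves through the two ends. It replaces integration over plane regions by
  integrals in one variable and an ordinary derivative.\<close>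

lemma flux_derivative:
  fixes A B Ax Bt :: "real \<Rightarrow> real \<Rightarrow> complex"
  assumes "a \<le> b" "convex U" "t0 \<in> U"
    and Ax: "\<And>x. x \<in> {a..b} \<Longrightarrow> ((\<lambda>x. A x t0) has_vector_derivative Ax x t0) (at x within {a..b})"
    and Bt: "\<And>x t. x \<in> {a..b} \<Longrightarrow> t \<in> U \<Longrightarrow> ((\<lambda>t. B x t) has_vector_derivative Bt x t) (at t within U)"
    and B: "\<And>t. t \<in> U \<Longrightarrow> continuous_on {a..b} (\<lambda>x. B x t)"
    and contBt: "continuous_on (U \<times> {a..b}) (\<lambda>(t,x). Bt x t)"
  shows "((\<lambda>t. integral {a..b} (\<lambda>x. B x t)) has_vector_derivative
     integral {a..b} (\<lambda>x. Ax x t0 + Bt x t0) - (A b t0 - A a t0)) (at t0 within U)"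
proof -
  have "continuous_on {a..b} (\<lambda>x. Bt x t0)"
    using continuous_on_compose2[OF contBt, of "{a..b}" "\<lambda>x. (t0, x)"] \<open>t0 \<in> U\<close>
    by (force intro!: continuous_intros)
  then have iB: "(\<lambda>x. Bt x t0) integrable_on {a..b}" by (rule integrable_continuous_real)
  have iA: "((\<lambda>x. Ax x t0) has_integral (A b t0 - A a t0)) {a..b}"
    by (rule fundamental_theorem_of_calculus) (use assms in auto)
  have "((\<lambda>t. integral (cbox a b) (\<lambda>x. B x t)) has_vector_derivative
     integral (cbox a b) (\<lambda>x. Bt x t0)) (at t0 within U)"
    by (rule leibniz_rule_vector_derivative)
      (use assms in \<open>auto intro: integrable_continuous_real\<close>)
  moreover have "integral {a..b} (\<lambda>x. Bt x t0)
      = integral {a..b} (\<lambda>x. Ax x t0 + Bt x t0) - (A b t0 - A a t0)"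
    using iA iB by (simp add: integral_add has_integral_integrable integral_unique)
  ultimately show ?thesis by simp
qed

text \<open>By the fundamental theorem in \<open>x\<close>, the increments of \<open>f\<close> are integrals of \<open>f\<^sub>x\<close>. Differentiating them
  in \<open>y\<close> under the integral sign shows that the increments of \<open>f\<^sub>y\<close> are integrals of \<open>f\<^sub>x\<^sub>y\<close>, and
  differentiating in \<open>x\<close> gives the claim.\<close>

lemma mixed_partials_commute:
  assumes "C2_on U f" "open U" "z \<in> U"
  shows "partial_x (partial_y f) z = partial_y (partial_x f) z"
proof -
  obtain x0 y0 where z: "z = Complex x0 y0" using complex.exhaust by blast
  obtain e where e: "e > 0" and sub: "\<And>x' y'. x' \<in> {x0-e..x0+e} \<Longrightarrow> y' \<in> {y0-e..y0+e} \<Longrightarrow> Complex x' y' \<in> U"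
    using open_contains_rectangle assms z by metis
  have C: "C1_on U f" "C1_on U (partial_x f)" "C1_on U (partial_y f)"
    using assms unfolding C2_on_def by auto
  have cxy: "continuous_on U (partial_y (partial_x f))" using C(2) unfolding C1_on_def by simp
  have cx: "continuous_on U (partial_x f)" using C(1) unfolding C1_on_def by simp
  define Y where "Y = {y0-e..y0+e}"
  have y0: "y0 \<in> Y" using e by (simp add: Y_def)
  have *: "partial_y f (Complex x y0) - partial_y f (Complex (x0-e) y0)
      = integral {x0-e..x} (\<lambda>s. partial_y (partial_x f) (Complex s y0))" if x: "x \<in> {x0-e..x0+e}" for x
  proof -
    have sub': "Complex x' y' \<in> U" if "x' \<in> {x0-e..x}" "y' \<in> Y" for x' y'
      using sub that x by (auto simp: Y_def)
    have I: "integral {x0-e..x} (\<lambda>s. partial_x f (Complex s y)) = f (Complex x y) - f (Complex (x0-e) y)"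
      if "y \<in> Y" for y
      by (intro integral_unique fundamental_theorem_of_calculus partial_x_works[OF C(1)])
        (use x that sub' in auto)
    have "((\<lambda>y. integral {x0-e..x} (\<lambda>s. partial_x f (Complex s y))) has_vector_derivative
       integral {x0-e..x} (\<lambda>s. 0 + partial_y (partial_x f) (Complex s y0)) - (0 - 0)) (at y0 within Y)"
    proof (rule flux_derivative[where A="\<lambda>_ _. 0"])
      show "continuous_on {x0-e..x} (\<lambda>s. partial_x f (Complex s y))" if "y \<in> Y" for y
        by (rule continuous_on_compose2[OF cx]) (use sub' that in \<open>auto intro!: continuous_intros\<close>)
      show "continuous_on (Y \<times> {x0-e..x}) (\<lambda>(t, xa). partial_y (partial_x f) (Complex xa t))"
        unfolding split_beta
        by (rule continuous_on_compose2[OF cxy]) (use sub' in \<open>auto intro!: continuous_intros\<close>)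
    qed (use x y0 sub' in \<open>auto simp: Y_def intro!: partial_y_works[OF C(2)]\<close>)
    then have derivative_eq: "((\<lambda>y. integral {x0-e..x} (\<lambda>s. partial_x f (Complex s y))) has_vector_derivative
       integral {x0-e..x} (\<lambda>s. partial_y (partial_x f) (Complex s y0))) (at y0 within Y)"
      by simp
    have 1: "((\<lambda>y. f (Complex x y) - f (Complex (x0-e) y)) has_vector_derivative
       integral {x0-e..x} (\<lambda>s. partial_y (partial_x f) (Complex s y0))) (at y0 within Y)"
      by (intro has_vector_derivative_transform[OF y0 _ derivative_eq]) (use I in auto)
    have 2: "((\<lambda>y. f (Complex x y) - f (Complex (x0-e) y)) has_vector_derivative
        partial_y f (Complex x y0) - partial_y f (Complex (x0-e) y0)) (at y0 within Y)"
      by (intro has_vector_derivative_diff partial_y_works[OF C(1)]) (use x sub' y0 in auto)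
    show ?thesis
      by (rule vector_derivative_unique_within[OF _ 2 1])
        (use e in \<open>auto simp: Y_def trivial_limit_within islimpt_Icc\<close>)
  qed
  have x0: "x0 \<in> {x0-e..x0+e}" using e by simp
  have 1: "((\<lambda>x. integral {x0-e..x} (\<lambda>s. partial_y (partial_x f) (Complex s y0))) has_vector_derivative
     partial_y (partial_x f) (Complex x0 y0)) (at x0 within {x0-e..x0+e})"
    by (rule integral_has_vector_derivative[OF _ x0], rule continuous_on_compose2[OF cxy])
      (use sub e in \<open>auto intro!: continuous_intros\<close>)
  have "((\<lambda>x. partial_y f (Complex x y0) - partial_y f (Complex (x0-e) y0)) has_vector_derivative
       partial_x (partial_y f) (Complex x0 y0) - 0) (at x0 within {x0-e..x0+e})"
    by (intro has_vector_derivative_diff partial_x_works[OF C(3)] has_vector_derivative_const)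
      (use assms z in auto)
  then have derivative_eq: "((\<lambda>x. partial_y f (Complex x y0) - partial_y f (Complex (x0-e) y0)) has_vector_derivative
       partial_x (partial_y f) (Complex x0 y0)) (at x0 within {x0-e..x0+e})"
    by simp
  have 2: "((\<lambda>x. integral {x0-e..x} (\<lambda>s. partial_y (partial_x f) (Complex s y0))) has_vector_derivative
       partial_x (partial_y f) (Complex x0 y0)) (at x0 within {x0-e..x0+e})"
    by (intro has_vector_derivative_transform[OF x0 _ derivative_eq]) (use * in auto)
  show ?thesis unfolding z
    by (rule vector_derivative_unique_within[OF _ 2 1])
      (use e in \<open>auto simp: trivial_limit_within islimpt_Icc\<close>)
qed

section \<open>A gradient bound from a mean value property on ellipses\<close>

text \<open>The equation \<open>a v\<^sub>x + \<i> b v\<^sub>y = 0\<close> says that \<open>v\<close> is holomorphic in the variable \<open>x / a + \<i> y / b\<close>.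
  In that variable the following curves are circles.\<close>

definition ellipse :: "real \<Rightarrow> real \<Rightarrow> real \<Rightarrow> complex" where
  "ellipse a b \<theta> = Complex (a * cos \<theta>) (b * sin \<theta>)"

definition ellipse' :: "real \<Rightarrow> real \<Rightarrow> real \<Rightarrow> complex" where
  "ellipse' a b \<theta> = Complex (- a * sin \<theta>) (b * cos \<theta>)"

lemma ellipse_sel [simp]:
  "Re (ellipse a b \<theta>) = a * cos \<theta>" "Im (ellipse a b \<theta>) = b * sin \<theta>"
  "Re (ellipse' a b \<theta>) = - a * sin \<theta>" "Im (ellipse' a b \<theta>) = b * cos \<theta>"
  by (simp_all add: ellipse_def ellipse'_def)

lemma has_vector_derivative_Complex:
  assumes "(f has_real_derivative f') (at t within S)" "(g has_real_derivative g') (at t within S)"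
  shows "((\<lambda>t. Complex (f t) (g t)) has_vector_derivative Complex f' g') (at t within S)"
proof -
  have "((\<lambda>t. of_real (f t) + \<i> * of_real (g t)) has_vector_derivative (of_real f' + \<i> * of_real g')) (at t within S)"
    using assms
    by (intro has_vector_derivative_add has_vector_derivative_mult_right has_vector_derivative_of_real)
  then show ?thesis by (simp add: Complex_eq)
qed

lemma ellipse_derivative:
  "(ellipse a b has_vector_derivative ellipse' a b \<theta>) (at \<theta> within S)"
  unfolding ellipse_def [abs_def] ellipse'_def
  by (rule has_vector_derivative_Complex) (auto intro!: derivative_eq_intros)

lemma continuous_on_ellipse [continuous_intros]:
  fixes f :: "'a::t2_space \<Rightarrow> real"
  shows
  "continuous_on S f \<Longrightarrow> continuous_on S (\<lambda>x. ellipse a b (f x))"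
  "continuous_on S f \<Longrightarrow> continuous_on S (\<lambda>x. ellipse' a b (f x))"
  unfolding ellipse_def ellipse'_def by (auto intro!: continuous_intros)

lemma norm_ellipse_le:
  assumes "0 < a" "a \<le> 1" "0 < b" "b \<le> 1"
  shows "norm (ellipse a b \<theta>) \<le> 1" and "norm (ellipse' a b \<theta>) \<le> 1"
proof -
  have ab: "a\<^sup>2 \<le> 1" "b\<^sup>2 \<le> 1" using assms by (auto simp: power_le_one)
  have "(a * cos \<theta>)\<^sup>2 + (b * sin \<theta>)\<^sup>2 \<le> (cos \<theta>)\<^sup>2 + (sin \<theta>)\<^sup>2"
    unfolding power_mult_distrib using ab by (intro add_mono mult_left_le_one_le) auto
  then show "norm (ellipse a b \<theta>) \<le> 1" by (simp add: ellipse_def cmod_def)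
  have "(a * sin \<theta>)\<^sup>2 + (b * cos \<theta>)\<^sup>2 \<le> (sin \<theta>)\<^sup>2 + (cos \<theta>)\<^sup>2"
    unfolding power_mult_distrib using ab by (intro add_mono mult_left_le_one_le) auto
  then show "norm (ellipse' a b \<theta>) \<le> 1" by (simp add: ellipse'_def cmod_def)
qed

lemma ellipse_in_cball:
  assumes "0 < a" "a \<le> 1" "0 < b" "b \<le> 1" "0 \<le> r" "r \<le> R"
  shows "z0 + of_real r * ellipse a b \<theta> \<in> cball z0 R"
  using norm_ellipse_le(1)[OF assms(1-4), of \<theta>] assms(5,6)
    mult_mono[of r R "norm (ellipse a b \<theta>)" 1]
  by (auto simp: dist_norm norm_mult)

text \<open>This is the mean value property of holomorphic functions on circles, after a linear change of
  variables. The equation turns the radial derivative of \<open>v\<close> into a multiple of its derivative in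
  the angle, so that the mean over the ellipse of radius \<open>r\<close> does not change with \<open>r\<close>.\<close>

lemma elliptic_mean_value:
  fixes v vx vy :: "complex \<Rightarrow> complex"
  assumes ab: "0 < a" "a \<le> 1" "0 < b" "b \<le> 1" and R: "0 < R"
    and grad: "\<And>z. z \<in> cball z0 R \<Longrightarrow> has_grad v (vx z) (vy z) z"
    and cont: "continuous_on (cball z0 R) vx" "continuous_on (cball z0 R) vy"
    and eq: "\<And>z. z \<in> cball z0 R \<Longrightarrow> of_real a * vx z + \<i> * of_real b * vy z = 0"
    and r: "r \<in> {0..R}"
  shows "integral {0..2*pi} (\<lambda>\<theta>. v (z0 + of_real r * ellipse a b \<theta>)) = 2 * pi * v z0"
proof -
  let ?e = "\<lambda>r \<theta>. z0 + of_real r * ellipse a b \<theta>"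
  have mem: "?e r \<theta> \<in> cball z0 R" if "r \<in> {0..R}" for r \<theta>
    using ellipse_in_cball[OF ab, of r R z0 \<theta>] that by simp
  have cv: "continuous_on (cball z0 R) v"
    using grad has_grad_imp_continuous by (blast intro: continuous_at_imp_continuous_on)
  have cont': "continuous_on ({0..R} \<times> {0..2*pi}) (\<lambda>p. f (?e (fst p) (snd p)))"
    if "continuous_on (cball z0 R) f" for f :: "complex \<Rightarrow> complex"
    by (rule continuous_on_compose2[OF that]) (use mem in \<open>auto intro!: continuous_intros\<close>)
  have cr: "continuous_on {0..2*pi} (\<lambda>\<theta>. v (?e r \<theta>))" if "r \<in> {0..R}" for r
    by (rule continuous_on_compose2[OF cv]) (use mem that in \<open>auto intro!: continuous_intros\<close>)
  define m where "m = (\<lambda>r. integral {0..2*pi} (\<lambda>\<theta>. v (?e r \<theta>)))"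
  define Bt where "Bt = (\<lambda>\<theta> r. Re (ellipse a b \<theta>) *\<^sub>R vx (?e r \<theta>) + Im (ellipse a b \<theta>) *\<^sub>R vy (?e r \<theta>))"
  define Dt where "Dt = (\<lambda>\<theta> r. Re (r * ellipse' a b \<theta>) *\<^sub>R vx (?e r \<theta>) + Im (r * ellipse' a b \<theta>) *\<^sub>R vy (?e r \<theta>))"
  have Bt: "((\<lambda>r. v (?e r \<theta>)) has_vector_derivative Bt \<theta> r) (at r within {0..R})" if "r \<in> {0..R}" for r \<theta>
    unfolding Bt_def
    by (rule has_grad_along_curve[OF grad])
      (use mem that in \<open>auto intro!: has_vector_derivative_eq_rhs derivative_intros simp: has_vector_derivative_def scaleR_conv_of_real intro!: derivative_eq_intros\<close>)
  have Dt: "((\<lambda>\<theta>. v (?e r \<theta>)) has_vector_derivative Dt \<theta> r) (at \<theta> within S)" if "r \<in> {0..R}" for r \<theta> S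
  proof -
    have "((\<lambda>\<theta>. ?e r \<theta>) has_vector_derivative 0 + of_real r * ellipse' a b \<theta>) (at \<theta> within S)"
      by (intro has_vector_derivative_add has_vector_derivative_const has_vector_derivative_mult_right ellipse_derivative)
    then show ?thesis unfolding Dt_def
      by (intro has_grad_along_curve[OF grad]) (use mem that in auto)
  qed
  have cm: "continuous_on {0..R} m"
    unfolding m_def cbox_interval[symmetric]
    by (rule integral_continuous_on_param) (use cont'[OF cv] in \<open>simp add: split_beta\<close>)
  have m0: "m 0 = 2 * pi * v z0" unfolding m_def by (simp add: scaleR_conv_of_real)
  have der: "(m has_vector_derivative 0) (at r within {0..R})" if r: "r \<in> {0..R} - {0}" for r
  proof -
    have r': "r \<in> {0..R}" "r > 0" using r by auto
    have "(m has_vector_derivative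
      integral {0..2*pi} (\<lambda>\<theta>. (\<i> / of_real r) * Dt \<theta> r + Bt \<theta> r) - ((\<i> / of_real r) * v (?e r (2*pi)) - (\<i> / of_real r) * v (?e r 0))) (at r within {0..R})"
      unfolding m_def
    proof (rule flux_derivative)
      show "((\<lambda>\<theta>. \<i> / complex_of_real r * v (?e r \<theta>)) has_vector_derivative \<i> / complex_of_real r * Dt \<theta> r) (at \<theta> within {0..2 * pi})" for \<theta>
        by (intro has_vector_derivative_mult_right Dt r')
      show "continuous_on ({0..R} \<times> {0..2 * pi}) (\<lambda>(t, x). Bt x t)"
        unfolding Bt_def split_beta by (intro continuous_intros cont' cont)
    qed (use Bt r' cr in auto)
    moreover have "(\<i> / of_real r) * Dt \<theta> r + Bt \<theta> r = 0" for \<theta>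
    proof -
      define p where "p = vx (?e r \<theta>)"
      define q where "q = vy (?e r \<theta>)"
      have "of_real a * p + \<i> * of_real b * q = 0" using eq mem r' unfolding p_def q_def by blast
      then have bq: "of_real b * q = \<i> * of_real a * p" by (simp add: complex_eq_iff)
      have "(\<i> / of_real r) * Dt \<theta> r + Bt \<theta> r = \<i> * (- of_real a * of_real (sin \<theta>) * p + of_real (cos \<theta>) * (of_real b * q))
         + of_real a * of_real (cos \<theta>) * p + of_real (sin \<theta>) * (of_real b * q)"
        using r' unfolding Dt_def Bt_def p_def[symmetric] q_def[symmetric]
        by (simp add: scaleR_conv_of_real field_simps)
      also have "\<dots> = 0" unfolding bq by (simp add: complex_eq_iff algebra_simps)
      finally show ?thesis .
    qed
    moreover have "?e r (2*pi) = ?e r 0" by (simp add: ellipse_def)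
    ultimately show ?thesis by simp
  qed
  have "m r = 2 * pi * v z0"
    by (rule has_derivative_zero_unique_strong_interval[of "{0}" 0 R m])
      (use cm m0 der r in \<open>auto simp: has_vector_derivative_def\<close>)
  then show ?thesis by (simp add: m_def)
qed

text \<open>By Green's formula, the integral of \<open>v\<close> over the elliptic disc is a boundary integral of \<open>f\<close>,
  hence \<open>O(B R)\<close>. By the mean value property it is also \<open>v(z\<^sub>0)\<close> times the area, which is of order
  \<open>R\<^sup>2\<close>. In the proof \<open>n(r)\<close> is the boundary integral of \<open>f dz\<close> over the ellipse of radius \<open>r\<close>.\<close>

lemma elliptic_gradient_bound:
  fixes f v vx vy :: "complex \<Rightarrow> complex"
  assumes ab: "0 < a" "a \<le> 1" "0 < b" "b \<le> 1" and R: "0 < R"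
    and gradf: "\<And>z. z \<in> cball z0 R \<Longrightarrow> has_grad f (fx z) (fy z) z"
    and contf: "continuous_on (cball z0 R) fx" "continuous_on (cball z0 R) fy"
    and v: "\<And>z. z \<in> cball z0 R \<Longrightarrow> v z = (fx z + \<i> * fy z) / 2"
    and grad: "\<And>z. z \<in> cball z0 R \<Longrightarrow> has_grad v (vx z) (vy z) z"
    and cont: "continuous_on (cball z0 R) vx" "continuous_on (cball z0 R) vy"
    and eq: "\<And>z. z \<in> cball z0 R \<Longrightarrow> of_real a * vx z + \<i> * of_real b * vy z = 0"
    and bound: "\<And>z. z \<in> cball z0 R \<Longrightarrow> norm (f z) \<le> B"
  shows "norm (v z0) \<le> B / (a * b * R)"
proof -
  let ?e = "\<lambda>r \<theta>. z0 + of_real r * ellipse a b \<theta>"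
  have mem: "?e r \<theta> \<in> cball z0 R" if "r \<in> {0..R}" for r \<theta>
    using ellipse_in_cball[OF ab, of r R z0 \<theta>] that by simp
  have cf: "continuous_on (cball z0 R) f"
    using gradf has_grad_imp_continuous by (blast intro: continuous_at_imp_continuous_on)
  have cont': "continuous_on ({0..R} \<times> {0..2*pi}) (\<lambda>p. f (?e (fst p) (snd p)))"
    if "continuous_on (cball z0 R) f" for f :: "complex \<Rightarrow> complex"
    by (rule continuous_on_compose2[OF that]) (use mem in \<open>auto intro!: continuous_intros\<close>)
  have cr: "continuous_on {0..2*pi} (\<lambda>\<theta>. f (?e r \<theta>))" if "r \<in> {0..R}" for r
    by (rule continuous_on_compose2[OF cf]) (use mem that in \<open>auto intro!: continuous_intros\<close>)
  let ?B = "\<lambda>\<theta> r. of_real r * (f (?e r \<theta>) * ellipse' a b \<theta>)"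
  let ?A = "\<lambda>\<theta> r. - (f (?e r \<theta>) * ellipse a b \<theta>)"
  define n where "n = (\<lambda>r. integral {0..2*pi} (\<lambda>\<theta>. ?B \<theta> r))"
  define Fr where "Fr = (\<lambda>\<theta> r. Re (ellipse a b \<theta>) *\<^sub>R fx (?e r \<theta>) + Im (ellipse a b \<theta>) *\<^sub>R fy (?e r \<theta>))"
  define Ft where "Ft = (\<lambda>\<theta> r. Re (r * ellipse' a b \<theta>) *\<^sub>R fx (?e r \<theta>) + Im (r * ellipse' a b \<theta>) *\<^sub>R fy (?e r \<theta>))"
  define Bt where "Bt = (\<lambda>\<theta> r. of_real r * (Fr \<theta> r * ellipse' a b \<theta>) + f (?e r \<theta>) * ellipse' a b \<theta>)"
  define At where "At = (\<lambda>\<theta> r. - (f (?e r \<theta>) * ellipse' a b \<theta> + Ft \<theta> r * ellipse a b \<theta>))"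
  have Fr: "((\<lambda>r. f (?e r \<theta>)) has_vector_derivative Fr \<theta> r) (at r within {0..R})" if "r \<in> {0..R}" for r \<theta>
    unfolding Fr_def
    by (rule has_grad_along_curve[OF gradf])
      (use mem that in \<open>auto intro!: has_vector_derivative_eq_rhs derivative_intros simp: has_vector_derivative_def scaleR_conv_of_real intro!: derivative_eq_intros\<close>)
  have Bt: "((\<lambda>r. ?B \<theta> r) has_vector_derivative Bt \<theta> r) (at r within {0..R})" if "r \<in> {0..R}" for r \<theta>
  proof -
    have r: "((\<lambda>r. complex_of_real r) has_vector_derivative 1) (at r within {0..R})"
      using has_vector_derivative_of_real[of "\<lambda>r. r" 1] by (simp add: DERIV_ident has_real_derivative_iff_has_vector_derivative[symmetric])
    show ?thesis
      using has_vector_derivative_mult[OF r has_vector_derivative_mult_left[OF Fr[OF that, of \<theta>], of "ellipse' a b \<theta>"]]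
      unfolding Bt_def by (simp add: algebra_simps)
  qed
  have At: "((\<lambda>\<theta>. ?A \<theta> r) has_vector_derivative At \<theta> r) (at \<theta> within S)" if "r \<in> {0..R}" for r \<theta> S
  proof -
    have "((\<lambda>\<theta>. ?e r \<theta>) has_vector_derivative 0 + of_real r * ellipse' a b \<theta>) (at \<theta> within S)"
      by (intro has_vector_derivative_add has_vector_derivative_const has_vector_derivative_mult_right ellipse_derivative)
    then have "((\<lambda>\<theta>. f (?e r \<theta>)) has_vector_derivative Ft \<theta> r) (at \<theta> within S)" unfolding Ft_def
      by (intro has_grad_along_curve[OF gradf]) (use mem that in auto)
    from has_vector_derivative_minus[OF has_vector_derivative_mult[OF this ellipse_derivative]]
    show ?thesis unfolding At_def .
  qed
  have key: "At \<theta> r + Bt \<theta> r = 2 * \<i> * of_real (a * b * r) * v (?e r \<theta>)" if "r \<in> {0..R}" for r \<theta>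
  proof -
    define p where "p = fx (?e r \<theta>)"
    define q where "q = fy (?e r \<theta>)"
    define s where "s = complex_of_real (sin \<theta>)"
    define c where "c = complex_of_real (cos \<theta>)"
    have sc: "s\<^sup>2 + c\<^sup>2 = 1" unfolding s_def c_def
      by (metis of_real_1 of_real_add of_real_power sin_cos_squared_add)
    have E: "ellipse a b \<theta> = a * c + \<i> * (b * s)" "ellipse' a b \<theta> = - a * s + \<i> * (b * c)"
      unfolding ellipse_def ellipse'_def s_def c_def by (auto simp: Complex_eq)
    have F: "Fr \<theta> r = a * c * p + b * s * q" "Ft \<theta> r = r * (- a * s * p + b * c * q)"
      unfolding Fr_def Ft_def p_def[symmetric] q_def[symmetric] s_def c_def
      by (simp_all add: scaleR_conv_of_real algebra_simps)
    have "At \<theta> r + Bt \<theta> r = of_real r * ((a * c * p + b * s * q) * (- a * s + \<i> * (b * c))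
          - (- a * s * p + b * c * q) * (a * c + \<i> * (b * s)))"
      unfolding At_def Bt_def F E by (simp add: algebra_simps)
    also have "\<dots> = of_real (a * b * r) * (\<i> * p - q) * (s\<^sup>2 + c\<^sup>2)"
      by (simp add: algebra_simps power2_eq_square)
    also have "\<dots> = 2 * \<i> * of_real (a * b * r) * v (?e r \<theta>)"
      using v[OF mem[OF that, of \<theta>]] unfolding sc p_def q_def by (simp add: field_simps)
    finally show ?thesis .
  qed
  \<comment> \<open>With this value, \<open>n' (r) = r V\<close> by the mean value property.\<close>
  define V where "V = 2 * \<i> * of_real (a * b) * (2 * pi * v z0)"
  have der: "(n has_vector_derivative of_real r * V) (at r within {0..R})" if r: "r \<in> {0..R}" for r
  proof -
    have "(n has_vector_derivative
      integral {0..2*pi} (\<lambda>\<theta>. At \<theta> r + Bt \<theta> r) - (?A (2*pi) r - ?A 0 r)) (at r within {0..R})"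
      unfolding n_def
    proof (rule flux_derivative)
      show "continuous_on ({0..R} \<times> {0..2 * pi}) (\<lambda>(t, x). Bt x t)"
        unfolding Bt_def Fr_def split_beta by (intro continuous_intros cont' contf cf)
    qed (use At Bt r cr in \<open>auto intro!: continuous_intros\<close>)
    moreover have "?A (2*pi) r - ?A 0 r = 0" by (simp add: ellipse_def)
    moreover have "integral {0..2*pi} (\<lambda>\<theta>. At \<theta> r + Bt \<theta> r) = of_real r * V"
      unfolding key[OF r] V_def using elliptic_mean_value[OF ab R grad cont eq r] by simp
    ultimately show ?thesis by simp
  qed
  have "n R - of_real (R\<^sup>2 / 2) * V = 0"
  proof (rule has_derivative_zero_unique_strong_interval[of "{}" 0 R "\<lambda>r. n r - of_real (r\<^sup>2 / 2) * V"])
    have d: "((\<lambda>r. n r - of_real (r\<^sup>2 / 2) * V) has_vector_derivative of_real r * V - of_real r * V) (at r within {0..R})" if "r \<in> {0..R}" for r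
    proof (intro has_vector_derivative_diff der that has_vector_derivative_mult_left has_vector_derivative_of_real)
      show "((\<lambda>x. x\<^sup>2 / 2) has_real_derivative r) (at r within {0..R})"
        by (auto intro!: derivative_eq_intros)
    qed
    then show "continuous_on {0..R} (\<lambda>r. n r - of_real (r\<^sup>2 / 2) * V)"
      unfolding continuous_on_eq_continuous_within by (blast intro: has_vector_derivative_continuous)
    show "((\<lambda>r. n r - of_real (r\<^sup>2 / 2) * V) has_derivative (\<lambda>h. 0)) (at x within {0..R})" if "x \<in> {0..R} - {}" for x
      using d[of x] that by (simp add: has_vector_derivative_def)
    show "n 0 - of_real (0\<^sup>2 / 2) * V = 0" by (simp add: n_def)
  qed (use R in auto)
  then have "n R = 2 * pi * \<i> * of_real (a * b * R\<^sup>2) * v z0"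
    unfolding V_def by (simp add: field_simps)
  then have "2 * pi * (a * b * R\<^sup>2) * norm (v z0) = norm (n R)"
    using ab R by (simp add: norm_mult norm_power abs_mult)
  also have "norm (n R) \<le> R * B * (2 * pi - 0)"
    unfolding n_def
  proof (rule integral_bound)
    show "continuous_on {0..2 * pi} (\<lambda>\<theta>. ?B \<theta> R)" using R by (intro continuous_intros cr) auto
    show "norm (?B \<theta> R) \<le> R * B" for \<theta>
      using mult_mono[OF bound[OF mem[of R \<theta>]] norm_ellipse_le(2)[OF ab, of \<theta>]] R
        norm_ge_zero order_trans[OF norm_ge_zero bound[OF mem[of R \<theta>]]]
      by (auto simp: norm_mult intro!: mult_left_mono)
  qed simp
  finally have "(a * b * R) * norm (v z0) * (2 * pi * R) \<le> B * (2 * pi * R)"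
    by (simp add: power2_eq_square algebra_simps)
  then have "(a * b * R) * norm (v z0) \<le> B" using R by (simp add: mult_le_cancel_right)
  then show ?thesis using ab R by (simp add: field_simps)
qed

lemma inverse_along_curve:
  assumes "(g has_vector_derivative g') (at t within S)" "g t \<noteq> (0::complex)"
  shows "((\<lambda>t. a / g t) has_vector_derivative - a * g' / (g t)\<^sup>2) (at t within S)"
proof -
  have "((\<lambda>z. a / z) has_field_derivative - a / (g t)\<^sup>2) (at (g t) within g ` S)"
    using assms(2) by (auto intro!: derivative_eq_intros simp: power2_eq_square field_simps)
  from field_vector_diff_chain_within[OF assms(1) this]
  show ?thesis by (simp add: o_def mult.commute)
qed

lemma Ln_along_curve:
  assumes "(g has_vector_derivative g') (at t within S)" "0 < Im (g t)"
  shows "((\<lambda>t. Ln (- \<i> * g t)) has_vector_derivative g' / g t) (at t within S)"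
proof -
  have "((\<lambda>z. Ln (- \<i> * z)) has_field_derivative 1 / g t) (at (g t) within g ` S)"
    using assms(2) by (auto intro!: derivative_eq_intros simp: complex_nonpos_Reals_iff field_simps)
  from field_vector_diff_chain_within[OF assms(1) this]
  show ?thesis by (simp add: o_def)
qed

section \<open>Divided differences and kernels at a boundary graph\<close>

text \<open>The boundary near its lowest point, which has abscissa \<open>0\<close>. The points above it are described by
  the coordinates \<open>x\<close> and \<open>t = y - \<phi>(x)\<close>, so that \<open>\<partial>\<^sub>y\<close> becomes \<open>\<partial>\<^sub>t\<close> and \<open>\<partial>\<^sub>x\<close> becomes
  \<open>\<partial>\<^sub>x - \<phi>' \<partial>\<^sub>t\<close>. Only \<open>|x| \<le> r\<close> and \<open>0 \<le> t \<le> r\<close> occur; the interval for \<open>\<phi>\<close> is longer on the right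
  because \<open>\<phi>(x + t)\<close> is needed.\<close>

locale boundary_graph =
  fixes \<phi> \<phi>' :: "real \<Rightarrow> real" and \<alpha> C r :: real
  assumes alpha: "0 < \<alpha>" "\<alpha> < 1" and r_pos: "0 < r"
    and deriv: "x \<in> {-r..2*r} \<Longrightarrow> (\<phi> has_real_derivative \<phi>' x) (at x)"
    and holder: "x \<in> {-r..2*r} \<Longrightarrow> y \<in> {-r..2*r} \<Longrightarrow> \<bar>\<phi>' x - \<phi>' y\<bar> \<le> C * \<bar>x - y\<bar> powr \<alpha>"
    and slope: "x \<in> {-r..2*r} \<Longrightarrow> \<bar>\<phi>' x\<bar> \<le> 1"
    and nonneg: "x \<in> {-r..2*r} \<Longrightarrow> 0 \<le> \<phi> x"
    and slope_0: "\<phi>' 0 = 0"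
begin

text \<open>An extension of \<open>\<phi>'\<close> to the points above the graph. Unlike \<open>\<phi>'\<close> it is differentiable, at the
  cost of derivatives of size \<open>t\<^bsup>\<alpha>-1\<^esup>\<close>.\<close>

definition q :: "real \<Rightarrow> real \<Rightarrow> real" where
  "q x t = (\<phi> (x + t) - \<phi> x) / t"

lemma C_nonneg: "0 \<le> C"
proof -
  have "0 \<le> C * \<bar>0 - r\<bar> powr \<alpha>" using holder[of 0 r] r_pos by (auto intro: order_trans[OF abs_ge_zero])
  then show ?thesis using r_pos by (simp add: zero_le_mult_iff)
qed

lemma q_eq_slope:
  assumes "x \<in> {-r..r}" "t \<in> {0<..r}"
  obtains \<xi> where "x < \<xi>" "\<xi> < x + t" "q x t = \<phi>' \<xi>"
proof -
  have "\<exists>\<xi>>x. \<xi> < x + t \<and> \<phi> (x + t) - \<phi> x = (x + t - x) * \<phi>' \<xi>"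
    by (rule MVT2) (use assms deriv in auto)
  then show ?thesis using that assms by (auto simp: q_def)
qed

lemma
  assumes x: "x \<in> {-r..r}" and t: "t \<in> {0<..r}"
  shows q_close_left: "\<bar>q x t - \<phi>' x\<bar> \<le> C * t powr \<alpha>"
    and q_close_right: "\<bar>\<phi>' (x + t) - q x t\<bar> \<le> C * t powr \<alpha>"
    and abs_q_le_1: "\<bar>q x t\<bar> \<le> 1"
    and abs_q_le: "\<bar>q x t\<bar> \<le> C * (\<bar>x\<bar> + t) powr \<alpha>"
proof -
  obtain \<xi> where \<xi>: "x < \<xi>" "\<xi> < x + t" "q x t = \<phi>' \<xi>" using q_eq_slope assms by blast
  have mono: "C * a powr \<alpha> \<le> C * b powr \<alpha>" if "0 \<le> a" "a \<le> b" for a b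
    using that alpha C_nonneg by (intro mult_left_mono powr_mono2) auto
  show "\<bar>q x t - \<phi>' x\<bar> \<le> C * t powr \<alpha>"
    using holder[of \<xi> x] mono[of "\<bar>\<xi> - x\<bar>" t] \<xi> x t by auto
  show "\<bar>\<phi>' (x + t) - q x t\<bar> \<le> C * t powr \<alpha>"
    using holder[of "x + t" \<xi>] mono[of "\<bar>x + t - \<xi>\<bar>" t] \<xi> x t by auto
  show "\<bar>q x t\<bar> \<le> 1" using slope[of \<xi>] \<xi> x t by auto
  show "\<bar>q x t\<bar> \<le> C * (\<bar>x\<bar> + t) powr \<alpha>"
    using holder[of \<xi> 0] mono[OF abs_ge_zero, of \<xi> "\<bar>x\<bar> + t"] \<xi> x t slope_0 r_pos by (auto simp: abs_if split: if_splits)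
qed

lemma q_derivatives:
  assumes x: "x \<in> {-r..r}" and t: "t \<in> {0<..r}"
  shows "((\<lambda>x. q x t) has_real_derivative (\<phi>' (x + t) - \<phi>' x) / t) (at x within S)"
    and "((\<lambda>t. q x t) has_real_derivative (\<phi>' (x + t) - q x t) / t) (at t within S)"
proof -
  have D: "((\<lambda>x. \<phi> (x + t)) has_real_derivative \<phi>' (x + t)) (at x within S)"
    "((\<lambda>t. \<phi> (x + t)) has_real_derivative \<phi>' (x + t)) (at t within S)"
  proof -
    have "((\<lambda>x. x + t) has_real_derivative 1) (at x within S)"
      "((\<lambda>t. x + t) has_real_derivative 1) (at t within S)"
      by (auto intro!: derivative_eq_intros)
    then show "((\<lambda>x. \<phi> (x + t)) has_real_derivative \<phi>' (x + t)) (at x within S)"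
      "((\<lambda>t. \<phi> (x + t)) has_real_derivative \<phi>' (x + t)) (at t within S)"
      using DERIV_chain2[of \<phi> "\<phi>' (x + t)" "\<lambda>x. x + t" x 1 S]
        DERIV_chain2[of \<phi> "\<phi>' (x + t)" "\<lambda>t. x + t" t 1 S] deriv[of "x + t"] x t by auto
  qed
  have "(\<phi> has_real_derivative \<phi>' x) (at x within S)"
    by (rule has_field_derivative_at_within[OF deriv]) (use x r_pos in auto)
  from DERIV_cdivide[OF DERIV_diff[OF D(1) this], of t]
  show "((\<lambda>x. q x t) has_real_derivative (\<phi>' (x + t) - \<phi>' x) / t) (at x within S)"
    unfolding q_def by simp
  show "((\<lambda>t. q x t) has_real_derivative (\<phi>' (x + t) - q x t) / t) (at t within S)"
  proof -
    have "((\<lambda>t. (\<phi> (x + t) - \<phi> x) / t) has_real_derivative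
        ((\<phi>' (x + t) - 0) * t - (\<phi> (x + t) - \<phi> x) * 1) / (t * t)) (at t within S)"
      by (intro DERIV_divide DERIV_diff D DERIV_const DERIV_ident) (use t in auto)
    moreover have "((\<phi>' (x + t) - 0) * t - (\<phi> (x + t) - \<phi> x) * 1) / (t * t) = (\<phi>' (x + t) - q x t) / t"
      unfolding q_def using t by (simp add: diff_divide_distrib)
    ultimately show ?thesis unfolding q_def by simp
  qed
qed

lemma continuous_slope: "continuous_on {-r..2*r} \<phi>'"
proof -
  have "continuous (at x within {-r..2*r}) \<phi>'" if x: "x \<in> {-r..2*r}" for x
  proof -
    have "((\<lambda>y. C * \<bar>y - x\<bar> powr \<alpha>) \<longlongrightarrow> C * \<bar>x - x\<bar> powr \<alpha>) (at x within {-r..2*r})"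
      using alpha by (intro tendsto_intros) auto
    then have lim: "((\<lambda>y. C * \<bar>y - x\<bar> powr \<alpha>) \<longlongrightarrow> 0) (at x within {-r..2*r})" by simp
    have "((\<lambda>y. \<phi>' y - \<phi>' x) \<longlongrightarrow> 0) (at x within {-r..2*r})"
      by (rule tendsto_rabs_zero_cancel, rule tendsto_sandwich[OF _ _ tendsto_const lim])
        (use holder x in \<open>auto simp: eventually_at_filter\<close>)
    then show ?thesis by (simp add: continuous_within LIM_zero_iff)
  qed
  then show ?thesis by (simp add: continuous_on_eq_continuous_within)
qed

lemma continuous_graph: "continuous_on {-r..2*r} \<phi>"
  using deriv by (blast intro: DERIV_isCont continuous_at_imp_continuous_on)

end

text \<open>Here \<open>c = (1-\<tau>)/2\<close> and \<open>d = (1+\<tau>)/2\<close>, so that \<open>\<partial>\<^sub>\<tau> = d \<partial>\<^sub>x + \<i> c \<partial>\<^sub>y\<close>. The pole of the kernels is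
  the point at depth \<open>s\<close> below the origin; the bounds below do not depend on \<open>s\<close>, except for those
  with \<open>s\<close> in their statement.\<close>

locale boundary_kernel = boundary_graph +
  fixes c \<beta> s :: real
  assumes c_pos: "0 < c" and beta_nonneg: "0 \<le> \<beta>" and c_le: "c * (1 + \<beta>) \<le> 1" and s_pos: "0 < s"
begin

abbreviation d :: real where "d \<equiv> c * (1 + \<beta>)"

text \<open>The position relative to the pole: \<open>\<zeta>\<close> is the point itself, and \<open>\<omega>\<close> agrees with \<open>\<zeta>\<close> on the graph.
  For a straight boundary \<open>\<omega>\<close> is annihilated by \<open>\<partial>\<^sub>\<tau>\<close>, that is, it depends only on the second
  characteristic variable.\<close>

definition \<zeta> :: "real \<Rightarrow> real \<Rightarrow> complex" where
  "\<zeta> x t = Complex x (\<phi> x + t + s)"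

definition \<omega> :: "real \<Rightarrow> real \<Rightarrow> complex" where
  "\<omega> x t = Complex x (\<phi> x + t + s + \<beta> * t)"

text \<open>The function \<open>N\<close> vanishes on the graph. The factor \<open>-\<i>\<close> moves the upper half plane, which contains
  \<open>\<zeta>\<close> and \<open>\<omega>\<close>, into the domain of the principal logarithm. The value for \<open>\<beta> = 0\<close> is the limit, which
  makes the formulas for the derivatives and the bounds the same for all \<open>\<beta>\<close>.\<close>

definition N :: "real \<Rightarrow> real \<Rightarrow> complex" where
  "N x t = (if \<beta> = 0 then - \<i> * t / \<zeta> x t else (Ln (- \<i> * \<zeta> x t) - Ln (- \<i> * \<omega> x t)) / \<beta>)"

text \<open>In the coordinates of the locale \<open>\<partial>\<^sub>\<tau> N = c / \<zeta> + \<i> d \<phi>' / \<omega>\<close>; this is the same expression with \<open>q\<close>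
  in place of \<open>\<phi>'\<close>, which can be differentiated once more.\<close>

definition Q :: "real \<Rightarrow> real \<Rightarrow> complex" where
  "Q x t = c / \<zeta> x t + \<i> * d * q x t / \<omega> x t"

lemma \<omega>_eq: "\<omega> x t = \<zeta> x t + \<i> * \<beta> * t"
  by (simp add: \<omega>_def \<zeta>_def complex_eq_iff)

lemma d_pos: "0 < d" using c_pos beta_nonneg by simp

lemma c_le_1: "c \<le> 1" 
proof -
  have "c * 1 \<le> c * (1 + \<beta>)" using c_pos beta_nonneg by (intro mult_left_mono) auto
  then show ?thesis using c_le by linarith
qed

lemma
  assumes "x \<in> {-r..r}" "0 \<le> t"
  shows norm_\<zeta>_ge: "(\<bar>x\<bar> + t) / 2 \<le> norm (\<zeta> x t)" and norm_\<zeta>_ge_s: "s \<le> norm (\<zeta> x t)"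
    and norm_\<omega>_ge: "(\<bar>x\<bar> + t) / 2 \<le> norm (\<omega> x t)" and norm_\<omega>_ge_s: "s \<le> norm (\<omega> x t)"
    and \<zeta>_nz: "\<zeta> x t \<noteq> 0" and \<omega>_nz: "\<omega> x t \<noteq> 0"
proof -
  have p: "0 \<le> \<phi> x" "0 \<le> \<beta> * t" using nonneg[of x] assms beta_nonneg r_pos by auto
  show "(\<bar>x\<bar> + t) / 2 \<le> norm (\<zeta> x t)" "s \<le> norm (\<zeta> x t)"
    using abs_Re_le_cmod[of "\<zeta> x t"] abs_Im_le_cmod[of "\<zeta> x t"] p s_pos assms by (auto simp: \<zeta>_def)
  show "(\<bar>x\<bar> + t) / 2 \<le> norm (\<omega> x t)" "s \<le> norm (\<omega> x t)"
    using abs_Re_le_cmod[of "\<omega> x t"] abs_Im_le_cmod[of "\<omega> x t"] p s_pos assms by (auto simp: \<omega>_def)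
  show "\<zeta> x t \<noteq> 0" "\<omega> x t \<noteq> 0" using p assms s_pos by (auto simp: \<zeta>_def \<omega>_def complex_eq_iff)
qed

lemma \<zeta>_derivatives:
  assumes "x \<in> {-r..r}"
  shows "((\<lambda>x. \<zeta> x t) has_vector_derivative 1 + \<i> * \<phi>' x) (at x within S)"
    and "((\<lambda>t. \<zeta> x t) has_vector_derivative \<i>) (at t within S)"
proof -
  have D: "(\<phi> has_real_derivative \<phi>' x) (at x within S)"
    by (rule has_field_derivative_at_within[OF deriv]) (use assms r_pos in auto)
  have "((\<lambda>x. \<zeta> x t) has_vector_derivative Complex 1 (\<phi>' x)) (at x within S)"
    unfolding \<zeta>_def by (rule has_vector_derivative_Complex) (auto intro!: derivative_eq_intros D)
  then show "((\<lambda>x. \<zeta> x t) has_vector_derivative 1 + \<i> * \<phi>' x) (at x within S)"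
    by (simp add: Complex_eq)
  have "((\<lambda>t. \<zeta> x t) has_vector_derivative Complex 0 1) (at t within S)"
    unfolding \<zeta>_def by (rule has_vector_derivative_Complex) (auto intro!: derivative_eq_intros)
  then show "((\<lambda>t. \<zeta> x t) has_vector_derivative \<i>) (at t within S)"
    by (simp add: Complex_eq)
qed

lemma \<omega>_derivatives:
  assumes "x \<in> {-r..r}"
  shows "((\<lambda>x. \<omega> x t) has_vector_derivative 1 + \<i> * \<phi>' x) (at x within S)"
    and "((\<lambda>t. \<omega> x t) has_vector_derivative \<i> * (1 + \<beta>)) (at t within S)"
proof -
  have D: "(\<phi> has_real_derivative \<phi>' x) (at x within S)"
    by (rule has_field_derivative_at_within[OF deriv]) (use assms r_pos in auto)
  have "((\<lambda>x. \<omega> x t) has_vector_derivative Complex 1 (\<phi>' x)) (at x within S)"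
    unfolding \<omega>_def by (rule has_vector_derivative_Complex) (auto intro!: derivative_eq_intros D)
  then show "((\<lambda>x. \<omega> x t) has_vector_derivative 1 + \<i> * \<phi>' x) (at x within S)"
    by (simp add: Complex_eq)
  have "((\<lambda>t. \<omega> x t) has_vector_derivative Complex 0 (1 + \<beta>)) (at t within S)"
    unfolding \<omega>_def by (rule has_vector_derivative_Complex) (auto intro!: derivative_eq_intros)
  then show "((\<lambda>t. \<omega> x t) has_vector_derivative \<i> * (1 + \<beta>)) (at t within S)"
    by (simp add: Complex_eq)
qed

lemma Im_pos:
  assumes "x \<in> {-r..r}" "0 \<le> t"
  shows "0 < Im (\<zeta> x t)" "0 < Im (\<omega> x t)"
  using nonneg[of x] assms beta_nonneg r_pos s_pos by (auto simp: \<zeta>_def \<omega>_def add_nonneg_pos add_pos_nonneg)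

lemma N_derivatives:
  assumes x: "x \<in> {-r..r}" and t: "0 \<le> t"
  shows "((\<lambda>x. N x t) has_vector_derivative \<i> * t * (1 + \<i> * \<phi>' x) / (\<zeta> x t * \<omega> x t)) (at x within S)"
    and "((\<lambda>t. N x t) has_vector_derivative - (t / \<zeta> x t + \<i>) / \<omega> x t) (at t within S)"
proof -
  note nz = \<zeta>_nz[OF x t] \<omega>_nz[OF x t]
  have "((\<lambda>x. N x t) has_vector_derivative \<i> * t * (1 + \<i> * \<phi>' x) / (\<zeta> x t * \<omega> x t)) (at x within S)
      \<and> ((\<lambda>t. N x t) has_vector_derivative - (t / \<zeta> x t + \<i>) / \<omega> x t) (at t within S)"
  proof (cases "\<beta> = 0")
    case True
    have \<omega>: "\<omega> x t = \<zeta> x t" by (simp only: \<omega>_eq) (simp add: True)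
    have "((\<lambda>x. (- \<i> * t) / \<zeta> x t) has_vector_derivative - (- \<i> * t) * (1 + \<i> * \<phi>' x) / (\<zeta> x t)\<^sup>2) (at x within S)"
      by (intro inverse_along_curve \<zeta>_derivatives x nz)
    moreover have "((\<lambda>t. complex_of_real t * (- \<i> / \<zeta> x t)) has_vector_derivative
        t * (- (- \<i>) * \<i> / (\<zeta> x t)\<^sup>2) + 1 * (- \<i> / \<zeta> x t)) (at t within S)"
      by (intro has_vector_derivative_mult inverse_along_curve \<zeta>_derivatives x nz)
        (auto intro!: derivative_eq_intros has_vector_derivative_eq_rhs[OF has_vector_derivative_of_real])
    moreover have "- (- \<i> * t) * (1 + \<i> * \<phi>' x) / (\<zeta> x t)\<^sup>2 = \<i> * t * (1 + \<i> * \<phi>' x) / (\<zeta> x t * \<zeta> x t)"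
      by (simp add: power2_eq_square)
    moreover have "t * (- (- \<i>) * \<i> / (\<zeta> x t)\<^sup>2) + 1 * (- \<i> / \<zeta> x t) = - (t / \<zeta> x t + \<i>) / \<zeta> x t"
      using nz by (simp add: power2_eq_square add_divide_distrib diff_divide_distrib)
    moreover have "(\<lambda>t. complex_of_real t * (- \<i> / \<zeta> x t)) = (\<lambda>t. - \<i> * t / \<zeta> x t)"
      by (simp add: fun_eq_iff)
    ultimately show ?thesis unfolding N_def \<omega> if_P[OF True] by (simp only:)
  next
    case False
    have "((\<lambda>x. (Ln (- \<i> * \<zeta> x t) - Ln (- \<i> * \<omega> x t)) / \<beta>) has_vector_derivative
       ((1 + \<i> * \<phi>' x) / \<zeta> x t - (1 + \<i> * \<phi>' x) / \<omega> x t) / \<beta>) (at x within S)"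
      by (intro has_vector_derivative_divide has_vector_derivative_diff Ln_along_curve \<zeta>_derivatives \<omega>_derivatives x Im_pos t)
    moreover have "((\<lambda>t. (Ln (- \<i> * \<zeta> x t) - Ln (- \<i> * \<omega> x t)) / \<beta>) has_vector_derivative
       (\<i> / \<zeta> x t - (\<i> * (1 + \<beta>)) / \<omega> x t) / \<beta>) (at t within S)"
      by (intro has_vector_derivative_divide has_vector_derivative_diff Ln_along_curve \<zeta>_derivatives \<omega>_derivatives x Im_pos t)
    moreover have "((1 + \<i> * \<phi>' x) / \<zeta> x t - (1 + \<i> * \<phi>' x) / \<omega> x t) / \<beta> = \<i> * t * (1 + \<i> * \<phi>' x) / (\<zeta> x t * \<omega> x t)"
    proof -
      have "((1 + \<i> * \<phi>' x) / \<zeta> x t - (1 + \<i> * \<phi>' x) / \<omega> x t) = (1 + \<i> * \<phi>' x) * (\<omega> x t - \<zeta> x t) / (\<zeta> x t * \<omega> x t)"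
        using nz by (simp add: field_simps)
      then show ?thesis using False by (simp add: \<omega>_eq)
    qed
    moreover have "(\<i> / \<zeta> x t - (\<i> * (1 + \<beta>)) / \<omega> x t) / \<beta> = - (t / \<zeta> x t + \<i>) / \<omega> x t"
    proof -
      have "\<i> / \<zeta> x t - (\<i> * (1 + \<beta>)) / \<omega> x t = \<i> * (\<omega> x t - \<zeta> x t - \<beta> * \<zeta> x t) / (\<zeta> x t * \<omega> x t)"
        using nz by (simp add: field_simps)
      also have "\<omega> x t - \<zeta> x t - \<beta> * \<zeta> x t = \<beta> * (\<i> * t - \<zeta> x t)" by (simp add: \<omega>_eq algebra_simps)
      finally have "(\<i> / \<zeta> x t - (\<i> * (1 + \<beta>)) / \<omega> x t) / \<beta> = \<i> * (\<i> * t - \<zeta> x t) / (\<zeta> x t * \<omega> x t)"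
        using False by simp
      also have "\<dots> = - (t / \<zeta> x t + \<i>) / \<omega> x t" using nz by (simp add: field_simps)
      finally show ?thesis .
    qed
    ultimately show ?thesis using False by (simp add: N_def)
  qed
  then show "((\<lambda>x. N x t) has_vector_derivative \<i> * t * (1 + \<i> * \<phi>' x) / (\<zeta> x t * \<omega> x t)) (at x within S)"
    and "((\<lambda>t. N x t) has_vector_derivative - (t / \<zeta> x t + \<i>) / \<omega> x t) (at t within S)" by auto
qed

text \<open>The segment from \<open>\<zeta>\<close> to \<open>\<omega>\<close> has length \<open>\<beta> t\<close> and points straight up from the upper half plane, so
  on it the modulus is smallest at \<open>\<zeta>\<close>.\<close>

lemma norm_N_le:
  assumes x: "x \<in> {-r..r}" and t: "0 \<le> t"
  shows "norm (N x t) \<le> t / norm (\<zeta> x t)"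
proof (cases "\<beta> = 0")
  case True
  have "N x t = - \<i> * t / \<zeta> x t" unfolding N_def if_P[OF True] ..
  then show ?thesis using t by (simp add: norm_divide norm_mult)
next
  case False
  define S where "S = closed_segment (- \<i> * \<zeta> x t) (- \<i> * \<omega> x t)"
  have S: "0 < Re w \<and> norm (\<zeta> x t) \<le> norm w" if wS: "w \<in> S" for w
  proof -
    obtain u where u: "0 \<le> u" "u \<le> 1" "w = (1 - u) *\<^sub>R (- \<i> * \<zeta> x t) + u *\<^sub>R (- \<i> * \<omega> x t)"
      using wS unfolding S_def in_segment by blast
    have w: "w = - \<i> * (\<zeta> x t + \<i> * (u * (\<beta> * t)))"
      unfolding u(3) \<omega>_eq by (simp add: scaleR_conv_of_real algebra_simps)
    have p: "0 \<le> u * (\<beta> * t)" using u beta_nonneg t by simp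
    have I: "0 < Im (\<zeta> x t)" using Im_pos x t by simp
    have "norm w = norm (\<zeta> x t + \<i> * (u * (\<beta> * t)))" unfolding w by (simp add: norm_mult)
    moreover have "(Im (\<zeta> x t))\<^sup>2 \<le> (Im (\<zeta> x t) + u * (\<beta> * t))\<^sup>2" using p I by (intro power_mono) auto
    ultimately show ?thesis using p I unfolding w by (simp add: cmod_def)
  qed
  have "norm (Ln (- \<i> * \<zeta> x t) - Ln (- \<i> * \<omega> x t)) \<le> (1 / norm (\<zeta> x t)) * norm (- \<i> * \<zeta> x t - - \<i> * \<omega> x t)"
  proof (rule field_differentiable_bound[of S _ "\<lambda>w. 1 / w"])
    show "(Ln has_field_derivative 1 / w) (at w within S)" if "w \<in> S" for w
      using S[OF that] by (auto intro!: derivative_eq_intros simp: complex_nonpos_Reals_iff divide_inverse)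
    show "norm (1 / w) \<le> 1 / norm (\<zeta> x t)" if "w \<in> S" for w
      using S[OF that] \<zeta>_nz[OF x t] by (auto simp: norm_divide intro!: divide_left_mono mult_pos_pos)
  qed (auto simp: S_def)
  also have "norm (- \<i> * \<zeta> x t - - \<i> * \<omega> x t) = \<beta> * t"
    unfolding \<omega>_eq using beta_nonneg t by (simp add: algebra_simps norm_mult)
  finally show ?thesis using False beta_nonneg by (simp add: N_def norm_divide field_simps)
qed

definition Qx :: "real \<Rightarrow> real \<Rightarrow> complex" where
  "Qx x t = - complex_of_real c * (1 + \<i> * \<phi>' x) / (\<zeta> x t)\<^sup>2 + \<i> * d * (((\<phi>' (x + t) - \<phi>' x) / t) / \<omega> x t
      - q x t * (1 + \<i> * \<phi>' x) / (\<omega> x t)\<^sup>2)"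

definition Qt :: "real \<Rightarrow> real \<Rightarrow> complex" where
  "Qt x t = - complex_of_real c * \<i> / (\<zeta> x t)\<^sup>2 + \<i> * d * (((\<phi>' (x + t) - q x t) / t) / \<omega> x t
      - q x t * (\<i> * (1 + \<beta>)) / (\<omega> x t)\<^sup>2)"

lemma Q_derivatives:
  assumes x: "x \<in> {-r..r}" and t: "t \<in> {0<..r}"
  shows "((\<lambda>x. Q x t) has_vector_derivative Qx x t) (at x within S)"
    and "((\<lambda>t. Q x t) has_vector_derivative Qt x t) (at t within S)"
proof -
  have t0: "0 \<le> t" using t by simp
  note nz = \<zeta>_nz[OF x t0] \<omega>_nz[OF x t0]
  have regroup: "u * (- 1 * e / w\<^sup>2) + a * (1 / w) = a / w - u * e / w\<^sup>2" for u e w a :: complex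
    by simp
  have "((\<lambda>x. c / \<zeta> x t + (\<i> * d) * (of_real (q x t) * (1 / \<omega> x t))) has_vector_derivative
     - complex_of_real c * (1 + \<i> * \<phi>' x) / (\<zeta> x t)\<^sup>2 + (\<i> * d) * (q x t * (- 1 * (1 + \<i> * \<phi>' x) / (\<omega> x t)\<^sup>2)
       + of_real ((\<phi>' (x + t) - \<phi>' x) / t) * (1 / \<omega> x t))) (at x within S)"
    by (intro has_vector_derivative_add has_vector_derivative_mult_right has_vector_derivative_mult
        has_vector_derivative_of_real q_derivatives inverse_along_curve \<zeta>_derivatives \<omega>_derivatives x t nz)
  then show "((\<lambda>x. Q x t) has_vector_derivative Qx x t) (at x within S)"
    unfolding Q_def Qx_def regroup by simp
  have "((\<lambda>t. c / \<zeta> x t + (\<i> * d) * (of_real (q x t) * (1 / \<omega> x t))) has_vector_derivative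
     - complex_of_real c * \<i> / (\<zeta> x t)\<^sup>2 + (\<i> * d) * (q x t * (- 1 * (\<i> * (1 + \<beta>)) / (\<omega> x t)\<^sup>2)
       + of_real ((\<phi>' (x + t) - q x t) / t) * (1 / \<omega> x t))) (at t within S)"
    by (intro has_vector_derivative_add has_vector_derivative_mult_right has_vector_derivative_mult
        has_vector_derivative_of_real q_derivatives inverse_along_curve \<zeta>_derivatives \<omega>_derivatives x t nz)
  then show "((\<lambda>t. Q x t) has_vector_derivative Qt x t) (at t within S)"
    unfolding Q_def Qt_def regroup by simp
qed

text \<open>The left-hand side is twice the derivative of \<open>Q\<close> conjugate to \<open>z\<close>. The term with \<open>\<zeta>\<close>, which would be
  of order \<open>|\<zeta>|\<^bsup>-2\<^esup>\<close>, drops out because \<open>\<zeta>\<close> is holomorphic in \<open>z\<close>.\<close>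

lemma dbar_Q:
  assumes x: "x \<in> {-r..r}" and t: "t \<in> {0<..r}"
  shows "Qx x t + (\<i> - \<phi>' x) * Qt x t
    = \<i> * d * (((\<phi>' (x + t) - \<phi>' x) / t + (\<i> - \<phi>' x) * ((\<phi>' (x + t) - q x t) / t)) / \<omega> x t
        + \<beta> * q x t * (1 + \<i> * \<phi>' x) / (\<omega> x t)\<^sup>2)"
proof -
  have "(1 + \<i> * \<phi>' x) + (\<i> - \<phi>' x) * \<i> = 0"
    "(1 + \<i> * \<phi>' x) + (\<i> - \<phi>' x) * (\<i> * (1 + \<beta>)) = - \<beta> * (1 + \<i> * \<phi>' x)"
    by (simp_all add: algebra_simps complex_eq_iff)
  note * = this
  have "Qx x t + (\<i> - \<phi>' x) * Qt x t = - c * ((1 + \<i> * \<phi>' x) + (\<i> - \<phi>' x) * \<i>) / (\<zeta> x t)\<^sup>2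
     + \<i> * d * (((\<phi>' (x + t) - \<phi>' x) / t + (\<i> - \<phi>' x) * ((\<phi>' (x + t) - q x t) / t)) / \<omega> x t
       - q x t * ((1 + \<i> * \<phi>' x) + (\<i> - \<phi>' x) * (\<i> * (1 + \<beta>))) / (\<omega> x t)\<^sup>2)"
    unfolding Qx_def Qt_def by (simp add: algebra_simps add_divide_distrib diff_divide_distrib)
  then show ?thesis unfolding * by simp
qed

text \<open>The quadratic singularity of \<open>1 / \<omega>\<^sup>2\<close> is not integrable in the plane. It is harmless because its factor
  \<open>q\<close> is \<open>O((|x| + t)\<^bsup>\<alpha>\<^esup>)\<close>, which uses that the tangent at the origin is horizontal.\<close>

lemma norm_dbar_Q_le:
  assumes x: "x \<in> {-r..r}" and t: "t \<in> {0<..r}"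
  shows "norm (Qx x t + (\<i> - \<phi>' x) * Qt x t)
    \<le> 6 * C * t powr (\<alpha> - 1) / (\<bar>x\<bar> + t) + 8 * \<beta> * C * (\<bar>x\<bar> + t) powr (\<alpha> - 2)"
proof -
  define h where "h = \<bar>x\<bar> + t"
  have h: "0 < h" using t by (simp add: h_def add_nonneg_pos)
  have w: "h / 2 \<le> norm (\<omega> x t)" using norm_\<omega>_ge[OF x, of t] t by (simp add: h_def)
  have i: "norm (\<i> - \<phi>' x) \<le> 2" "norm (1 + \<i> * \<phi>' x) \<le> 2"
    using slope[of x] x r_pos norm_triangle_ineq4[of \<i> "complex_of_real (\<phi>' x)"]
      norm_triangle_ineq[of 1 "\<i> * complex_of_real (\<phi>' x)"] by (auto simp: norm_mult)
  have qx: "\<bar>(\<phi>' (x + t) - \<phi>' x) / t\<bar> \<le> C * t powr (\<alpha> - 1)"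
    using holder[of "x + t" x] x t by (auto simp: powr_diff abs_divide intro!: divide_right_mono)
  have qt: "\<bar>(\<phi>' (x + t) - q x t) / t\<bar> \<le> C * t powr (\<alpha> - 1)"
    using q_close_right[OF x t] t by (auto simp: powr_diff abs_divide intro!: divide_right_mono)
  have norm_bound: "norm (of_real a + z * of_real b) \<le> \<bar>a\<bar> + 2 * \<bar>b\<bar>" if "norm z \<le> 2" for a b and z :: complex
    using order_trans[OF norm_triangle_ineq[of "of_real a" "z * of_real b"]]
      mult_right_mono[OF that, of "\<bar>b\<bar>"] by (simp add: norm_mult)
  have n1: "norm (((\<phi>' (x + t) - \<phi>' x) / t + (\<i> - \<phi>' x) * ((\<phi>' (x + t) - q x t) / t)) / \<omega> x t)
      \<le> (3 * C * t powr (\<alpha> - 1)) / (h / 2)"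
  proof -
    have "norm (of_real ((\<phi>' (x + t) - \<phi>' x) / t) + (\<i> - \<phi>' x) * of_real ((\<phi>' (x + t) - q x t) / t))
       \<le> \<bar>(\<phi>' (x + t) - \<phi>' x) / t\<bar> + 2 * \<bar>(\<phi>' (x + t) - q x t) / t\<bar>"
      by (rule norm_bound[OF i(1)])
    also have "\<dots> \<le> 3 * C * t powr (\<alpha> - 1)" using qx qt by linarith
    finally show ?thesis unfolding norm_divide[of _ "\<omega> x t"]
      using w h C_nonneg by (intro frac_le) auto
  qed
  have n2: "norm (\<beta> * q x t * (1 + \<i> * \<phi>' x) / (\<omega> x t)\<^sup>2) \<le> (\<beta> * (C * h powr \<alpha>) * 2) / (h / 2)\<^sup>2"
  proof -
    have "\<beta> * \<bar>q x t\<bar> \<le> \<beta> * (C * h powr \<alpha>)"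
      using abs_q_le[OF x t] beta_nonneg unfolding h_def by (intro mult_left_mono)
    then have "norm (\<beta> * q x t * (1 + \<i> * \<phi>' x)) \<le> \<beta> * (C * h powr \<alpha>) * 2"
      using mult_mono[of "\<beta> * \<bar>q x t\<bar>" "\<beta> * (C * h powr \<alpha>)", OF _ i(2)] beta_nonneg C_nonneg
      by (simp add: norm_mult)
    moreover have "(h / 2)\<^sup>2 \<le> (norm (\<omega> x t))\<^sup>2" using w h by (intro power_mono) auto
    ultimately show ?thesis unfolding norm_divide norm_power
      using h beta_nonneg C_nonneg by (intro frac_le) auto
  qed
  have "norm (\<i> * complex_of_real d) = d" using d_pos by (simp only: norm_mult norm_ii norm_of_real)
  then have "norm (\<i> * complex_of_real d) \<le> 1" using c_le by simp
  note m = mult_mono[OF this order_trans[OF norm_triangle_ineq add_mono[OF n1 n2]] zero_le_one norm_ge_zero]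
  have "norm (Qx x t + (\<i> - \<phi>' x) * Qt x t) \<le> 1 * ((3 * C * t powr (\<alpha> - 1)) / (h / 2) + (\<beta> * (C * h powr \<alpha>) * 2) / (h / 2)\<^sup>2)"
    unfolding dbar_Q[OF x t] norm_mult[of "\<i> * complex_of_real d"] by (rule m)
  also have "(3 * C * t powr (\<alpha> - 1)) / (h / 2) = 6 * C * t powr (\<alpha> - 1) / h" by simp
  also have "(\<beta> * (C * h powr \<alpha>) * 2) / (h / 2)\<^sup>2 = 8 * \<beta> * C * h powr (\<alpha> - 2)"
    using h by (simp add: powr_diff power2_eq_square)
  also have "1 * (6 * C * t powr (\<alpha> - 1) / h + 8 * \<beta> * C * h powr (\<alpha> - 2))
     = 6 * C * t powr (\<alpha> - 1) / h + 8 * \<beta> * C * h powr (\<alpha> - 2)" by simp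
  finally show ?thesis by (simp add: h_def)
qed

end

section \<open>The flux through the curves parallel to the boundary\<close>

text \<open>The right-hand side is independent of \<open>t\<close>: the singularity at the origin is integrable uniformly
  in the distance to the boundary.\<close>

lemma integral_abs_powr_le:
  fixes \<gamma> t r :: real
  assumes "0 < \<gamma>" "0 < t" "t \<le> r"
  shows "integral {-r..r} (\<lambda>x. (\<bar>x\<bar> + t) powr (\<gamma> - 1)) \<le> 2 * ((2 * r) powr \<gamma> / \<gamma>)"
proof -
  have right: "((\<lambda>x. (\<bar>x\<bar> + t) powr (\<gamma> - 1)) has_integral ((r + t) powr \<gamma> / \<gamma> - (0 + t) powr \<gamma> / \<gamma>)) {0..r}"
  proof (rule has_integral_eq[OF _ fundamental_theorem_of_calculus])
    show "((\<lambda>x. (x + t) powr \<gamma> / \<gamma>) has_vector_derivative (x + t) powr (\<gamma> - 1)) (at x within {0..r})" if "x \<in> {0..r}" for x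
      unfolding has_real_derivative_iff_has_vector_derivative[symmetric]
      using that assms by (auto intro!: derivative_eq_intros)
  qed (use assms in auto)
  have left: "((\<lambda>x. (\<bar>x\<bar> + t) powr (\<gamma> - 1)) has_integral (- ((t - 0) powr \<gamma> / \<gamma>) - - ((t - - r) powr \<gamma> / \<gamma>))) {-r..0}"
  proof (rule has_integral_eq[OF _ fundamental_theorem_of_calculus])
    show "((\<lambda>x. - ((t - x) powr \<gamma> / \<gamma>)) has_vector_derivative (t - x) powr (\<gamma> - 1)) (at x within {-r..0})" if "x \<in> {-r..0}" for x
      unfolding has_real_derivative_iff_has_vector_derivative[symmetric]
      using that assms by (auto intro!: derivative_eq_intros)
  qed (use assms in \<open>auto simp: algebra_simps\<close>)
  have "integral {-r..r} (\<lambda>x. (\<bar>x\<bar> + t) powr (\<gamma> - 1)) = 2 * ((r + t) powr \<gamma> / \<gamma>) - 2 * (t powr \<gamma> / \<gamma>)"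
    using integral_unique[OF has_integral_combine[OF _ _ left right]] assms by (simp add: add.commute)
  also have "\<dots> \<le> 2 * ((2 * r) powr \<gamma> / \<gamma>)"
  proof -
    have "(r + t) powr \<gamma> / \<gamma> \<le> (2 * r) powr \<gamma> / \<gamma>"
      using assms by (intro divide_right_mono powr_mono2) auto
    moreover have "0 \<le> t powr \<gamma> / \<gamma>" using assms by simp
    ultimately show ?thesis by linarith
  qed
  finally show ?thesis .
qed

text \<open>Applied to the derivatives of \<open>N\<close>, this is the formula \<open>\<partial>\<^sub>\<tau> N = c / \<zeta> + \<i> d \<phi>' / \<omega>\<close>.\<close>

lemma kernel_identity:
  fixes z w c d b t f :: complex
  assumes "z \<noteq> 0" "w \<noteq> 0" "w = z + \<i> * b * t" "d = c * (1 + b)"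
  shows "d * (\<i> * t * (1 + \<i> * f) / (z * w)) + (\<i> * c - d * f) * (- (t / z + \<i>) / w) = c / z + \<i> * d * f / w"
proof -
  have "- (t / z + \<i>) / w = - (t + \<i> * z) / (z * w)"
    using assms(1,2) by (simp add: add_divide_distrib diff_divide_distrib)
  then have "d * (\<i> * t * (1 + \<i> * f) / (z * w)) + (\<i> * c - d * f) * (- (t / z + \<i>) / w)
     = (d * (\<i> * t * (1 + \<i> * f)) + (\<i> * c - d * f) * - (t + \<i> * z)) / (z * w)"
    by (simp only: times_divide_eq_right add_divide_distrib)
  also have "d * (\<i> * t * (1 + \<i> * f)) + (\<i> * c - d * f) * - (t + \<i> * z) = c * w + \<i> * d * f * z"
    unfolding assms(3,4) by (simp add: algebra_simps)
  also have "(c * w + \<i> * d * f * z) / (z * w) = c / z + \<i> * d * f / w"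
    using assms(1,2) by (simp add: add_divide_distrib)
  finally show ?thesis .
qed

text \<open>The product rule for the field whose flux is estimated below, with the letters standing for the
  values at one point of the functions of the same names, \<open>f\<close> for \<open>\<phi>'\<close>, and \<open>K\<close>, \<open>K'\<close> for the
  derivatives of \<open>N\<close>.\<close>

lemma divergence_identity:
  fixes F Fx Fy Q Qx Qt V Vx Vy N K K' c d f :: complex
  shows "((F * Qx + (Fx + f * Fy) * Q) / 2 - d * (V * K + (Vx + f * Vy) * N))
      + ((\<i> - f) * (F * Qt + Fy * Q) / 2 - (\<i> * c - d * f) * (V * K' + Vy * N))
    = Q * ((Fx + \<i> * Fy) / 2) + F * (Qx + (\<i> - f) * Qt) / 2
      - N * (d * Vx + \<i> * c * Vy) - V * (d * K + (\<i> * c - d * f) * K')"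
  by (simp add: algebra_simps add_divide_distrib diff_divide_distrib)

context boundary_graph begin

text \<open>The three terms come from the flux at height \<open>r\<close>, from the divergence below it and from the outflow
  at \<open>x = \<plusminus>r\<close>. The depth \<open>s\<close> of the pole does not enter.\<close>

definition flux_bound :: "real \<Rightarrow> real \<Rightarrow> real" where
  "flux_bound \<beta> B = 16 * B
     + (B * C * (5 + 4 * \<beta>) * (2 * ((2 * r) powr (\<alpha> / 2) / (\<alpha> / 2)))) * (r powr (\<alpha> / 2) / (\<alpha> / 2)) + 8 * B"

end

context boundary_kernel begin

lemma norm_Q_le:
  assumes x: "x \<in> {-r..r}" and t: "t \<in> {0<..r}"
  shows "norm (Q x t) \<le> 4 / (\<bar>x\<bar> + t)"
proof -
  have t0: "0 \<le> t" and h: "0 < \<bar>x\<bar> + t" using t by auto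
  have a: "norm (c / \<zeta> x t) \<le> 1 / ((\<bar>x\<bar> + t) / 2)"
    unfolding norm_divide using norm_\<zeta>_ge[OF x t0] h c_pos c_le_1 by (intro frac_le) auto
  have "norm (\<i> * d * q x t) = d * \<bar>q x t\<bar>"
    using d_pos by (simp only: norm_mult norm_ii norm_of_real)
  also have "\<dots> \<le> 1" using mult_mono[OF c_le abs_q_le_1[OF x t]] by simp
  finally have b: "norm (\<i> * d * q x t / \<omega> x t) \<le> 1 / ((\<bar>x\<bar> + t) / 2)"
    unfolding norm_divide using norm_\<omega>_ge[OF x t0] h by (intro frac_le) auto
  show ?thesis unfolding Q_def
    using norm_triangle_ineq[of "c / \<zeta> x t" "\<i> * d * q x t / \<omega> x t"] a b by simp
qed

lemma continuous_slope_on: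
  fixes f :: "'a::t2_space \<Rightarrow> real"
  assumes f: "continuous_on T f" "\<And>p. p \<in> T \<Longrightarrow> f p \<in> {-r..r}"
  shows "continuous_on T (\<lambda>p. \<phi>' (f p))"
  by (rule continuous_on_compose2[OF continuous_slope f(1)]) (use f(2) r_pos in force)

lemma continuous_parts:
  fixes f g :: "'a::t2_space \<Rightarrow> real"
  assumes f: "continuous_on T f" "\<And>p. p \<in> T \<Longrightarrow> f p \<in> {-r..r}"
    and g: "continuous_on T g" "\<And>p. p \<in> T \<Longrightarrow> 0 \<le> g p"
  shows "continuous_on T (\<lambda>p. \<zeta> (f p) (g p))"
    and "continuous_on T (\<lambda>p. \<omega> (f p) (g p))"
    and "continuous_on T (\<lambda>p. N (f p) (g p))"
proof -
  have 2: "continuous_on T (\<lambda>p. \<phi> (f p))"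
    by (rule continuous_on_compose2[OF continuous_graph f(1)]) (use f(2) r_pos in force)
  show 3: "continuous_on T (\<lambda>p. \<zeta> (f p) (g p))" unfolding \<zeta>_def
    by (intro continuous_intros f g 2)
  show 4: "continuous_on T (\<lambda>p. \<omega> (f p) (g p))" unfolding \<omega>_def
    by (intro continuous_intros f g 2)
  show "continuous_on T (\<lambda>p. N (f p) (g p))"
  proof (cases "\<beta> = 0")
    case True
    show ?thesis unfolding N_def if_P[OF True]
      by (intro continuous_intros 3 g) (use \<zeta>_nz f g in auto)
  next
    case False
    show ?thesis unfolding N_def if_not_P[OF False]
      by (intro continuous_intros 3 4)
        (use Im_pos f g False in \<open>force simp: complex_nonpos_Reals_iff\<close>)+
  qed
qed

lemma continuous_parts':
  fixes f g :: "'a::t2_space \<Rightarrow> real"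
  assumes f: "continuous_on T f" "\<And>p. p \<in> T \<Longrightarrow> f p \<in> {-r..r}"
    and g: "continuous_on T g" "\<And>p. p \<in> T \<Longrightarrow> g p \<in> {0<..r}"
  shows "continuous_on T (\<lambda>p. q (f p) (g p))"
    and "continuous_on T (\<lambda>p. Q (f p) (g p))"
    and "continuous_on T (\<lambda>p. Qx (f p) (g p))"
    and "continuous_on T (\<lambda>p. Qt (f p) (g p))"
proof -
  have g0: "\<And>p. p \<in> T \<Longrightarrow> 0 \<le> g p" using g(2) by force
  note parts = continuous_slope_on[OF f] continuous_parts[OF f g(1) g0]
  have 1: "continuous_on T (\<lambda>p. \<phi>' (f p + g p))"
    by (rule continuous_on_compose2[OF continuous_slope continuous_on_add[OF f(1) g(1)]]) (use f(2) g(2) in force)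
  have 2: "continuous_on T (\<lambda>p. \<phi> (f p + g p))"
    by (rule continuous_on_compose2[OF continuous_graph continuous_on_add[OF f(1) g(1)]]) (use f(2) g(2) in force)
  have 3: "continuous_on T (\<lambda>p. \<phi> (f p))"
    by (rule continuous_on_compose2[OF continuous_graph f(1)]) (use f(2) r_pos in force)
  have nz: "\<zeta> (f p) (g p) \<noteq> 0" "\<omega> (f p) (g p) \<noteq> 0" "complex_of_real (g p) \<noteq> 0" "g p \<noteq> 0" if "p \<in> T" for p
    using \<zeta>_nz[OF f(2) g0] \<omega>_nz[OF f(2) g0] g(2) that by force+
  show q: "continuous_on T (\<lambda>p. q (f p) (g p))" unfolding q_def
    by (intro continuous_intros 2 3 g) (use nz in auto)
  show "continuous_on T (\<lambda>p. Q (f p) (g p))" unfolding Q_def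
    by (intro continuous_intros parts q) (use nz in auto)
  show "continuous_on T (\<lambda>p. Qx (f p) (g p))" unfolding Qx_def
    by (intro continuous_intros parts q 1 g) (use nz in auto)
  show "continuous_on T (\<lambda>p. Qt (f p) (g p))" unfolding Qt_def
    by (intro continuous_intros parts q 1 g) (use nz in auto)
qed

end

text \<open>A solution of \<open>\<L>\<^sub>\<tau> f = 0\<close> in the coordinates \<open>(x, t)\<close>: \<open>F\<close> is \<open>f\<close>, \<open>Fx\<close> and \<open>Fy\<close> are its partial
  derivatives with respect to the original coordinates, \<open>V\<close> is its derivative conjugate to \<open>z\<close>, and
  \<open>V_solves\<close> says \<open>\<partial>\<^sub>\<tau> V = 0\<close>. The last assumption is a consequence of the uniform
  continuity of \<open>f\<close> up to the boundary.\<close>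

locale boundary_solution = boundary_kernel +
  fixes F Fx Fy V Vx Vy :: "real \<Rightarrow> real \<Rightarrow> complex" and B :: real
  assumes F_cont: "continuous_on ({0..r} \<times> {-r..r}) (\<lambda>(t,x). F x t)"
    and F_x: "x \<in> {-r..r} \<Longrightarrow> t \<in> {0<..r} \<Longrightarrow>
      ((\<lambda>x. F x t) has_vector_derivative Fx x t + \<phi>' x * Fy x t) (at x within {-r..r})"
    and F_t: "x \<in> {-r..r} \<Longrightarrow> t \<in> {0<..r} \<Longrightarrow>
      ((\<lambda>t. F x t) has_vector_derivative Fy x t) (at t within {0<..r})"
    and Fy_cont: "continuous_on ({0<..r} \<times> {-r..r}) (\<lambda>(t,x). Fy x t)"
    and V_eq: "x \<in> {-r..r} \<Longrightarrow> t \<in> {0<..r} \<Longrightarrow> V x t = (Fx x t + \<i> * Fy x t) / 2"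
    and V_x: "x \<in> {-r..r} \<Longrightarrow> t \<in> {0<..r} \<Longrightarrow>
      ((\<lambda>x. V x t) has_vector_derivative Vx x t + \<phi>' x * Vy x t) (at x within {-r..r})"
    and V_t: "x \<in> {-r..r} \<Longrightarrow> t \<in> {0<..r} \<Longrightarrow>
      ((\<lambda>t. V x t) has_vector_derivative Vy x t) (at t within {0<..r})"
    and V_cont: "continuous_on ({0<..r} \<times> {-r..r}) (\<lambda>(t,x). V x t)"
    and Vy_cont: "continuous_on ({0<..r} \<times> {-r..r}) (\<lambda>(t,x). Vy x t)"
    and V_solves: "x \<in> {-r..r} \<Longrightarrow> t \<in> {0<..r} \<Longrightarrow> d * Vx x t + \<i> * c * Vy x t = 0"
    and F_bound: "x \<in> {-r..r} \<Longrightarrow> t \<in> {0..r} \<Longrightarrow> norm (F x t) \<le> B"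
    and V_bound: "x \<in> {-r..r} \<Longrightarrow> t \<in> {0<..r} \<Longrightarrow> norm (V x t) \<le> B / t"
    and V_small: "0 < \<epsilon> \<Longrightarrow> \<exists>\<delta>>0. \<forall>x\<in>{-r..r}. \<forall>t\<in>{0<..<\<delta>}. t \<le> r \<longrightarrow> t * norm (V x t) \<le> \<epsilon>"
begin

text \<open>The components of the field of Green's formula. Its divergence in the coordinates \<open>(x, t)\<close> is
  the derivative of \<open>F Q\<close> conjugate to \<open>z\<close>, minus \<open>\<partial>\<^sub>\<tau> (V N)\<close>. The factors \<open>\<i> - \<phi>'\<close> and \<open>\<i> c - d \<phi>'\<close> in
  the vertical component are the coefficients of \<open>\<partial>\<^sub>t\<close> in these operators. The first is normalised as
  \<open>(\<partial>\<^sub>x + \<i> \<partial>\<^sub>y) / 2\<close>.\<close>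

definition A :: "real \<Rightarrow> real \<Rightarrow> complex" where
  "A x t = F x t * Q x t / 2 - d * (V x t * N x t)"

definition Bn :: "real \<Rightarrow> real \<Rightarrow> complex" where
  "Bn x t = (\<i> - \<phi>' x) * (F x t * Q x t) / 2 - (\<i> * c - complex_of_real d * \<phi>' x) * (V x t * N x t)"

definition Ax :: "real \<Rightarrow> real \<Rightarrow> complex" where
  "Ax x t = (F x t * Qx x t + (Fx x t + \<phi>' x * Fy x t) * Q x t) / 2
     - d * (V x t * (\<i> * t * (1 + \<i> * \<phi>' x) / (\<zeta> x t * \<omega> x t)) + (Vx x t + \<phi>' x * Vy x t) * N x t)"

definition Bt :: "real \<Rightarrow> real \<Rightarrow> complex" where
  "Bt x t = (\<i> - \<phi>' x) * (F x t * Qt x t + Fy x t * Q x t) / 2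
     - (\<i> * c - complex_of_real d * \<phi>' x) * (V x t * (- (t / \<zeta> x t + \<i>) / \<omega> x t) + Vy x t * N x t)"

definition E :: "real \<Rightarrow> real \<Rightarrow> complex" where
  "E x t = V x t * (\<i> * d * (q x t - \<phi>' x) / \<omega> x t) + F x t * (Qx x t + (\<i> - \<phi>' x) * Qt x t) / 2"

lemma B_nonneg: "0 \<le> B"
  using F_bound[of 0 0] r_pos by (auto intro: order_trans[OF norm_ge_zero])

lemma A_derivative:
  assumes "x \<in> {-r..r}" "t \<in> {0<..r}"
  shows "((\<lambda>x. A x t) has_vector_derivative Ax x t) (at x within {-r..r})"
  unfolding A_def Ax_def
  by (intro has_vector_derivative_diff has_vector_derivative_divide has_vector_derivative_mult_right
      has_vector_derivative_mult F_x V_x Q_derivatives N_derivatives) (use assms in auto)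

lemma Bn_derivative:
  assumes "x \<in> {-r..r}" "t \<in> {0<..r}"
  shows "((\<lambda>t. Bn x t) has_vector_derivative Bt x t) (at t within {0<..r})"
  unfolding Bn_def Bt_def
  by (intro has_vector_derivative_diff has_vector_derivative_divide has_vector_derivative_mult_right
      has_vector_derivative_mult F_t V_t Q_derivatives N_derivatives) (use assms in auto)

text \<open>In the divergence the product of \<open>V\<close> with \<open>Q - \<partial>\<^sub>\<tau> N\<close> remains, and there the singular terms
  \<open>c / \<zeta>\<close> cancel. The term with \<open>N\<close> disappears by the equation for \<open>V\<close>.\<close>

lemma divergence:
  assumes x: "x \<in> {-r..r}" and t: "t \<in> {0<..r}"
  shows "Ax x t + Bt x t = E x t"
proof -
  have t0: "0 \<le> t" using t by simp
  define z w f where "z = \<zeta> x t" and "w = \<omega> x t" and "f = complex_of_real (\<phi>' x)"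
  have nz: "z \<noteq> 0" "w \<noteq> 0" using \<zeta>_nz[OF x t0] \<omega>_nz[OF x t0] by (auto simp: z_def w_def)
  have w: "w = z + \<i> * \<beta> * t" unfolding w_def z_def by (rule \<omega>_eq)
  have kernel: "d * (\<i> * t * (1 + \<i> * f) / (z * w)) + (\<i> * c - d * f) * (- (t / z + \<i>) / w) = c / z + \<i> * d * f / w"
    by (rule kernel_identity[OF nz w]) simp
  have "Ax x t + Bt x t = Q x t * ((Fx x t + \<i> * Fy x t) / 2) + F x t * (Qx x t + (\<i> - \<phi>' x) * Qt x t) / 2
     - N x t * (d * Vx x t + \<i> * c * Vy x t)
     - V x t * (d * (\<i> * t * (1 + \<i> * f) / (z * w)) + (\<i> * c - d * f) * (- (t / z + \<i>) / w))"
    unfolding Ax_def Bt_def z_def[symmetric] w_def[symmetric] f_def[symmetric]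
    by (rule divergence_identity)
  also have "\<dots> = V x t * (Q x t - (c / z + \<i> * d * f / w)) + F x t * (Qx x t + (\<i> - \<phi>' x) * Qt x t) / 2"
    unfolding V_solves[OF x t] V_eq[OF x t, symmetric] kernel
    by (simp only: mult_zero_right diff_zero right_diff_distrib mult.commute[of "V x t"] left_diff_distrib) simp
  also have "Q x t - (c / z + \<i> * d * f / w) = \<i> * d * (q x t - f) / w"
    unfolding Q_def z_def[symmetric] w_def[symmetric]
    by (simp only: right_diff_distrib diff_divide_distrib) simp
  finally show ?thesis unfolding E_def w_def f_def by simp
qed

text \<open>The factor \<open>1/t\<close> in the bound for \<open>V\<close> meets \<open>|q - \<phi>'| = O(t\<^bsup>\<alpha>\<^esup>)\<close>. The powers are then distributed
  evenly between \<open>t\<close> and \<open>|x| + t \<ge> t\<close>, so that each factor is integrable in its variable.\<close>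

lemma norm_E_le:
  assumes x: "x \<in> {-r..r}" and t: "t \<in> {0<..r}"
  shows "norm (E x t) \<le> B * C * (5 + 4 * \<beta>) * (t powr (\<alpha> / 2 - 1) * (\<bar>x\<bar> + t) powr (\<alpha> / 2 - 1))"
proof -
  define h where "h = \<bar>x\<bar> + t"
  have tt: "0 < t" and h: "0 < h" "t \<le> h" using t by (auto simp: h_def)
  have w: "h / 2 \<le> norm (\<omega> x t)" using norm_\<omega>_ge[OF x, of t] t by (simp add: h_def)
  define T where "T = t powr (\<alpha> / 2 - 1) * h powr (\<alpha> / 2 - 1)"
  have T1: "t powr (\<alpha> - 1) / h \<le> T"
  proof -
    have "t powr (\<alpha> - 1) = t powr ((\<alpha> / 2 - 1) + \<alpha> / 2)" by (rule arg_cong[where f="(powr) t"]) simp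
    then have a: "t powr (\<alpha> - 1) = t powr (\<alpha> / 2 - 1) * t powr (\<alpha> / 2)" by (simp only: powr_add)
    have "h powr (\<alpha> / 2 - 1) = h powr (\<alpha> / 2) / h powr 1" by (rule powr_diff)
    then have b: "h powr (\<alpha> / 2) / h = h powr (\<alpha> / 2 - 1)" using h by (simp only: powr_one)
    have "t powr (\<alpha> / 2) / h \<le> h powr (\<alpha> / 2) / h"
      using tt h alpha by (intro divide_right_mono powr_mono2) auto
    then have "t powr (\<alpha> / 2 - 1) * (t powr (\<alpha> / 2) / h) \<le> T"
      unfolding b T_def by (rule mult_left_mono) simp
    then have "t powr (\<alpha> - 1) / h \<le> T" unfolding a by (simp only: times_divide_eq_right)
    then show ?thesis .
  qed
  have T2: "h powr (\<alpha> - 2) \<le> T"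
  proof -
    have "h powr (\<alpha> - 2) = h powr ((\<alpha> / 2 - 1) + (\<alpha> / 2 - 1))" by (rule arg_cong[where f="(powr) h"]) simp
    also have "\<dots> = h powr (\<alpha> / 2 - 1) * h powr (\<alpha> / 2 - 1)" by (rule powr_add)
    also have "\<dots> \<le> T" unfolding T_def
      using tt h alpha by (intro mult_right_mono powr_mono2') auto
    finally show ?thesis .
  qed
  have BC: "0 \<le> B * C" using B_nonneg C_nonneg by simp
  have n: "norm (\<i> * d * (q x t - \<phi>' x) / \<omega> x t) \<le> 1 * (C * t powr \<alpha>) / (h / 2)"
  proof -
    have "norm (\<i> * d * (q x t - \<phi>' x)) = d * \<bar>q x t - \<phi>' x\<bar>"
      using d_pos by (simp only: norm_mult norm_ii norm_of_real of_real_diff[symmetric])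
    also have "\<dots> \<le> 1 * (C * t powr \<alpha>)" using c_le q_close_left[OF x t] by (intro mult_mono) auto
    finally show ?thesis unfolding norm_divide using w h C_nonneg by (intro frac_le) auto
  qed
  have "norm (V x t * (\<i> * d * (q x t - \<phi>' x) / \<omega> x t)) \<le> (B / t) * (1 * (C * t powr \<alpha>) / (h / 2))"
    unfolding norm_mult[of "V x t"] using n V_bound[OF x t] B_nonneg tt by (intro mult_mono) auto
  also have "\<dots> = B * C * 2 * (t powr (\<alpha> - 1) / h)"
    using tt h by (simp add: powr_diff field_simps)
  also have "\<dots> \<le> B * C * 2 * T" using T1 BC by (intro mult_left_mono) auto
  finally have 1: "norm (V x t * (\<i> * d * (q x t - \<phi>' x) / \<omega> x t)) \<le> B * C * 2 * T" .
  have "norm (F x t * (Qx x t + (\<i> - \<phi>' x) * Qt x t) / 2)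
     \<le> B * (6 * C * t powr (\<alpha> - 1) / h + 8 * \<beta> * C * h powr (\<alpha> - 2)) / 2"
  proof -
    have "norm (F x t) * norm (Qx x t + (\<i> - \<phi>' x) * Qt x t)
       \<le> B * (6 * C * t powr (\<alpha> - 1) / h + 8 * \<beta> * C * h powr (\<alpha> - 2))"
      using F_bound[OF x] t norm_dbar_Q_le[OF x t] B_nonneg by (intro mult_mono) (auto simp: h_def)
    then show ?thesis unfolding norm_divide norm_mult[of "F x t"] norm_numeral by (rule divide_right_mono) simp
  qed
  also have "\<dots> = B * C * 3 * (t powr (\<alpha> - 1) / h) + (B * C * 4 * \<beta>) * h powr (\<alpha> - 2)"
    by (simp add: field_simps)
  also have "\<dots> \<le> B * C * 3 * T + (B * C * 4 * \<beta>) * T"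
    using T1 T2 BC beta_nonneg by (intro add_mono mult_left_mono) auto
  finally have 2: "norm (F x t * (Qx x t + (\<i> - \<phi>' x) * Qt x t) / 2) \<le> B * C * 3 * T + (B * C * 4 * \<beta>) * T" .
  have "norm (E x t) \<le> B * C * 2 * T + (B * C * 3 * T + (B * C * 4 * \<beta>) * T)"
    unfolding E_def by (rule order_trans[OF norm_triangle_ineq add_mono[OF 1 2]])
  then show ?thesis by (simp add: T_def h_def algebra_simps)
qed

lemma norm_V_N_le:
  assumes x: "x \<in> {-r..r}" and t: "t \<in> {0<..r}"
  shows "norm (V x t * N x t) \<le> 2 * B / (\<bar>x\<bar> + t)"
proof -
  have h: "0 < \<bar>x\<bar> + t" using t by auto
  have "norm (N x t) \<le> t / norm (\<zeta> x t)" using norm_N_le[OF x] t by simp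
  also have "\<dots> \<le> t / ((\<bar>x\<bar> + t) / 2)" using norm_\<zeta>_ge[OF x, of t] t h by (intro frac_le) auto
  finally have "norm (V x t) * norm (N x t) \<le> (B / t) * (t / ((\<bar>x\<bar> + t) / 2))"
    using V_bound[OF x t] B_nonneg t by (intro mult_mono) auto
  also have "\<dots> = 2 * B / (\<bar>x\<bar> + t)" using t by simp
  finally show ?thesis by (simp add: norm_mult)
qed

lemma norm_F_Q_le:
  assumes x: "x \<in> {-r..r}" and t: "t \<in> {0<..r}"
  shows "norm (F x t * Q x t) \<le> 4 * B / (\<bar>x\<bar> + t)"
proof -
  have "norm (F x t) * norm (Q x t) \<le> B * (4 / (\<bar>x\<bar> + t))"
    using F_bound[OF x] norm_Q_le[OF x t] B_nonneg t by (intro mult_mono) auto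
  then show ?thesis by (simp add: norm_mult mult.commute)
qed

lemma norm_coeff_le:
  assumes x: "x \<in> {-r..r}"
  shows "norm (\<i> - \<phi>' x) \<le> 2" "norm (\<i> * c - complex_of_real d * \<phi>' x) \<le> 2"
proof -
  have s: "\<bar>\<phi>' x\<bar> \<le> 1" using slope[of x] x r_pos by auto
  show "norm (\<i> - \<phi>' x) \<le> 2"
    using norm_triangle_ineq4[of \<i> "complex_of_real (\<phi>' x)"] s by simp
  have "norm (complex_of_real d * \<phi>' x) = d * \<bar>\<phi>' x\<bar>"
    using d_pos by (simp only: norm_mult norm_of_real)
  also have "\<dots> \<le> 1" using mult_mono[OF c_le s] by simp
  finally show "norm (\<i> * c - complex_of_real d * \<phi>' x) \<le> 2"
    using norm_triangle_ineq4[of "\<i> * c" "complex_of_real d * \<phi>' x"] c_pos c_le_1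
    by (simp add: norm_mult)
qed

lemma norm_A_le:
  assumes x: "x \<in> {-r..r}" and t: "t \<in> {0<..r}" and "r \<le> \<bar>x\<bar> + t"
  shows "norm (A x t) \<le> 4 * B / r"
proof -
  have le: "k * B / (\<bar>x\<bar> + t) \<le> k * B / r" if "0 \<le> k" for k
    using assms B_nonneg r_pos that by (intro divide_left_mono) auto
  have "norm (complex_of_real d * (V x t * N x t)) = d * norm (V x t * N x t)"
    using d_pos by (simp only: norm_mult[of "complex_of_real d"] norm_of_real)
  also have "\<dots> \<le> 1 * (2 * B / (\<bar>x\<bar> + t))" using c_le norm_V_N_le[OF x t] by (intro mult_mono) auto
  finally have 1: "norm (complex_of_real d * (V x t * N x t)) \<le> 2 * B / r" using le[of 2] by simp
  have 2: "norm (F x t * Q x t / 2) \<le> 2 * B / r" using norm_F_Q_le[OF x t] le[of 4] by (simp add: norm_divide)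
  show ?thesis unfolding A_def using norm_triangle_ineq4[of "F x t * Q x t / 2" "complex_of_real d * (V x t * N x t)"] 1 2
    by simp
qed

lemma norm_Bn_le:
  assumes x: "x \<in> {-r..r}" and t: "t \<in> {0<..r}" and "r \<le> \<bar>x\<bar> + t"
  shows "norm (Bn x t) \<le> 8 * B / r"
proof -
  have le: "k * B / (\<bar>x\<bar> + t) \<le> k * B / r" if "0 \<le> k" for k
    using assms B_nonneg r_pos that by (intro divide_left_mono) auto
  have 1: "norm ((\<i> * c - complex_of_real d * \<phi>' x) * (V x t * N x t)) \<le> 2 * (2 * B / r)"
    unfolding norm_mult[of "\<i> * c - complex_of_real d * \<phi>' x"]
    using norm_coeff_le[OF x] norm_V_N_le[OF x t] le[of 2] by (intro mult_mono) auto
  have "norm ((\<i> - \<phi>' x) * (F x t * Q x t)) \<le> 2 * (4 * B / r)"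
    unfolding norm_mult[of "\<i> - \<phi>' x"]
    using norm_coeff_le[OF x] norm_F_Q_le[OF x t] le[of 4] by (intro mult_mono) auto
  then have 2: "norm ((\<i> - \<phi>' x) * (F x t * Q x t) / 2) \<le> 4 * B / r" by (simp add: norm_divide)
  have "norm (Bn x t) \<le> 4 * B / r + 2 * (2 * B / r)"
    unfolding Bn_def by (rule order_trans[OF norm_triangle_ineq4 add_mono[OF 2 1]])
  then show ?thesis by simp
qed

lemma continuous_data:
  shows "continuous_on ({0<..r} \<times> {-r..r}) (\<lambda>p. F (snd p) (fst p))"
    and "continuous_on ({0<..r} \<times> {-r..r}) (\<lambda>p. Fy (snd p) (fst p))"
    and "continuous_on ({0<..r} \<times> {-r..r}) (\<lambda>p. V (snd p) (fst p))"
    and "continuous_on ({0<..r} \<times> {-r..r}) (\<lambda>p. Vy (snd p) (fst p))"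
proof -
  have "{0<..r} \<subseteq> {0..r}" by (rule greaterThanAtMost_subseteq_atLeastAtMost_iff[THEN iffD2]) simp
  then have sub: "{0<..r} \<times> {-r..r} \<subseteq> {0..r} \<times> {-r..r}" by (rule Sigma_mono) simp
  show "continuous_on ({0<..r} \<times> {-r..r}) (\<lambda>p. F (snd p) (fst p))"
    using continuous_on_subset[OF F_cont sub] unfolding split_beta .
  show "continuous_on ({0<..r} \<times> {-r..r}) (\<lambda>p. Fy (snd p) (fst p))"
    using Fy_cont unfolding split_beta .
  show "continuous_on ({0<..r} \<times> {-r..r}) (\<lambda>p. V (snd p) (fst p))"
    using V_cont unfolding split_beta .
  show "continuous_on ({0<..r} \<times> {-r..r}) (\<lambda>p. Vy (snd p) (fst p))"
    using Vy_cont unfolding split_beta .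
qed

lemma continuous_Bt: "continuous_on ({0<..r} \<times> {-r..r}) (\<lambda>(t,x). Bt x t)"
  unfolding split_beta Bt_def
  by (intro continuous_intros continuous_data continuous_slope_on continuous_parts continuous_parts')
    (use \<zeta>_nz \<omega>_nz in auto)

lemma continuous_Bn: "continuous_on ({0<..r} \<times> {-r..r}) (\<lambda>p. Bn (snd p) (fst p))"
  unfolding Bn_def
  by (intro continuous_intros continuous_data continuous_slope_on continuous_parts continuous_parts') auto

lemma continuous_E: "continuous_on ({0<..r} \<times> {-r..r}) (\<lambda>p. E (snd p) (fst p))"
  unfolding E_def
  by (intro continuous_intros continuous_data continuous_slope_on continuous_parts continuous_parts') (use \<omega>_nz in auto)

lemma continuous_slice:
  assumes "continuous_on ({0<..r} \<times> {-r..r}) (\<lambda>p. g (snd p) (fst p))" "t \<in> {0<..r}"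
  shows "continuous_on {-r..r} (\<lambda>x. g x t)"
  using continuous_on_compose2[OF assms(1), of "{-r..r}" "\<lambda>x. (t, x)"] assms(2)
  by (force intro: continuous_intros)

text \<open>Green's formula takes the form of an estimate of how this flux, through the curve at height \<open>t\<close>
  above the boundary, depends on \<open>t\<close>.\<close>

definition J :: "real \<Rightarrow> complex" where
  "J t = integral {-r..r} (\<lambda>x. Bn x t)"

lemma J_derivative:
  assumes t: "t \<in> {0<..r}"
  shows "(J has_vector_derivative integral {-r..r} (\<lambda>x. E x t) - (A r t - A (- r) t)) (at t within {0<..r})"
proof -
  have "((\<lambda>t. integral {-r..r} (\<lambda>x. Bn x t)) has_vector_derivative
     integral {-r..r} (\<lambda>x. Ax x t + Bt x t) - (A r t - A (- r) t)) (at t within {0<..r})"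
  proof (rule flux_derivative[where A=A and Ax=Ax and B=Bn and Bt=Bt, OF _ _ t])
    show "- r \<le> r" "convex {0<..r}" using r_pos by auto
    show "((\<lambda>x. A x t) has_vector_derivative Ax x t) (at x within {-r..r})" if "x \<in> {-r..r}" for x
      by (rule A_derivative[OF that t])
    show "(Bn x has_vector_derivative Bt x u) (at u within {0<..r})" if "x \<in> {-r..r}" "u \<in> {0<..r}" for x u
      by (rule Bn_derivative[OF that])
    show "continuous_on {-r..r} (\<lambda>x. Bn x u)" if "u \<in> {0<..r}" for u
      by (rule continuous_slice[OF continuous_Bn that])
  qed (rule continuous_Bt)
  moreover have "integral {-r..r} (\<lambda>x. Ax x t + Bt x t) = integral {-r..r} (\<lambda>x. E x t)"
    by (rule integral_cong, rule divergence[OF _ t])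
  ultimately show ?thesis unfolding J_def[abs_def] by simp
qed

text \<open>At height \<open>r\<close> the flux is bounded since the pole is far away, and on the way down it changes by the
  integral of \<open>E\<close>, which is bounded uniformly in \<open>s\<close>, and by the outflow at \<open>x = \<plusminus>r\<close>.\<close>

lemma norm_J_le:
  assumes t: "t \<in> {0<..r}"
  shows "norm (J t) \<le> flux_bound \<beta> B"
proof -
  define \<gamma> where "\<gamma> = \<alpha> / 2"
  have \<gamma>: "0 < \<gamma>" using alpha by (simp add: \<gamma>_def)
  define I where "I = 2 * ((2 * r) powr \<gamma> / \<gamma>)"
  define M where "M = B * C * (5 + 4 * \<beta>)"
  have M: "0 \<le> M" using B_nonneg C_nonneg beta_nonneg by (simp add: M_def)
  define G where "G = (\<lambda>t. M * I * (t powr \<gamma> / \<gamma>) + (8 * B / r) * t)"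
  have der_le: "norm (integral {-r..r} (\<lambda>x. E x u) - (A r u - A (- r) u)) \<le> M * I * u powr (\<gamma> - 1) + 8 * B / r"
    if u: "u \<in> {0<..r}" for u
  proof -
    have c: "continuous_on {-r..r} (\<lambda>x. M * (u powr (\<gamma> - 1) * (\<bar>x\<bar> + u) powr (\<gamma> - 1)))"
      using u by (intro continuous_intros) auto
    have "norm (integral {-r..r} (\<lambda>x. E x u)) \<le> integral {-r..r} (\<lambda>x. M * (u powr (\<gamma> - 1) * (\<bar>x\<bar> + u) powr (\<gamma> - 1)))"
      using continuous_slice[OF continuous_E u] c norm_E_le[OF _ u]
      by (intro integral_norm_bound_integral integrable_continuous_real) (auto simp: M_def \<gamma>_def)
    also have "\<dots> = M * u powr (\<gamma> - 1) * integral {-r..r} (\<lambda>x. (\<bar>x\<bar> + u) powr (\<gamma> - 1))"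
      by simp
    also have "\<dots> \<le> M * u powr (\<gamma> - 1) * I"
      unfolding I_def using integral_abs_powr_le[OF \<gamma>, of u r] u M by (intro mult_left_mono) auto
    finally have 1: "norm (integral {-r..r} (\<lambda>x. E x u)) \<le> M * I * u powr (\<gamma> - 1)" by (simp add: mult_ac)
    have 2: "norm (A r u) \<le> 4 * B / r" "norm (A (- r) u) \<le> 4 * B / r"
      by (intro norm_A_le; use u r_pos in simp)+
    show ?thesis
      using norm_triangle_ineq4[of "integral {-r..r} (\<lambda>x. E x u)" "A r u - A (- r) u"]
        norm_triangle_ineq4[of "A r u" "A (- r) u"] 1 2 by simp
  qed
  have Gnn: "0 \<le> G u" if "0 \<le> u" for u
    using that M \<gamma> B_nonneg r_pos by (simp add: G_def I_def)
  have increment: "norm (J r - J t) \<le> G r - G t"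
  proof (cases "t < r")
    case True
    show ?thesis
    proof (rule differentiable_bound_general[OF True])
      show "continuous_on {t..r} J"
        by (rule continuous_on_subset[of "{0<..r}"])
          (use J_derivative has_vector_derivative_continuous t in \<open>force simp: continuous_on_eq_continuous_within\<close>)+
      show "continuous_on {t..r} G" unfolding G_def using t \<gamma> by (intro continuous_intros) auto
      show "(J has_vector_derivative integral {-r..r} (\<lambda>x. E x u) - (A r u - A (- r) u)) (at u)" if "t < u" "u < r" for u
      proof -
        have u: "u \<in> {0<..<r}" and u': "u \<in> {0<..r}" and sub: "{0<..<r} \<subseteq> {0<..r}" using that t by auto
        have "at u within {0<..<r} = at u" by (rule at_within_open[OF u]) simp
        then show ?thesis using has_vector_derivative_within_subset[OF J_derivative[OF u'] sub] by simp
      qed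
      show "(G has_vector_derivative M * I * u powr (\<gamma> - 1) + 8 * B / r) (at u)" if "t < u" "u < r" for u
      proof -
        have "0 < u" using that t by simp
        then have "(G has_real_derivative M * I * ((\<gamma> * u powr (\<gamma> - 1)) / \<gamma>) + (8 * B / r) * 1) (at u)"
          unfolding G_def
          by (intro DERIV_add DERIV_cmult DERIV_cdivide has_real_derivative_powr DERIV_ident)
        then show ?thesis using \<gamma> by (simp add: has_real_derivative_iff_has_vector_derivative)
      qed
      show "norm (integral {-r..r} (\<lambda>x. E x u) - (A r u - A (- r) u)) \<le> M * I * u powr (\<gamma> - 1) + 8 * B / r" if "t < u" "u < r" for u
        using der_le[of u] that t by auto
    qed
  qed (use t in auto)
  have "norm (J r) \<le> (8 * B / r) * (r - - r)"
    unfolding J_def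
    by (rule integral_bound[OF _ continuous_slice[OF continuous_Bn]]) (use r_pos in \<open>auto intro!: norm_Bn_le\<close>)
  then have "norm (J r) \<le> 16 * B" using r_pos by simp
  then have "norm (J t) \<le> 16 * B + G r"
    using increment Gnn[of t] t norm_triangle_ineq3[of "J r" "J t"] by auto
  also have "\<dots> = flux_bound \<beta> B"
    using r_pos by (simp add: G_def flux_bound_def I_def M_def \<gamma>_def)
  finally show ?thesis .
qed

text \<open>The flux without the part of \<open>V\<close>, which is not defined for \<open>t = 0\<close>, and with \<open>\<phi>'\<close> instead of \<open>q\<close>.
  At \<open>t = 0\<close> it is the boundary integral that is to be estimated.\<close>

definition J0 :: "real \<Rightarrow> complex" where
  "J0 t = integral {-r..r} (\<lambda>x. (\<i> - \<phi>' x) * (F x t * (c / \<zeta> x t + \<i> * d * \<phi>' x / \<omega> x t)) / 2)"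

lemma J0_cont: "continuous_on {0..r} J0"
proof -
  have F: "continuous_on ({0..r} \<times> {-r..r}) (\<lambda>p. F (snd p) (fst p))"
    using F_cont by (simp add: split_beta)
  have "continuous_on ({0..r} \<times> cbox (-r) r) (\<lambda>(t, x). (\<i> - \<phi>' x) * (F x t * (c / \<zeta> x t + \<i> * d * \<phi>' x / \<omega> x t)) / 2)"
    unfolding split_beta cbox_interval
    by (intro continuous_intros F continuous_slope_on continuous_parts) (use \<zeta>_nz \<omega>_nz in auto)
  from integral_continuous_on_param[OF this] show ?thesis unfolding J0_def by simp
qed

lemma norm_J_diff_le:
  assumes t: "t \<in> {0<..r}" and small: "\<And>x. x \<in> {-r..r} \<Longrightarrow> t * norm (V x t) \<le> \<epsilon>" and "0 \<le> \<epsilon>"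
  shows "norm (J t - J0 t) \<le> (B * C * t powr \<alpha> / s + 2 * \<epsilon> / s) * (2 * r)"
proof -
  have t0: "0 \<le> t" using t by simp
  define D where "D = (\<lambda>x. (\<i> - \<phi>' x) * (F x t * (\<i> * d * (q x t - \<phi>' x) / \<omega> x t)) / 2 - (\<i> * c - complex_of_real d * \<phi>' x) * (V x t * N x t))"
  have D: "Bn x t - (\<i> - \<phi>' x) * (F x t * (c / \<zeta> x t + \<i> * d * \<phi>' x / \<omega> x t)) / 2 = D x" for x
    unfolding Bn_def D_def Q_def by (simp add: algebra_simps diff_divide_distrib add_divide_distrib)
  have cB: "continuous_on {-r..r} (\<lambda>x. Bn x t)" by (rule continuous_slice[OF continuous_Bn t])
  have cF: "continuous_on {-r..r} (\<lambda>x. F x t)" by (rule continuous_slice[OF continuous_data(1) t])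
  have c0: "continuous_on {-r..r} (\<lambda>x. (\<i> - \<phi>' x) * (F x t * (c / \<zeta> x t + \<i> * d * \<phi>' x / \<omega> x t)) / 2)"
    by (intro continuous_intros cF continuous_slope_on continuous_parts) (use \<zeta>_nz \<omega>_nz t in auto)
  have "J t - J0 t = integral {-r..r} D"
    unfolding J_def J0_def D[symmetric]
    by (rule integral_diff[symmetric]; rule integrable_continuous_real) (rule cB c0)+
  also have "norm \<dots> \<le> (B * C * t powr \<alpha> / s + 2 * \<epsilon> / s) * (r - - r)"
  proof (rule integral_bound)
    show "continuous_on {-r..r} D" unfolding D[symmetric] by (intro continuous_intros cB c0)
    show "norm (D x) \<le> B * C * t powr \<alpha> / s + 2 * \<epsilon> / s" if x: "x \<in> {-r..r}" for x
    proof -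
      have "norm (\<i> * d * (q x t - \<phi>' x)) = d * \<bar>q x t - \<phi>' x\<bar>"
        using d_pos by (simp only: norm_mult norm_ii norm_of_real of_real_diff[symmetric])
      also have "\<dots> \<le> 1 * (C * t powr \<alpha>)" using c_le q_close_left[OF x t] by (intro mult_mono) auto
      finally have "norm (\<i> * d * (q x t - \<phi>' x) / \<omega> x t) \<le> 1 * (C * t powr \<alpha>) / s"
        unfolding norm_divide using norm_\<omega>_ge_s[OF x t0] s_pos C_nonneg by (intro frac_le) auto
      then have "norm (F x t * (\<i> * d * (q x t - \<phi>' x) / \<omega> x t)) \<le> B * (1 * (C * t powr \<alpha>) / s)"
        unfolding norm_mult[of "F x t"] using F_bound[OF x, of t] B_nonneg t by (intro mult_mono) auto
      then have "norm ((\<i> - \<phi>' x) * (F x t * (\<i> * d * (q x t - \<phi>' x) / \<omega> x t))) \<le> 2 * (B * (1 * (C * t powr \<alpha>) / s))"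
        unfolding norm_mult[of "\<i> - \<phi>' x"] using norm_coeff_le(1)[OF x] by (intro mult_mono) auto
      then have 1: "norm ((\<i> - \<phi>' x) * (F x t * (\<i> * d * (q x t - \<phi>' x) / \<omega> x t)) / 2) \<le> B * C * t powr \<alpha> / s"
        by (simp add: norm_divide)
      have "norm (V x t) * norm (N x t) \<le> norm (V x t) * (t / s)"
        using order_trans[OF norm_N_le[OF x t0]] norm_\<zeta>_ge_s[OF x t0] s_pos t0
        by (intro mult_left_mono) (auto intro: frac_le)
      also have "\<dots> \<le> \<epsilon> / s" using small[OF x] s_pos by (simp add: divide_right_mono mult.commute)
      finally have "norm (V x t * N x t) \<le> \<epsilon> / s" by (simp add: norm_mult)
      then have 2: "norm ((\<i> * c - complex_of_real d * \<phi>' x) * (V x t * N x t)) \<le> 2 * (\<epsilon> / s)"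
        unfolding norm_mult[of "\<i> * c - complex_of_real d * \<phi>' x"] using norm_coeff_le(2)[OF x] by (intro mult_mono) auto
      have "norm (D x) \<le> B * C * t powr \<alpha> / s + 2 * (\<epsilon> / s)"
        unfolding D_def by (rule order_trans[OF norm_triangle_ineq4 add_mono[OF 1 2]])
      then show ?thesis by simp
    qed
  qed (use r_pos in simp)
  finally show ?thesis by simp
qed

text \<open>For fixed \<open>s\<close> the difference between \<open>J\<close> and \<open>J0\<close> tends to \<open>0\<close> with \<open>t\<close>: \<open>q\<close> tends to \<open>\<phi>'\<close>, and
  \<open>|V N|\<close> is at most \<open>t |V| / s\<close>, where \<open>t |V|\<close> tends to \<open>0\<close> by the continuity of the solution.
  Boundedness of \<open>t |V|\<close> alone would not do here.\<close>

lemma norm_J0_le: "norm (J0 0) \<le> flux_bound \<beta> B"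
proof (rule field_le_epsilon)
  fix \<epsilon>' :: real assume "0 < \<epsilon>'"
  define \<epsilon> where "\<epsilon> = \<epsilon>' / 3"
  have \<epsilon>: "0 < \<epsilon>" using \<open>0 < \<epsilon>'\<close> by (simp add: \<epsilon>_def)
  have "(J0 \<longlongrightarrow> J0 0) (at 0 within {0..r})"
    using J0_cont r_pos by (auto simp: continuous_on_def)
  then have "(J0 \<longlongrightarrow> J0 0) (at_right 0)"
    using r_pos by (simp add: at_within_Icc_at_right)
  from tendstoD[OF this \<epsilon>] have e1: "\<forall>\<^sub>F t in at_right 0. norm (J0 t - J0 0) < \<epsilon>"
    by (simp add: dist_norm)
  have "((\<lambda>t. B * C * t powr \<alpha> / s * (2 * r)) \<longlongrightarrow> B * C * 0 powr \<alpha> / s * (2 * r)) (at_right 0)"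
    using alpha s_pos by (intro tendsto_intros) (auto simp: eventually_at_filter)
  then have "((\<lambda>t. B * C * t powr \<alpha> / s * (2 * r)) \<longlongrightarrow> 0) (at_right 0)" using alpha by simp
  from order_tendstoD(2)[OF this \<epsilon>]
  have e2: "\<forall>\<^sub>F t in at_right 0. B * C * t powr \<alpha> / s * (2 * r) < \<epsilon>" .
  have "0 < \<epsilon> * s / (4 * r)" using \<epsilon> s_pos r_pos by simp
  from V_small[OF this] obtain \<delta> where \<delta>: "0 < \<delta>"
    "\<forall>x\<in>{-r..r}. \<forall>t\<in>{0<..<\<delta>}. t \<le> r \<longrightarrow> t * norm (V x t) \<le> \<epsilon> * s / (4 * r)" by blast
  have e3: "\<forall>\<^sub>F t in at_right 0. t \<in> {0<..<min \<delta> r}"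
    using \<delta> r_pos by (intro eventually_at_rightI[of 0 "min \<delta> r"]) auto
  have "\<exists>t. norm (J0 t - J0 0) < \<epsilon> \<and> B * C * t powr \<alpha> / s * (2 * r) < \<epsilon> \<and> t \<in> {0<..<min \<delta> r}"
    using eventually_happens[OF eventually_conj[OF e1 eventually_conj[OF e2 e3]]] by simp
  then obtain t where t: "norm (J0 t - J0 0) < \<epsilon>" "B * C * t powr \<alpha> / s * (2 * r) < \<epsilon>" "t \<in> {0<..<min \<delta> r}" by blast
  have "norm (J t - J0 t) \<le> (B * C * t powr \<alpha> / s + 2 * (\<epsilon> * s / (4 * r)) / s) * (2 * r)"
    by (rule norm_J_diff_le) (use t \<delta> \<epsilon> s_pos r_pos in auto)
  also have "\<dots> = B * C * t powr \<alpha> / s * (2 * r) + \<epsilon>"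
    using s_pos r_pos by (simp add: field_simps)
  finally have "norm (J t - J0 t) \<le> 2 * \<epsilon>" using t by simp
  moreover have "norm (J t) \<le> flux_bound \<beta> B" by (rule norm_J_le) (use t in auto)
  moreover have "norm (J0 0) \<le> norm (J t) + norm (J t - J0 t) + norm (J0 t - J0 0)"
    using norm_triangle_ineq4[of "J t" "J t - J0 t"] norm_triangle_ineq4[of "J0 t" "J0 t - J0 0"] by simp
  ultimately show "norm (J0 0) \<le> flux_bound \<beta> B + \<epsilon>'" using t by (simp add: \<epsilon>_def)
qed

end

section \<open>Boundary data with unbounded singular integrals\<close>

text \<open>A continuous function that vanishes at the origin so slowly that its quotient by \<open>x\<close> is not
  integrable there.\<close>

definition log_bump :: "real \<Rightarrow> real \<Rightarrow> real" where
  "log_bump r x = (if 0 < x then 1 / (1 - ln (x / r)) else 0)"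

lemma continuous_on_log_bump:
  assumes "0 < r"
  shows "continuous_on {..r} (log_bump r)"
proof -
  have den: "0 < 1 - ln (x / r)" if "0 < x" "x \<le> r" for x
  proof -
    have "ln (x / r) \<le> 0" using that assms by (subst ln_le_zero_iff) auto
    then show ?thesis by simp
  qed
  have right: "continuous_on {0..r} (log_bump r)"
  proof -
    have "continuous (at x within {0..r}) (log_bump r)" if x: "x \<in> {0..r}" for x
    proof (cases "x = 0")
      case True
      have "filterlim (\<lambda>x::real. - ln x) at_top (at_right 0)"
        using ln_at_0 by (simp add: filterlim_uminus_at_top)
      then have "filterlim (\<lambda>x. (1 + ln r) + - ln x) at_top (at_right 0)"
        by (rule filterlim_tendsto_add_at_top[OF tendsto_const])
      then have "((\<lambda>x. inverse ((1 + ln r) + - ln x)) \<longlongrightarrow> 0) (at_right 0)"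
        by (rule tendsto_inverse_0_at_top)
      moreover have "\<forall>\<^sub>F x in at_right 0. inverse ((1 + ln r) + - ln x) = log_bump r x"
        using assms by (auto simp: eventually_at_filter log_bump_def divide_inverse[of 1] ln_div algebra_simps)
      ultimately have "(log_bump r \<longlongrightarrow> 0) (at_right 0)" by (rule Lim_transform_eventually)
      then show ?thesis unfolding True continuous_within
        using assms by (simp add: at_within_Icc_at_right log_bump_def)
    next
      case False
      have "continuous_on {0<..r} (\<lambda>x. 1 / (1 - ln (x / r)))"
        using assms by (intro continuous_intros) (use den in force)+
      then have "continuous_on {0<..r} (log_bump r)"
        by (rule continuous_on_eq) (auto simp: log_bump_def)
      then have "continuous (at x within {0<..r}) (log_bump r)"
        using False x by (auto simp: continuous_on_eq_continuous_within)
      moreover have "at x within {0<..r} = at x within {0..r}"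
        by (rule at_within_nhd[of _ "{0<..}"]) (use False x in auto)
      ultimately show ?thesis by (simp add: continuous_within)
    qed
    then show ?thesis by (simp add: continuous_on_eq_continuous_within)
  qed
  have "continuous_on ({..0} \<union> {0..r}) (log_bump r)"
  proof (rule continuous_on_closed_Un[OF _ _ _ right])
    show "continuous_on {..0} (log_bump r)"
      by (rule continuous_on_eq[of _ "\<lambda>_. 0"]) (auto simp: log_bump_def)
  qed auto
  moreover have "{..0} \<union> {0..r} = {..r}" using assms by auto
  ultimately show ?thesis by simp
qed

context boundary_graph begin

text \<open>In \<open>J0 0\<close> the boundary values are multiplied by this weight and by the kernel \<open>1 / (2 \<zeta>)\<close>.\<close>

definition boundary_weight :: "real \<Rightarrow> real \<Rightarrow> real \<Rightarrow> complex" where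
  "boundary_weight c d x = (\<i> - \<phi>' x) * (c + \<i> * d * \<phi>' x)"

lemma continuous_boundary_weight: "continuous_on {-r..r} (boundary_weight c d)"
  unfolding boundary_weight_def
  by (intro continuous_intros continuous_on_subset[OF continuous_slope]) (use r_pos in auto)

lemma Re_weight_kernel:
  "Re (boundary_weight c d x * (cnj (boundary_weight c d x) * b) / Complex x y / 2)
     = (norm (boundary_weight c d x))\<^sup>2 * b * x / (x\<^sup>2 + y\<^sup>2) / 2"
proof -
  have "boundary_weight c d x * (cnj (boundary_weight c d x) * b) / Complex x y / 2
     = complex_of_real ((norm (boundary_weight c d x))\<^sup>2 * b / 2) / Complex x y"
    using complex_norm_square[of "boundary_weight c d x"] by (simp add: mult.assoc)
  also have "Re \<dots> = (norm (boundary_weight c d x))\<^sup>2 * b / 2 * (x / (x\<^sup>2 + y\<^sup>2))"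
  proof -
    have "Re (complex_of_real a / Complex x y) = a * (x / (x\<^sup>2 + y\<^sup>2))" for a
      by (simp add: Re_divide)
    then show ?thesis .
  qed
  finally show ?thesis by simp
qed

lemma norm_boundary_weight_ge: "c\<^sup>2 \<le> (norm (boundary_weight c d x))\<^sup>2"
proof -
  have "1 * c\<^sup>2 \<le> (1 + (\<phi>' x)\<^sup>2) * (c\<^sup>2 + (d * \<phi>' x)\<^sup>2)"
    by (intro mult_mono) auto
  also have "\<dots> = (norm (\<i> - \<phi>' x))\<^sup>2 * (norm (c + \<i> * d * \<phi>' x))\<^sup>2"
    by (simp add: cmod_power2)
  finally show ?thesis by (simp add: boundary_weight_def norm_mult power_mult_distrib)
qed

text \<open>The conjugate of the weight makes the real part of the integrand nonnegative. For \<open>x \<ge> s\<close> one has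
  \<open>\<phi>(x) + s \<le> 2 x\<close>, so the real part of the kernel is at least \<open>1 / (5 x)\<close>, and the integral of
  \<open>1 / (x (1 - ln (x/r)))\<close> from \<open>s\<close> to \<open>r\<close> is \<open>ln (1 - ln (s/r))\<close>.\<close>

lemma boundary_functional_unbounded:
  assumes c: "0 < c" and phi0: "\<phi> 0 = 0"
  obtains s where "0 < s" and
    "M < norm (integral {-r..r} (\<lambda>x. boundary_weight c d x * (cnj (boundary_weight c d x) * log_bump r x) / Complex x (\<phi> x + s) / 2))"
proof -
  define k where "k = (\<bar>M\<bar> + 1) * 10 / c\<^sup>2"
  have k: "0 < k" using c by (simp add: k_def)
  \<comment> \<open>Chosen such that \<open>ln (1 - ln (s/r)) = k\<close>.\<close>
  define s where "s = r * exp (1 - exp k)"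
  have s: "0 < s" "s \<le> r" using r_pos k by (auto simp: s_def)
  define g where "g = (\<lambda>x. boundary_weight c d x * (cnj (boundary_weight c d x) * log_bump r x) / Complex x (\<phi> x + s) / 2)"
  have nz: "Complex x (\<phi> x + s) \<noteq> 0" if "x \<in> {-r..r}" for x
    using nonneg[of x] that s r_pos by (auto simp: complex_eq_iff)
  have cg: "continuous_on {-r..r} g"
    unfolding g_def
    by (intro continuous_intros continuous_boundary_weight continuous_on_subset[OF continuous_graph]
        continuous_on_subset[OF continuous_on_log_bump[OF r_pos]]) (use nz r_pos in auto)
  have Reg: "Re (g x) = (norm (boundary_weight c d x))\<^sup>2 * log_bump r x * x / (x\<^sup>2 + (\<phi> x + s)\<^sup>2) / 2" for x
    unfolding g_def by (rule Re_weight_kernel)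
  have bump: "0 \<le> log_bump r x" if "x \<le> r" for x
  proof (cases "0 < x")
    case True
    have "ln (x / r) \<le> 0" using that r_pos True by (subst ln_le_zero_iff) auto
    then show ?thesis by (simp add: log_bump_def)
  qed (simp add: log_bump_def)
  have pos: "0 \<le> Re (g x)" if "x \<in> {-r..r}" for x
    unfolding Reg using bump[of x] that by (cases "0 < x") (auto simp: log_bump_def)
  have lower: "c\<^sup>2 / 10 * (1 / (x * (1 - ln (x / r)))) \<le> Re (g x)" if x: "x \<in> {s..r}" for x
  proof -
    have x0: "0 < x" using x s by auto
    have "\<exists>z>0. z < x \<and> \<phi> x - \<phi> 0 = (x - 0) * \<phi>' z"
      by (rule MVT2) (use x x0 r_pos deriv in auto)
    then obtain z where z: "0 < z" "z < x" "\<phi> x = x * \<phi>' z" using phi0 by auto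
    have "\<phi> x \<le> x" using mult_left_mono[of "\<phi>' z" 1 x] slope[of z] z x x0 r_pos by auto
    then have "(\<phi> x + s)\<^sup>2 \<le> (2 * x)\<^sup>2" using nonneg[of x] x s by (intro power_mono) auto
    then have den: "x\<^sup>2 + (\<phi> x + s)\<^sup>2 \<le> 5 * x\<^sup>2" by (simp add: power_mult_distrib)
    have b: "0 \<le> log_bump r x" using bump x by auto
    have "c\<^sup>2 / 10 * (1 / (x * (1 - ln (x / r)))) = c\<^sup>2 * log_bump r x * x / (5 * x\<^sup>2) / 2"
      using x0 by (simp add: log_bump_def power2_eq_square)
    also have "\<dots> \<le> Re (g x)" unfolding Reg
      using norm_boundary_weight_ge[of c d x] den b x0
      by (intro divide_right_mono frac_le mult_right_mono) (auto intro: add_pos_nonneg)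
    finally show ?thesis .
  qed
  have prim: "((\<lambda>x. c\<^sup>2 / 10 * (1 / (x * (1 - ln (x / r))))) has_integral
      c\<^sup>2 / 10 * (- ln (1 - ln (r / r))) - c\<^sup>2 / 10 * (- ln (1 - ln (s / r)))) {s..r}"
  proof (rule fundamental_theorem_of_calculus)
    fix x assume x: "x \<in> {s..r}"
    have x0: "0 < x" using x s by auto
    have ln: "ln (x / r) \<le> 0" using x x0 r_pos by (subst ln_le_zero_iff) auto
    have "((\<lambda>x. c\<^sup>2 / 10 * (- ln (1 - ln (x / r)))) has_real_derivative c\<^sup>2 / 10 * (1 / (x * (1 - ln (x / r))))) (at x)"
    proof -
      have "((\<lambda>x. x / r) has_real_derivative 1 / r) (at x)" by (intro DERIV_cdivide DERIV_ident)
      from DERIV_chain2[OF DERIV_ln_divide this] have "((\<lambda>x. ln (x / r)) has_real_derivative 1 / (x / r) * (1 / r)) (at x)"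
        using x0 r_pos by simp
      from DERIV_diff[OF DERIV_const this]
      have "((\<lambda>x. 1 - ln (x / r)) has_real_derivative 0 - 1 / (x / r) * (1 / r)) (at x)" .
      from DERIV_chain2[OF DERIV_ln_divide this]
      have "((\<lambda>x. ln (1 - ln (x / r))) has_real_derivative 1 / (1 - ln (x / r)) * (0 - 1 / (x / r) * (1 / r))) (at x)"
        using ln by simp
      from DERIV_cmult[OF DERIV_minus[OF this], of "c\<^sup>2 / 10"] show ?thesis
        using x0 r_pos by (simp add: mult.commute)
    qed
    then show "((\<lambda>x. c\<^sup>2 / 10 * (- ln (1 - ln (x / r)))) has_vector_derivative c\<^sup>2 / 10 * (1 / (x * (1 - ln (x / r))))) (at x within {s..r})"
      unfolding has_real_derivative_iff_has_vector_derivative[symmetric] by (rule has_field_derivative_at_within)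
  qed (use s in simp)
  have "ln (s / r) = 1 - exp k" using r_pos by (simp add: s_def)
  then have val: "c\<^sup>2 / 10 * (- ln (1 - ln (r / r))) - c\<^sup>2 / 10 * (- ln (1 - ln (s / r))) = \<bar>M\<bar> + 1"
    using c r_pos by (simp add: k_def)
  have iRe: "(\<lambda>x. Re (g x)) integrable_on S" if "S = {-r..r} \<or> S = {s..r}" for S
    using that s by (auto intro!: integrable_continuous_real continuous_on_Re continuous_on_subset[OF cg])
  have "\<bar>M\<bar> + 1 \<le> integral {s..r} (\<lambda>x. Re (g x))"
    using has_integral_le[OF prim integrable_integral[OF iRe[of "{s..r}"]] lower] val by simp
  also have "\<dots> \<le> integral {-r..r} (\<lambda>x. Re (g x))"
    using s r_pos pos by (intro integral_subset_le iRe) auto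
  also have "\<dots> = Re (integral {-r..r} g)"
    using integral_linear[OF integrable_continuous_real[OF cg] bounded_linear_Re] by (simp add: o_def)
  also have "\<dots> \<le> norm (integral {-r..r} g)" by (rule complex_Re_le_cmod)
  finally have "M < norm (integral {-r..r} g)" by linarith
  then show ?thesis using that s unfolding g_def by blast
qed

end

section \<open>The boundary near its lowest point\<close>

lemma isolating_ball:
  fixes w :: "real \<Rightarrow> complex"
  assumes "continuous_on T w" "compact T" "p \<notin> w ` T"
  obtains \<rho> where "0 < \<rho>" "ball p \<rho> \<inter> w ` T = {}"
proof -
  have "open (- w ` T)" using compact_continuous_image[OF assms(1,2)] by (simp add: compact_imp_closed open_Compl)
  then obtain \<rho> where "0 < \<rho>" "ball p \<rho> \<subseteq> - w ` T"
    using assms(3) by (auto elim: openE[of _ p])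
  then show ?thesis using that by blast
qed

lemma has_vector_derivative_union:
  assumes "(f has_vector_derivative D) (at x within S)" "(f has_vector_derivative D) (at x within T)"
  shows "(f has_vector_derivative D) (at x within S \<union> T)"
  using assms unfolding has_vector_derivative_def has_derivative_within
  by (auto simp: at_within_union intro: filterlim_sup)

lemma vector_derivative_shift:
  assumes "(f has_vector_derivative D) (at (a + x) within {b..c})" "{a + l..a + u} \<subseteq> {b..c}"
  shows "((\<lambda>x. f (a + x)) has_vector_derivative D) (at (x::real) within {l..u})"
proof -
  have 1: "((\<lambda>x. a + x) has_vector_derivative 1) (at x within {l..u})"
    unfolding has_real_derivative_iff_has_vector_derivative[symmetric] by (auto intro!: derivative_eq_intros)
  have "(f has_vector_derivative D) (at (a + x) within (\<lambda>x. a + x) ` {l..u})"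
    by (rule has_vector_derivative_within_subset[OF assms(1)]) (use assms(2) in auto)
  from vector_diff_chain_within[OF 1 this] show ?thesis by (simp add: o_def)
qed

text \<open>A closed curve has no distinguished point: also around the common end point of the parameter
  interval there is a parametrization by an interval around \<open>0\<close>, obtained by joining the last piece
  to the first, where the agreement of the one-sided derivatives is used. The last
  conclusion says that no other part of the curve comes close to \<open>p\<close>; it follows from
  injectivity and compactness.\<close>

lemma C1_holder_curve_local_parametrization:
  assumes "C1_holder_curve \<alpha> \<Gamma>" "p \<in> \<Gamma>" "0 < \<alpha>"
  obtains e e' K \<delta>0 where "0 < \<delta>0" "e 0 = p" "e' 0 \<noteq> 0" "0 \<le> K"
    "\<And>u. u \<in> {-\<delta>0..\<delta>0} \<Longrightarrow> (e has_vector_derivative e' u) (at u within {-\<delta>0..\<delta>0})"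
    "\<And>u. u \<in> {-\<delta>0..\<delta>0} \<Longrightarrow> e u \<in> \<Gamma>"
    "\<And>u v. u \<in> {-\<delta>0..\<delta>0} \<Longrightarrow> v \<in> {-\<delta>0..\<delta>0} \<Longrightarrow> norm (e' u - e' v) \<le> K * \<bar>u - v\<bar> powr \<alpha>"
    "\<And>\<delta>. 0 < \<delta> \<Longrightarrow> \<delta> \<le> \<delta>0 \<Longrightarrow> \<exists>\<rho>>0. \<Gamma> \<inter> ball p \<rho> \<subseteq> e ` {-\<delta><..<\<delta>}"
proof -
  obtain w w' C where w: "simple_path w" "pathfinish w = pathstart w" "path_image w = \<Gamma>"
    and der: "\<And>\<xi>. \<xi> \<in> {0..1} \<Longrightarrow> (w has_vector_derivative w' \<xi>) (at \<xi> within {0..1})"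
    and w'01: "w' 0 = w' 1" and nz: "\<And>\<xi>. \<xi> \<in> {0..1} \<Longrightarrow> w' \<xi> \<noteq> 0"
    and hol: "\<And>\<xi>1 \<xi>2. \<xi>1 \<in> {0..1} \<Longrightarrow> \<xi>2 \<in> {0..1} \<Longrightarrow> norm (w' \<xi>1 - w' \<xi>2) \<le> C * \<bar>\<xi>1 - \<xi>2\<bar> powr \<alpha>"
    using assms(1) unfolding C1_holder_curve_def by blast
  have \<Gamma>: "\<Gamma> = w ` {0..1}" using w(3) by (simp add: path_image_def)
  have w01: "w 0 = w 1" using w(2) by (simp add: pathfinish_def pathstart_def)
  have cw: "continuous_on {0..1} w" using w(1) by (simp add: simple_path_def path_def)
  have inj: "x = y \<or> x = 0 \<and> y = 1 \<or> x = 1 \<and> y = 0" if "x \<in> {0..1}" "y \<in> {0..1}" "w x = w y" for x y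
    using w(1) that unfolding simple_path_def loop_free_def by blast
  have C: "0 \<le> C" using order_trans[OF norm_ge_zero hol[of 0 1]] by simp
  obtain \<xi>0 where \<xi>0: "\<xi>0 \<in> {0..1}" "w \<xi>0 = p" using assms(2) \<Gamma> by auto
  show ?thesis
  proof (cases "\<xi>0 \<in> {0<..<1}")
    case True
    define \<delta>0 where "\<delta>0 = min \<xi>0 (1 - \<xi>0) / 2"
    have \<delta>0: "0 < \<delta>0" "\<delta>0 < \<xi>0" "\<delta>0 < 1 - \<xi>0" using True by (auto simp: \<delta>0_def min_def)
    show ?thesis
    proof (rule that[of \<delta>0 "\<lambda>u. w (\<xi>0 + u)" "\<lambda>u. w' (\<xi>0 + u)" C])
      show "((\<lambda>u. w (\<xi>0 + u)) has_vector_derivative w' (\<xi>0 + u)) (at u within {-\<delta>0..\<delta>0})" if "u \<in> {-\<delta>0..\<delta>0}" for u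
        by (rule vector_derivative_shift[OF der]) (use that \<delta>0 in auto)
      show "\<exists>\<rho>>0. \<Gamma> \<inter> ball p \<rho> \<subseteq> (\<lambda>u. w (\<xi>0 + u)) ` {-\<delta><..<\<delta>}" if \<delta>: "0 < \<delta>" "\<delta> \<le> \<delta>0" for \<delta>
      proof -
        define T where "T = {0..\<xi>0 - \<delta>} \<union> {\<xi>0 + \<delta>..1}"
        have T: "T \<subseteq> {0..1}" using \<delta> \<delta>0 by (auto simp: T_def)
        have "p \<notin> w ` T"
        proof
          assume "p \<in> w ` T"
          then obtain t where "t \<in> T" "w t = w \<xi>0" using \<xi>0 by auto
          then show False using inj[of t \<xi>0] T True \<delta> by (auto simp: T_def)
        qed
        moreover have "compact T" unfolding T_def by (intro compact_Un compact_Icc)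
        ultimately obtain \<rho> where \<rho>: "0 < \<rho>" "ball p \<rho> \<inter> w ` T = {}"
          using isolating_ball[OF continuous_on_subset[OF cw T]] by blast
        have "z \<in> (\<lambda>u. w (\<xi>0 + u)) ` {-\<delta><..<\<delta>}" if z: "z \<in> \<Gamma> \<inter> ball p \<rho>" for z
        proof -
          obtain \<xi> where \<xi>: "\<xi> \<in> {0..1}" "z = w \<xi>" using z \<Gamma> by auto
          then have "\<xi> \<notin> T" using z \<rho> by blast
          then have "\<xi> - \<xi>0 \<in> {-\<delta><..<\<delta>}" using \<xi> by (auto simp: T_def)
          then show ?thesis using \<xi> by (intro image_eqI[of _ _ "\<xi> - \<xi>0"]) auto
        qed
        then show ?thesis using \<rho> by blast
      qed
    qed (use \<xi>0 \<delta>0 C nz \<Gamma> hol[of "\<xi>0 + _" "\<xi>0 + _"] in auto)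
  next
    case False
    then have p: "p = w 0" "p = w 1" using \<xi>0 w01 by (auto simp: less_eq_real_def)
    define e where "e = (\<lambda>u. if u \<le> 0 then w (1 + u) else w (0 + u))"
    define e' where "e' = (\<lambda>u. if u \<le> 0 then w' (1 + u) else w' (0 + u))"
    have dl: "(e has_vector_derivative e' u) (at u within {-(1/4)..0})" if "u \<in> {-(1/4)..0}" for u
    proof (rule has_vector_derivative_transform[OF that])
      show "e x = w (1 + x)" if "x \<in> {-(1/4)..0}" for x using that by (auto simp: e_def)
      have "e' u = w' (1 + u)" using that by (auto simp: e'_def)
      then show "((\<lambda>x. w (1 + x)) has_vector_derivative e' u) (at u within {-(1/4)..0})"
        using vector_derivative_shift[OF der[of "1 + u"], of "-(1/4)" 0] that by auto
    qed
    have dr: "(e has_vector_derivative e' u) (at u within {0..1/4})" if "u \<in> {0..1/4}" for u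
    proof (rule has_vector_derivative_transform[OF that])
      show "e x = w (0 + x)" if "x \<in> {0..1/4}" for x using that w01 by (auto simp: e_def)
      have "e' u = w' (0 + u)" using that w'01 by (auto simp: e'_def)
      then show "((\<lambda>x. w (0 + x)) has_vector_derivative e' u) (at u within {0..1/4})"
        using vector_derivative_shift[OF der[of "0 + u"], of 0 "1/4"] that by auto
    qed
    have holder_glue: "norm (e' u - e' v) \<le> 2 * C * \<bar>u - v\<bar> powr \<alpha>" if "u \<le> v" "u \<in> {-(1/4)..1/4}" "v \<in> {-(1/4)..1/4}" for u v
    proof -
      have le: "C * x powr \<alpha> \<le> C * (v - u) powr \<alpha>" if "0 \<le> x" "x \<le> v - u" for x
        using that C assms(3) by (intro mult_left_mono powr_mono2) auto
      consider "v \<le> 0" | "0 < u" | "u \<le> 0" "0 < v" by linarith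
      then show ?thesis
      proof cases
        case 1
        have "norm (e' u - e' v) \<le> C * \<bar>u - v\<bar> powr \<alpha>" using 1 that hol[of "1 + u" "1 + v"] by (auto simp: e'_def)
        also have "\<dots> \<le> 2 * C * \<bar>u - v\<bar> powr \<alpha>" using C by (intro mult_right_mono) auto
        finally show ?thesis .
      next
        case 2
        have "norm (e' u - e' v) \<le> C * \<bar>u - v\<bar> powr \<alpha>" using 2 that hol[of u v] by (auto simp: e'_def)
        also have "\<dots> \<le> 2 * C * \<bar>u - v\<bar> powr \<alpha>" using C by (intro mult_right_mono) auto
        finally show ?thesis .
      next
        case 3
        have "norm (e' u - e' v) = norm ((w' (1 + u) - w' 1) + (w' 0 - w' v))" using 3 w'01 by (simp add: e'_def)
        also have "\<dots> \<le> norm (w' (1 + u) - w' 1) + norm (w' 0 - w' v)" by (rule norm_triangle_ineq)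
        also have "\<dots> \<le> C * (- u) powr \<alpha> + C * v powr \<alpha>"
          using hol[of "1 + u" 1] hol[of 0 v] 3 that by (intro add_mono) auto
        also have "\<dots> \<le> 2 * C * (v - u) powr \<alpha>" using le[of "- u"] le[of v] 3 by simp
        finally show ?thesis using that by (simp add: abs_minus_commute)
      qed
    qed
    show ?thesis
    proof (rule that[of "1/4" e e' "2 * C"])
      show "(e has_vector_derivative e' u) (at u within {-(1/4)..1/4})" if u: "u \<in> {-(1/4)..1/4}" for u
      proof -
        have U: "{-(1/4)..1/4} = {-(1/4)..0} \<union> {0..1/4::real}" by auto
        consider "u < 0" | "u = 0" | "0 < u" by linarith
        then show ?thesis
        proof cases
          case 1
          then have "at u within {-(1/4)..1/4} = at u within {-(1/4)..0}"
            by (intro at_within_nhd[of _ "{..<0}"]) auto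
          then show ?thesis using dl[of u] 1 u by auto
        next
          case 2
          then show ?thesis unfolding U using dl[of u] dr[of u] by (intro has_vector_derivative_union) auto
        next
          case 3
          then have "at u within {-(1/4)..1/4} = at u within {0..1/4}"
            by (intro at_within_nhd[of _ "{0<..}"]) auto
          then show ?thesis using dr[of u] 3 u by auto
        qed
      qed
      show "norm (e' u - e' v) \<le> 2 * C * \<bar>u - v\<bar> powr \<alpha>" if "u \<in> {-(1/4)..1/4}" "v \<in> {-(1/4)..1/4}" for u v
        using holder_glue[of u v] holder_glue[of v u] that
        by (cases "u \<le> v") (auto simp: norm_minus_commute abs_minus_commute)
      show "\<exists>\<rho>>0. \<Gamma> \<inter> ball p \<rho> \<subseteq> e ` {-\<delta><..<\<delta>}" if \<delta>: "0 < \<delta>" "\<delta> \<le> 1/4" for \<delta>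
      proof -
        define T where "T = {\<delta>..1 - \<delta>}"
        have T: "T \<subseteq> {0..1}" using \<delta> by (auto simp: T_def)
        have "p \<notin> w ` T"
        proof
          assume "p \<in> w ` T"
          then obtain t where "t \<in> T" "w t = w 0" using p by auto
          then show False using inj[of t 0] T \<delta> by (auto simp: T_def)
        qed
        moreover have "compact T" unfolding T_def by (intro compact_Un compact_Icc)
        ultimately obtain \<rho> where \<rho>: "0 < \<rho>" "ball p \<rho> \<inter> w ` T = {}"
          using isolating_ball[OF continuous_on_subset[OF cw T]] by blast
        have "z \<in> e ` {-\<delta><..<\<delta>}" if z: "z \<in> \<Gamma> \<inter> ball p \<rho>" for z
        proof -
          obtain \<xi> where \<xi>: "\<xi> \<in> {0..1}" "z = w \<xi>" using z \<Gamma> by auto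
          then have "\<xi> \<notin> T" using z \<rho> by blast
          then consider "\<xi> = 0" | "0 < \<xi>" "\<xi> < \<delta>" | "1 - \<delta> < \<xi>" using \<xi> by (fastforce simp: T_def)
          then show ?thesis
          proof cases
            case 1
            then show ?thesis using \<xi> w01 \<delta> by (intro image_eqI[of _ _ 0]) (auto simp: e_def)
          next
            case 2
            then show ?thesis using \<xi> \<delta> by (intro image_eqI[of _ _ \<xi>]) (auto simp: e_def)
          next
            case 3
            then show ?thesis using \<xi> \<delta> by (intro image_eqI[of _ _ "\<xi> - 1"]) (auto simp: e_def)
          qed
        qed
        then show ?thesis using \<rho> by blast
      qed
      show "e u \<in> \<Gamma>" if "u \<in> {-(1/4)..1/4}" for u using that \<Gamma> by (auto simp: e_def)
    qed (use p C nz[of 1] in \<open>auto simp: e_def e'_def\<close>)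
  qed
qed

text \<open>Close to \<open>0\<close> the real part of the arc has derivative at least \<open>m > 0\<close>, so it has a Lipschitz inverse
  \<open>g\<close>, and the arc is the graph of \<open>\<phi> = Y \<circ> g\<close>. The slope \<open>\<phi>'\<close> is the quotient of the components of
  \<open>e'\<close>, composed with \<open>g\<close>, and inherits its Hoelder condition.\<close>

lemma increasing_arc_is_graph:
  fixes e e' :: "real \<Rightarrow> complex"
  assumes "0 < \<alpha>" "0 \<le> K" "0 < \<delta>0"
    and der: "\<And>u. u \<in> {-\<delta>0..\<delta>0} \<Longrightarrow> (e has_vector_derivative e' u) (at u within {-\<delta>0..\<delta>0})"
    and hol: "\<And>u v. u \<in> {-\<delta>0..\<delta>0} \<Longrightarrow> v \<in> {-\<delta>0..\<delta>0} \<Longrightarrow> norm (e' u - e' v) \<le> K * \<bar>u - v\<bar> powr \<alpha>"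
    and start: "0 < Re (e' 0)" "Im (e' 0) = 0"
  obtains \<delta> r0 \<phi> \<phi>' C where "0 < \<delta>" "\<delta> \<le> \<delta>0" "0 < r0" "\<phi> 0 = 0" "\<phi>' 0 = 0"
    "\<And>x. x \<in> {-r0..r0} \<Longrightarrow> (\<phi> has_real_derivative \<phi>' x) (at x)"
    "\<And>x. x \<in> {-r0..r0} \<Longrightarrow> \<bar>\<phi>' x\<bar> \<le> 1"
    "\<And>x y. x \<in> {-r0..r0} \<Longrightarrow> y \<in> {-r0..r0} \<Longrightarrow> \<bar>\<phi>' x - \<phi>' y\<bar> \<le> C * \<bar>x - y\<bar> powr \<alpha>"
    "\<And>x. x \<in> {-r0..r0} \<Longrightarrow> \<exists>u\<in>{-\<delta>..\<delta>}. e u = e 0 + Complex x (\<phi> x)"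
    "\<And>u. u \<in> {-\<delta><..<\<delta>} \<Longrightarrow> e u = e 0 + Complex (Re (e u - e 0)) (\<phi> (Re (e u - e 0)))"
proof -
  define m where "m = Re (e' 0) / 2"
  have m: "0 < m" using start by (simp add: m_def)
  have "((\<lambda>u. K * \<bar>u\<bar> powr \<alpha>) \<longlongrightarrow> K * \<bar>0\<bar> powr \<alpha>) (at 0)"
    using assms(1) by (intro tendsto_intros) auto
  then have "((\<lambda>u. K * \<bar>u\<bar> powr \<alpha>) \<longlongrightarrow> 0) (at 0)" by simp
  from order_tendstoD(2)[OF this m]
  obtain \<delta>1 where \<delta>1: "0 < \<delta>1" "\<And>u. u \<noteq> 0 \<Longrightarrow> \<bar>u\<bar> < \<delta>1 \<Longrightarrow> K * \<bar>u\<bar> powr \<alpha> < m"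
    by (auto simp: eventually_at dist_norm)
  define \<delta> where "\<delta> = min \<delta>0 \<delta>1 / 2"
  have \<delta>: "0 < \<delta>" "\<delta> < \<delta>0" "\<delta> < \<delta>1" using assms(3) \<delta>1 by (auto simp: \<delta>_def min_def)
  have close: "norm (e' u - e' 0) \<le> m" if "u \<in> {-\<delta>..\<delta>}" for u
  proof (cases "u = 0")
    case False
    then show ?thesis using hol[of u 0] \<delta>1(2)[of u] that \<delta> by (auto simp: abs_if split: if_splits)
  qed (use m in simp)
  have Re': "m \<le> Re (e' u)" and Im': "\<bar>Im (e' u)\<bar> \<le> m" if "u \<in> {-\<delta>..\<delta>}" for u
    using close[OF that] abs_Re_le_cmod[of "e' u - e' 0"] abs_Im_le_cmod[of "e' u - e' 0"] start
    by (auto simp: m_def)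
  define X where "X = (\<lambda>u. Re (e u - e 0))"
  define Y where "Y = (\<lambda>u. Im (e u - e 0))"
  have derXY: "(X has_real_derivative Re (e' u)) (at u)" "(Y has_real_derivative Im (e' u)) (at u)" if "u \<in> {-\<delta>..\<delta>}" for u
  proof -
    have "at u within {-\<delta>0..\<delta>0} = at u" using that \<delta> by (intro at_within_Icc_at) auto
    then have "((\<lambda>u. e u - e 0) has_vector_derivative e' u - 0) (at u)"
      using der[of u] that \<delta> by (intro has_vector_derivative_diff has_vector_derivative_const) auto
    then show "(X has_real_derivative Re (e' u)) (at u)" "(Y has_real_derivative Im (e' u)) (at u)"
      unfolding X_def Y_def has_real_derivative_iff_has_vector_derivative
      using bounded_linear.has_vector_derivative[OF bounded_linear_Re]
        bounded_linear.has_vector_derivative[OF bounded_linear_Im] by fastforce+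
  qed
  have contX: "continuous_on {-\<delta>..\<delta>} X"
    using derXY(1) by (blast intro: DERIV_isCont continuous_at_imp_continuous_on)
  have growth: "m * (v - u) \<le> X v - X u" if uv: "u \<le> v" "u \<in> {-\<delta>..\<delta>}" "v \<in> {-\<delta>..\<delta>}" for u v
  proof (cases "u = v")
    case False
    then have "\<exists>z>u. z < v \<and> X v - X u = (v - u) * Re (e' z)"
      using uv derXY(1) by (intro MVT2) auto
    then obtain z where z: "u < z" "z < v" "X v - X u = (v - u) * Re (e' z)" by blast
    have "(v - u) * m \<le> (v - u) * Re (e' z)" using Re'[of z] z uv by (intro mult_left_mono) auto
    then show ?thesis using z by (simp add: mult.commute)
  qed auto
  have X0: "X 0 = 0" by (simp add: X_def)
  have injX: "inj_on X {-\<delta>..\<delta>}"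
  proof (rule inj_onI)
    fix u v assume *: "u \<in> {-\<delta>..\<delta>}" "v \<in> {-\<delta>..\<delta>}" "X u = X v"
    have "m * \<bar>u - v\<bar> \<le> 0" using growth[of u v] growth[of v u] * by (auto simp: abs_if)
    then show "u = v" using m by (simp add: mult_le_0_iff)
  qed
  define r0 where "r0 = m * \<delta> / 2"
  have r0: "0 < r0" "r0 < X \<delta>" "X (-\<delta>) < - r0"
  proof -
    have "0 < m * \<delta>" by (rule mult_pos_pos[OF m \<delta>(1)])
    moreover have "m * \<delta> \<le> X \<delta>" "m * \<delta> \<le> - X (-\<delta>)"
      using growth[of 0 \<delta>] growth[of "-\<delta>" 0] \<delta> X0 by auto
    ultimately show "0 < r0" "r0 < X \<delta>" "X (-\<delta>) < - r0" by (simp_all add: r0_def)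
  qed
  define g where "g = inv_into {-\<delta>..\<delta>} X"
  have surj: "x \<in> X ` {-\<delta>..\<delta>}" if "x \<in> {X (-\<delta>)..X \<delta>}" for x
  proof -
    have "\<exists>u\<ge>-\<delta>. u \<le> \<delta> \<and> X u = x"
      by (rule IVT') (use that \<delta> contX in auto)
    then show ?thesis by auto
  qed
  have gX: "g (X u) = u" if "u \<in> {-\<delta>..\<delta>}" for u
    unfolding g_def by (rule inv_into_f_f[OF injX that])
  have Xg: "X (g x) = x" "g x \<in> {-\<delta>..\<delta>}" if "x \<in> {X (-\<delta>)..X \<delta>}" for x
    using f_inv_into_f[OF surj[OF that]] inv_into_into[OF surj[OF that]] by (auto simp: g_def)
  have Xg_open: "g x \<in> {-\<delta><..<\<delta>}" if "x \<in> {X (-\<delta>)<..<X \<delta>}" for x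
    using Xg[of x] that by (cases "g x = \<delta> \<or> g x = -\<delta>") auto
  have g_lipschitz: "\<bar>g x - g y\<bar> \<le> \<bar>x - y\<bar> / m" if "x \<in> {X (-\<delta>)..X \<delta>}" "y \<in> {X (-\<delta>)..X \<delta>}" for x y
    using growth[of "g x" "g y"] growth[of "g y" "g x"] Xg[OF that(1)] Xg[OF that(2)] m
    by (auto simp: abs_if pos_le_divide_eq mult.commute)
  have derg: "(g has_real_derivative inverse (Re (e' (g x)))) (at x)" if x: "x \<in> {X (-\<delta>)<..<X \<delta>}" for x
  proof (rule DERIV_inverse_function[where f=X and a="X (-\<delta>)" and b="X \<delta>"])
    show "(X has_real_derivative Re (e' (g x))) (at (g x))" using Xg[of x] x by (intro derXY) auto
    show "Re (e' (g x)) \<noteq> 0" using Re'[of "g x"] Xg[of x] x m by auto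
    show "isCont g x"
    proof -
      have "isCont g (X (g x))"
        by (rule isCont_inverse_function2[of "-\<delta>" _ \<delta>])
          (use Xg_open[OF x] gX derXY(1) in \<open>auto intro: DERIV_isCont\<close>)
      then show ?thesis using Xg[of x] x by simp
    qed
  qed (use x Xg in auto)
  define \<phi> where "\<phi> = (\<lambda>x. Y (g x))"
  define \<phi>' where "\<phi>' = (\<lambda>x. Im (e' (g x)) / Re (e' (g x)))"
  define C where "C = 2 * K / m * (1 / m) powr \<alpha>"
  have mem: "x \<in> {X (-\<delta>)..X \<delta>}" "x \<in> {X (-\<delta>)<..<X \<delta>}" if "x \<in> {-r0..r0}" for x
    using that r0 by auto
  have g0: "g 0 = 0" using gX[of 0] X0 \<delta> by simp
  show ?thesis
  proof (rule that[of \<delta> r0 \<phi> \<phi>' C])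
    show "(\<phi> has_real_derivative \<phi>' x) (at x)" if "x \<in> {-r0..r0}" for x
      unfolding \<phi>_def \<phi>'_def divide_inverse
      by (rule DERIV_chain2[OF derXY(2) derg]) (use Xg mem[OF that] in auto)
    show "\<bar>\<phi>' x\<bar> \<le> 1" if "x \<in> {-r0..r0}" for x
      using Re'[of "g x"] Im'[of "g x"] Xg[OF mem(1)[OF that]] m by (auto simp: \<phi>'_def abs_divide divide_le_eq_1)
    show "\<bar>\<phi>' x - \<phi>' y\<bar> \<le> C * \<bar>x - y\<bar> powr \<alpha>" if x: "x \<in> {-r0..r0}" and y: "y \<in> {-r0..r0}" for x y
    proof -
      define u v where "u = g x" and "v = g y"
      have uv: "u \<in> {-\<delta>..\<delta>}" "v \<in> {-\<delta>..\<delta>}" using Xg mem x y by (auto simp: u_def v_def)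
      define h where "h = norm (e' u - e' v)"
      have h: "\<bar>Re (e' u) - Re (e' v)\<bar> \<le> h" "\<bar>Im (e' u) - Im (e' v)\<bar> \<le> h"
        using abs_Re_le_cmod[of "e' u - e' v"] abs_Im_le_cmod[of "e' u - e' v"] by (auto simp: h_def)
      have R: "m \<le> Re (e' u)" "m \<le> Re (e' v)" "\<bar>Im (e' v)\<bar> \<le> Re (e' v)"
        using Re'[OF uv(1)] Re'[OF uv(2)] Im'[OF uv(2)] by auto
      have "Im (e' u) / Re (e' u) - Im (e' v) / Re (e' v)
         = ((Im (e' u) - Im (e' v)) - (Im (e' v) / Re (e' v)) * (Re (e' u) - Re (e' v))) / Re (e' u)"
        using R m by (simp add: field_simps)
      also have "\<bar>\<dots>\<bar> \<le> (h + 1 * h) / m"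
      proof -
        have "\<bar>Im (e' v) / Re (e' v)\<bar> \<le> 1" using R m by (simp add: abs_divide divide_le_eq_1)
        then have "\<bar>Im (e' v) / Re (e' v) * (Re (e' u) - Re (e' v))\<bar> \<le> 1 * h"
          unfolding abs_mult using h by (intro mult_mono) auto
        then have "\<bar>(Im (e' u) - Im (e' v)) - (Im (e' v) / Re (e' v)) * (Re (e' u) - Re (e' v))\<bar> \<le> h + 1 * h"
          using h(2) by linarith
        then show ?thesis unfolding abs_divide[of _ "Re (e' u)"]
          using R m by (intro frac_le) (auto simp: h_def)
      qed
      finally have 1: "\<bar>\<phi>' x - \<phi>' y\<bar> \<le> 2 * h / m" by (simp add: \<phi>'_def u_def v_def)
      have "h \<le> K * \<bar>u - v\<bar> powr \<alpha>" unfolding h_def using hol uv \<delta> by auto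
      also have "\<dots> \<le> K * (\<bar>x - y\<bar> * (1 / m)) powr \<alpha>"
        using g_lipschitz mem x y assms(1,2) by (intro mult_left_mono powr_mono2) (auto simp: u_def v_def)
      also have "\<dots> = K * (\<bar>x - y\<bar> powr \<alpha> * (1 / m) powr \<alpha>)" using m by (subst powr_mult) auto
      finally have "2 * h / m \<le> 2 * (K * (\<bar>x - y\<bar> powr \<alpha> * (1 / m) powr \<alpha>)) / m"
        using m by (intro divide_right_mono) auto
      also have "\<dots> = C * \<bar>x - y\<bar> powr \<alpha>" by (simp add: C_def)
      finally show ?thesis using 1 by linarith
    qed
    show "\<exists>u\<in>{-\<delta>..\<delta>}. e u = e 0 + Complex x (\<phi> x)" if "x \<in> {-r0..r0}" for x
    proof (rule bexI[of _ "g x"])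
      show "e (g x) = e 0 + Complex x (\<phi> x)"
        using Xg(1)[OF mem(1)[OF that]] by (simp add: \<phi>_def X_def Y_def complex_eq_iff)
    qed (use Xg mem that in auto)
    show "e u = e 0 + Complex (Re (e u - e 0)) (\<phi> (Re (e u - e 0)))" if "u \<in> {-\<delta><..<\<delta>}" for u
      using gX[of u] that by (simp add: \<phi>_def X_def Y_def complex_eq_iff)
  qed (use \<delta> r0 g0 start in \<open>auto simp: \<phi>_def \<phi>'_def Y_def\<close>)
qed

lemma lowest_boundary_point:
  assumes "open G" "bounded G" "G \<noteq> {}"
  obtains p where "p \<in> frontier G" "\<And>z. z \<in> closure G \<Longrightarrow> Im p \<le> Im z"
proof -
  have "compact (closure G)" using assms by (simp add: compact_closure)
  then obtain p where p: "p \<in> closure G" "\<And>z. z \<in> closure G \<Longrightarrow> Im p \<le> Im z"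
    using continuous_attains_inf[of "closure G" Im] continuous_on_Im[OF continuous_on_id] assms(3)
    by auto
  have "p \<notin> G"
  proof
    assume "p \<in> G"
    then obtain \<epsilon> where \<epsilon>: "0 < \<epsilon>" "ball p \<epsilon> \<subseteq> G" using assms(1) openE by blast
    have "p - \<i> * (\<epsilon> / 2) \<in> ball p \<epsilon>" using \<epsilon> by (simp add: dist_norm norm_mult)
    then have "Im p \<le> Im (p - \<i> * (\<epsilon> / 2))" using \<epsilon> p(2) closure_subset by blast
    then show False using \<epsilon> by simp
  qed
  then show ?thesis using that[of p] p assms(1) by (simp add: frontier_def interior_open)
qed

text \<open>At a lowest point the tangent is horizontal, so the boundary is a graph over the \<open>x\<close>-axis, and the
  domain must lie above the graph: the strip \<open>S'\<close> just below the graph does not meet the frontier and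
  contains a point lower than \<open>p\<close>, so it is disjoint from \<open>G\<close>. Since \<open>p\<close> is a limit of points of
  \<open>G\<close>, the strip \<open>S\<close> above meets \<open>G\<close>, and by connectedness it is contained in \<open>G\<close>.\<close>

lemma boundary_graph_at_lowest_point:
  assumes "0 < \<alpha>" "\<alpha> < 1" "open G" "bounded G" "G \<noteq> {}" "connected G"
    and curve: "C1_holder_curve \<alpha> (frontier G)"
  obtains p \<phi> \<phi>' C r where "boundary_graph \<phi> \<phi>' \<alpha> C r" "\<phi> 0 = 0"
    "\<And>x. x \<in> {-2*r..2*r} \<Longrightarrow> p + Complex x (\<phi> x) \<in> frontier G"
    "\<And>x t. x \<in> {-2*r..2*r} \<Longrightarrow> t \<in> {0<..2*r} \<Longrightarrow> p + Complex x (\<phi> x + t) \<in> G"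
    "\<And>x. x \<in> {-2*r..2*r} \<Longrightarrow> (\<phi> has_real_derivative \<phi>' x) (at x)"
    "\<And>x. x \<in> {-2*r..2*r} \<Longrightarrow> \<bar>\<phi>' x\<bar> \<le> 1"
proof -
  obtain p where p: "p \<in> frontier G" and low: "\<And>z. z \<in> closure G \<Longrightarrow> Im p \<le> Im z"
    using lowest_boundary_point assms by metis
  have lowf: "Im p \<le> Im z" if "z \<in> frontier G" for z using low that by (auto simp: frontier_def)
  obtain e0 e0' K \<delta>0 where e0: "0 < \<delta>0" "e0 0 = p" "e0' 0 \<noteq> 0" "0 \<le> K"
    and der0: "\<And>u. u \<in> {-\<delta>0..\<delta>0} \<Longrightarrow> (e0 has_vector_derivative e0' u) (at u within {-\<delta>0..\<delta>0})"
    and mem0: "\<And>u. u \<in> {-\<delta>0..\<delta>0} \<Longrightarrow> e0 u \<in> frontier G"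
    and hol0: "\<And>u v. u \<in> {-\<delta>0..\<delta>0} \<Longrightarrow> v \<in> {-\<delta>0..\<delta>0} \<Longrightarrow> norm (e0' u - e0' v) \<le> K * \<bar>u - v\<bar> powr \<alpha>"
    and iso0: "\<And>\<delta>. 0 < \<delta> \<Longrightarrow> \<delta> \<le> \<delta>0 \<Longrightarrow> \<exists>\<rho>>0. frontier G \<inter> ball p \<rho> \<subseteq> e0 ` {-\<delta><..<\<delta>}"
    using C1_holder_curve_local_parametrization[OF curve p assms(1)] by metis
  have Im0: "Im (e0' 0) = 0"
  proof (rule DERIV_local_min)
    have "at 0 within {-\<delta>0..\<delta>0} = at 0" using e0 by (intro at_within_Icc_at) auto
    then have "(e0 has_vector_derivative e0' 0) (at 0)" using der0[of 0] e0 by auto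
    then show "((\<lambda>u. Im (e0 u)) has_real_derivative Im (e0' 0)) (at 0)"
      unfolding has_real_derivative_iff_has_vector_derivative by (rule bounded_linear.has_vector_derivative[OF bounded_linear_Im])
    show "\<forall>y. \<bar>0 - y\<bar> < \<delta>0 \<longrightarrow> Im (e0 0) \<le> Im (e0 y)"
      using lowf[OF mem0] e0(2) by (auto simp: abs_if split: if_splits)
  qed (rule e0)
  \<comment> \<open>If the parametrization runs to the left at \<open>p\<close>, it is reversed.\<close>
  define \<sigma> where "\<sigma> = sgn (Re (e0' 0))"
  have Re0: "Re (e0' 0) \<noteq> 0" using e0 Im0 by (auto simp: complex_eq_iff)
  then have \<sigma>: "\<sigma> = 1 \<or> \<sigma> = -1" by (auto simp: \<sigma>_def sgn_if)
  define e where "e = (\<lambda>u. e0 (\<sigma> * u))"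
  define e' where "e' = (\<lambda>u. \<sigma> *\<^sub>R e0' (\<sigma> * u))"
  have \<sigma>m: "\<sigma> * u \<in> {-a..a}" if "u \<in> {-a..a}" for u a using \<sigma> that by auto
  have der: "(e has_vector_derivative e' u) (at u within {-\<delta>0..\<delta>0})" if u: "u \<in> {-\<delta>0..\<delta>0}" for u
  proof -
    have 1: "((\<lambda>u. \<sigma> * u) has_vector_derivative \<sigma>) (at u within {-\<delta>0..\<delta>0})"
      unfolding has_real_derivative_iff_has_vector_derivative[symmetric] by (auto intro!: derivative_eq_intros)
    have "(e0 has_vector_derivative e0' (\<sigma> * u)) (at (\<sigma> * u) within (\<lambda>u. \<sigma> * u) ` {-\<delta>0..\<delta>0})"
      by (rule has_vector_derivative_within_subset[OF der0[OF \<sigma>m[OF u]]]) (use \<sigma>m in blast)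
    from vector_diff_chain_within[OF 1 this] show ?thesis by (simp add: e_def e'_def o_def)
  qed
  have hol: "norm (e' u - e' v) \<le> K * \<bar>u - v\<bar> powr \<alpha>" if "u \<in> {-\<delta>0..\<delta>0}" "v \<in> {-\<delta>0..\<delta>0}" for u v
  proof -
    have "norm (e' u - e' v) = norm (e0' (\<sigma> * u) - e0' (\<sigma> * v))"
      using \<sigma> by (auto simp: e'_def norm_minus_commute)
    also have "\<dots> \<le> K * \<bar>\<sigma> * u - \<sigma> * v\<bar> powr \<alpha>" by (intro hol0 \<sigma>m that)
    also have "\<bar>\<sigma> * u - \<sigma> * v\<bar> = \<bar>u - v\<bar>" using \<sigma> by auto
    finally show ?thesis .
  qed
  have start: "0 < Re (e' 0)" "Im (e' 0) = 0"
    using Re0 Im0 by (auto simp: e'_def \<sigma>_def sgn_if)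
  obtain \<delta> r0 \<phi> \<phi>' C where \<delta>: "0 < \<delta>" "\<delta> \<le> \<delta>0" and r0: "0 < r0" and \<phi>0: "\<phi> 0 = 0" "\<phi>' 0 = 0"
    and \<phi>der: "\<And>x. x \<in> {-r0..r0} \<Longrightarrow> (\<phi> has_real_derivative \<phi>' x) (at x)"
    and \<phi>slope: "\<And>x. x \<in> {-r0..r0} \<Longrightarrow> \<bar>\<phi>' x\<bar> \<le> 1"
    and \<phi>hol: "\<And>x y. x \<in> {-r0..r0} \<Longrightarrow> y \<in> {-r0..r0} \<Longrightarrow> \<bar>\<phi>' x - \<phi>' y\<bar> \<le> C * \<bar>x - y\<bar> powr \<alpha>"
    and onto: "\<And>x. x \<in> {-r0..r0} \<Longrightarrow> \<exists>u\<in>{-\<delta>..\<delta>}. e u = e 0 + Complex x (\<phi> x)"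
    and graph: "\<And>u. u \<in> {-\<delta><..<\<delta>} \<Longrightarrow> e u = e 0 + Complex (Re (e u - e 0)) (\<phi> (Re (e u - e 0)))"
    by (rule increasing_arc_is_graph[OF assms(1) e0(4) e0(1) der hol start], assumption, assumption, assumption, rule that)
  have ep: "e 0 = p" using e0 by (simp add: e_def)
  have on_frontier: "p + Complex x (\<phi> x) \<in> frontier G" if x: "x \<in> {-r0..r0}" for x
  proof -
    obtain u where "u \<in> {-\<delta>..\<delta>}" "e u = p + Complex x (\<phi> x)" using onto[OF x] ep by auto
    then show ?thesis using mem0[OF \<sigma>m[of u \<delta>0]] \<delta> by (auto simp: e_def)
  qed
  have \<phi>nonneg: "0 \<le> \<phi> x" if "x \<in> {-r0..r0}" for x using lowf[OF on_frontier[OF that]] by simp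
  obtain \<rho> where \<rho>: "0 < \<rho>" "frontier G \<inter> ball p \<rho> \<subseteq> e0 ` {-\<delta><..<\<delta>}" using iso0[OF \<delta>] by blast
  define r where "r = min r0 \<rho> / 8"
  have r: "0 < r" "2 * r \<le> r0" "8 * r \<le> \<rho>" using r0 \<rho> by (auto simp: r_def min_def)
  have sub: "x \<in> {-r0..r0}" if "x \<in> {-2*r..2*r}" for x using that r by auto
  have frontier_in_graph: "y = \<phi> x" if on: "p + Complex x y \<in> frontier G" and near: "\<bar>x\<bar> + \<bar>y\<bar> < \<rho>" for x y
  proof -
    have "dist p (p + Complex x y) < \<rho>" using cmod_le[of "Complex x y"] near by (simp add: dist_norm)
    then have "p + Complex x y \<in> e0 ` {-\<delta><..<\<delta>}" using \<rho>(2) on by (intro subsetD[OF \<rho>(2)]) simp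
    then obtain v where v: "v \<in> {-\<delta><..<\<delta>}" "p + Complex x y = e0 v" by blast
    define u where "u = \<sigma> * v"
    have "u \<in> {-\<delta><..<\<delta>}" "p + Complex x y = e u" using v \<sigma> by (auto simp: u_def e_def)
    then have "e u = p + Complex x y" "e u = p + Complex (Re (e u - p)) (\<phi> (Re (e u - p)))"
      using graph[of u] ep by auto
    then have "Complex x y = Complex x (\<phi> x)" by simp
    then show ?thesis by simp
  qed
  have \<phi>le: "\<phi> x \<le> \<bar>x\<bar>" if "x \<in> {-r0..r0}" for x
  proof -
    have "norm (\<phi> x - \<phi> 0) \<le> 1 * norm (x - 0)"
      by (rule field_differentiable_bound[of "{-r0..r0}" \<phi> \<phi>'])
        (use \<phi>der \<phi>slope that r0 in \<open>auto intro: has_field_derivative_at_within\<close>)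
    then show ?thesis using \<phi>0 by simp
  qed
  define S where "S = (\<lambda>(x,t). p + Complex x (\<phi> x + t)) ` ({-2*r..2*r} \<times> {0<..2*r})"
  define S' where "S' = (\<lambda>(x,t). p + Complex x (\<phi> x + t)) ` ({-2*r..2*r} \<times> {-2*r..<0})"
  have conn: "connected ((\<lambda>(x,t). p + Complex x (\<phi> x + t)) ` ({-2*r..2*r} \<times> I))" if "convex I" for I
  proof (rule connected_continuous_image)
    have "continuous_on {-r0..r0} \<phi>"
      using \<phi>der by (blast intro: DERIV_isCont continuous_at_imp_continuous_on)
    then have "continuous_on ({-2*r..2*r} \<times> I) (\<lambda>z. \<phi> (fst z))"
      by (rule continuous_on_compose2) (use sub in \<open>auto intro!: continuous_intros\<close>)
    then show "continuous_on ({-2*r..2*r} \<times> I) (\<lambda>(x,t). p + Complex x (\<phi> x + t))"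
      unfolding split_beta by (intro continuous_intros)
    show "connected ({-2*r..2*r} \<times> I)" using that by (intro convex_connected convex_Times) auto
  qed
  have off: "p + Complex x (\<phi> x + t) \<notin> frontier G" if "x \<in> {-2*r..2*r}" "t \<in> {-2*r..2*r}" "t \<noteq> 0" for x t
  proof
    assume *: "p + Complex x (\<phi> x + t) \<in> frontier G"
    have "\<bar>x\<bar> + \<bar>\<phi> x + t\<bar> < \<rho>" using that r \<phi>le[OF sub[OF that(1)]] \<phi>nonneg[OF sub[OF that(1)]] by (auto simp: abs_if split: if_splits)
    from frontier_in_graph[OF * this] show False using that by simp
  qed
  have S'G: "S' \<inter> G = {}"
  proof (rule ccontr)
    assume "S' \<inter> G \<noteq> {}"
    moreover have "p + Complex 0 (\<phi> 0 + - r) \<in> S' - G"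
      using r \<phi>0 low[of "p + Complex 0 (\<phi> 0 + - r)"] closure_subset[of G]
      by (auto simp: S'_def intro!: image_eqI[of _ _ "(0, - r)"])
    ultimately have "S' \<inter> frontier G \<noteq> {}"
      using connected_Int_frontier[of S' G] conn[OF convex_real_interval(7)] unfolding S'_def by blast
    then show False using off by (auto simp: S'_def)
  qed
  have "S \<inter> G \<noteq> {}"
  proof
    assume SG: "S \<inter> G = {}"
    have "p \<in> closure G" using p by (simp add: frontier_def)
    then obtain z where z: "z \<in> G" "dist z p < r" using r closure_approachable by blast
    define x t where "x = Re (z - p)" and "t = Im (z - p) - \<phi> x"
    have xy: "\<bar>x\<bar> < r" "\<bar>Im (z - p)\<bar> < r"
      using z abs_Re_le_cmod[of "z - p"] abs_Im_le_cmod[of "z - p"] by (auto simp: x_def dist_norm)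
    have x: "x \<in> {-2*r..2*r}" using xy by auto
    have zeq: "z = p + Complex x (\<phi> x + t)" by (simp add: x_def t_def complex_eq_iff)
    have t: "\<bar>t\<bar> \<le> 2 * r" using xy \<phi>le[OF sub[OF x]] \<phi>nonneg[OF sub[OF x]] by (auto simp: t_def)
    consider "0 < t" | "t = 0" | "t < 0" by linarith
    then show False
    proof cases
      case 1
      then have "z \<in> S" unfolding S_def using x t zeq by (intro image_eqI[of _ _ "(x, t)"]) auto
      then show False using SG z by auto
    next
      case 2
      then have "z \<in> frontier G" using on_frontier[OF sub[OF x]] zeq by simp
      then show False using z assms(3) by (simp add: frontier_def interior_open)
    next
      case 3
      then have "z \<in> S'" unfolding S'_def using x t zeq by (intro image_eqI[of _ _ "(x, t)"]) auto
      then show False using S'G z by auto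
    qed
  qed
  then have SG: "S \<subseteq> G"
  proof -
    have "S \<inter> frontier G = {}" using off by (auto simp: S_def)
    then show ?thesis
      using connected_Int_frontier[of S G] conn[OF convex_real_interval(6)] \<open>S \<inter> G \<noteq> {}\<close> unfolding S_def by blast
  qed
  have bg: "boundary_graph \<phi> \<phi>' \<alpha> C r"
    by unfold_locales (use assms(1,2) r \<phi>der \<phi>slope \<phi>hol \<phi>nonneg \<phi>0 in auto)
  show ?thesis
  proof (rule that[OF bg \<phi>0(1)])
    show "p + Complex x (\<phi> x + t) \<in> G" if "x \<in> {-2*r..2*r}" "t \<in> {0<..2*r}" for x t
    proof -
      have "p + Complex x (\<phi> x + t) \<in> S" unfolding S_def using that by (intro image_eqI[of _ _ "(x, t)"]) auto
      then show ?thesis using SG by blast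
    qed
  qed (use on_frontier \<phi>der \<phi>slope sub in auto)
qed

section \<open>Domains bounded by a smooth curve are not regular\<close>

definition dbar_x :: "(complex \<Rightarrow> complex) \<Rightarrow> complex \<Rightarrow> complex" where
  "dbar_x f z = 1 / 2 * partial_x (partial_x f) z + \<i> / 2 * partial_x (partial_y f) z"

definition dbar_y :: "(complex \<Rightarrow> complex) \<Rightarrow> complex \<Rightarrow> complex" where
  "dbar_y f z = 1 / 2 * partial_y (partial_x f) z + \<i> / 2 * partial_y (partial_y f) z"

text \<open>The equation is \<open>\<partial>\<^sub>\<tau>\<close> first and the conjugate derivative second. By symmetry of the second
  derivatives the order can be reversed, which gives a first-order equation for \<open>dbar f\<close>.\<close>

lemma L_solution_derivatives:
  assumes "L_solution_on \<tau> U f" "open U"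
  shows "z \<in> U \<Longrightarrow> has_grad f (partial_x f z) (partial_y f z) z"
    and "z \<in> U \<Longrightarrow> has_grad (dbar f) (dbar_x f z) (dbar_y f z) z"
    and "z \<in> U \<Longrightarrow> of_real ((1 + \<tau>) / 2) * dbar_x f z + \<i> * of_real ((1 - \<tau>) / 2) * dbar_y f z = 0"
    and "continuous_on U (partial_x f)" "continuous_on U (partial_y f)"
    and "continuous_on U (dbar_x f)" "continuous_on U (dbar_y f)"
proof -
  have C2: "C2_on U f" and L: "\<And>z. z \<in> U \<Longrightarrow> L_op \<tau> f z = 0"
    using assms(1) by (auto simp: L_solution_on_def)
  have C1: "C1_on U f" "C1_on U (partial_x f)" "C1_on U (partial_y f)"
    using C2 by (auto simp: C2_on_def)
  note grad = C1_on_has_grad[OF C1(2) assms(2)] C1_on_has_grad[OF C1(3) assms(2)]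
  show "z \<in> U \<Longrightarrow> has_grad f (partial_x f z) (partial_y f z) z"
    by (rule C1_on_has_grad[OF C1(1) assms(2)])
  have dbar: "dbar f = (\<lambda>z. 1 / 2 * partial_x f z + \<i> / 2 * partial_y f z)"
    by (simp add: dbar_def fun_eq_iff add_divide_distrib)
  show "z \<in> U \<Longrightarrow> has_grad (dbar f) (dbar_x f z) (dbar_y f z) z"
    unfolding dbar dbar_x_def dbar_y_def by (intro has_grad_linear grad)
  show "continuous_on U (partial_x f)" "continuous_on U (partial_y f)"
    using C1(1) by (auto simp: C1_on_def)
  show "continuous_on U (dbar_x f)" "continuous_on U (dbar_y f)"
    unfolding dbar_x_def dbar_y_def using C1(2,3) by (auto simp: C1_on_def intro!: continuous_intros)
  show "of_real ((1 + \<tau>) / 2) * dbar_x f z + \<i> * of_real ((1 - \<tau>) / 2) * dbar_y f z = 0" if z: "z \<in> U"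
  proof -
    define a b where "a = complex_of_real ((1 + \<tau>) / 2)" and "b = \<i> * complex_of_real ((1 - \<tau>) / 2)"
    have "del_tau \<tau> f = (\<lambda>z. a * partial_x f z + b * partial_y f z)"
      by (simp add: del_tau_def dbar_def del_def a_def b_def fun_eq_iff field_simps)
    then have "has_grad (del_tau \<tau> f)
        (a * partial_x (partial_x f) z + b * partial_x (partial_y f) z)
        (a * partial_y (partial_x f) z + b * partial_y (partial_y f) z) z"
      using has_grad_linear[OF grad(1)[OF z] grad(2)[OF z]] by simp
    from partials_of_has_grad[OF this]
    have "L_op \<tau> f z = ((a * partial_x (partial_x f) z + b * partial_x (partial_y f) z)
        + \<i> * (a * partial_y (partial_x f) z + b * partial_y (partial_y f) z)) / 2"
      by (simp add: L_op_def dbar_def)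
    also have "\<dots> = a * dbar_x f z + b * dbar_y f z"
      unfolding dbar_x_def dbar_y_def mixed_partials_commute[OF C2 assms(2) z]
      by (simp add: field_simps)
    finally show ?thesis using L[OF z] by (simp add: a_def b_def)
  qed
qed

text \<open>Constants are solutions, so the bound involves only the oscillation of \<open>f\<close>.\<close>

lemma dbar_bound:
  assumes sol: "L_solution_on \<tau> G f" "open G" and tau: "0 \<le> \<tau>" "\<tau> < 1"
    and ball: "cball z0 R \<subseteq> G" "0 < R" and bound: "\<And>z. z \<in> cball z0 R \<Longrightarrow> norm (f z - k) \<le> b"
  shows "norm (dbar f z0) \<le> b / ((1 + \<tau>) / 2 * ((1 - \<tau>) / 2) * R)"
proof -
  note d = L_solution_derivatives[OF sol]
  show ?thesis
  proof (rule elliptic_gradient_bound[where f="\<lambda>z. f z - k" and v="dbar f"])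
    show "has_grad (\<lambda>z. f z - k) (partial_x f z) (partial_y f z) z" if "z \<in> cball z0 R" for z
      using has_grad_minus_const[OF d(1)] that ball by blast
    show "has_grad (dbar f) (dbar_x f z) (dbar_y f z) z" if "z \<in> cball z0 R" for z
      using d(2) that ball by blast
    show "of_real ((1 + \<tau>) / 2) * dbar_x f z + \<i> * of_real ((1 - \<tau>) / 2) * dbar_y f z = 0" if "z \<in> cball z0 R" for z
      using d(3) that ball by blast
    show "continuous_on (cball z0 R) (partial_x f)" "continuous_on (cball z0 R) (partial_y f)"
      "continuous_on (cball z0 R) (dbar_x f)" "continuous_on (cball z0 R) (dbar_y f)"
      using d(4-7) ball(1) continuous_on_subset by blast+
  qed (use tau ball(2) bound in \<open>auto simp: dbar_def\<close>)
qed

lemma C1_holder_domain_not_regular: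
  assumes "0 < \<alpha>" "\<alpha> < 1" "open G" "bounded G" "G \<noteq> {}" "connected G"
    and curve: "C1_holder_curve \<alpha> (frontier G)" and tau: "0 \<le> \<tau>" "\<tau> < 1"
  shows "\<not> L_regular \<tau> G"
proof
  assume reg: "L_regular \<tau> G"
  obtain p \<phi> \<phi>' C r where bg: "boundary_graph \<phi> \<phi>' \<alpha> C r" and \<phi>0: "\<phi> 0 = 0"
    and on: "\<And>x. x \<in> {-2*r..2*r} \<Longrightarrow> p + Complex x (\<phi> x) \<in> frontier G"
    and inside: "\<And>x t. x \<in> {-2*r..2*r} \<Longrightarrow> t \<in> {0<..2*r} \<Longrightarrow> p + Complex x (\<phi> x + t) \<in> G"
    and \<phi>der: "\<And>x. x \<in> {-2*r..2*r} \<Longrightarrow> (\<phi> has_real_derivative \<phi>' x) (at x)"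
    and \<phi>slope: "\<And>x. x \<in> {-2*r..2*r} \<Longrightarrow> \<bar>\<phi>' x\<bar> \<le> 1"
    by (rule boundary_graph_at_lowest_point[OF assms(1-6) curve]) (rule that)
  interpret boundary_graph \<phi> \<phi>' \<alpha> C r by (rule bg)
  define c \<beta> where "c = (1 - \<tau>) / 2" and "\<beta> = 2 * \<tau> / (1 - \<tau>)"
  define d where "d = c * (1 + \<beta>)"
  have c: "0 < c" "c \<le> 1" and \<beta>: "0 \<le> \<beta>" using tau by (auto simp: c_def \<beta>_def)
  have d_eq: "d = (1 + \<tau>) / 2" using tau by (simp add: d_def c_def \<beta>_def field_simps)
  have d: "0 < d" "d \<le> 1" using tau by (auto simp: d_eq)
  define P where "P = (\<lambda>x. cnj (boundary_weight c d x) * log_bump r x)"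
  \<comment> \<open>Near \<open>p\<close> this is \<open>P\<close> of the coordinate \<open>x\<close>; clamping makes it continuous on the whole plane.\<close>
  define \<psi> where "\<psi> = (\<lambda>z. P (max (-r) (min r (Re (z - p)))))"
  have cP: "continuous_on {-r..r} P" unfolding P_def
    by (intro continuous_intros continuous_boundary_weight continuous_on_subset[OF continuous_on_log_bump[OF r_pos]]) auto
  have "continuous_on UNIV \<psi>" unfolding \<psi>_def
    by (rule continuous_on_compose2[OF cP]) (use r_pos in \<open>auto intro!: continuous_intros\<close>)
  then have "continuous_on (frontier G) \<psi>" by (rule continuous_on_subset) simp
  moreover from this have "bounded (\<psi> ` frontier G)"
    by (intro compact_imp_bounded compact_continuous_image compact_frontier_bounded assms(4))
  ultimately have "\<psi> \<in> bounded_continuous (frontier G)" by (simp add: bounded_continuous_def)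
  then obtain f where f: "f \<in> bounded_continuous (closure G)" and sol: "L_solution_on \<tau> G f"
    and bdry: "\<And>z. z \<in> frontier G \<Longrightarrow> f z = \<psi> z"
    using reg unfolding L_regular_def by blast
  have cf: "continuous_on (closure G) f" using f by (simp add: bounded_continuous_def)
  obtain B0 where B0: "\<And>z. z \<in> closure G \<Longrightarrow> norm (f z) \<le> B0" "0 \<le> B0"
    using f unfolding bounded_continuous_def bounded_pos by force
  \<comment> \<open>The constant of the gradient bound on balls of radius \<open>t / 3\<close>; it also bounds \<open>f\<close>.\<close>
  define B where "B = 3 * B0 / (d * c)"
  have B: "B0 \<le> B"
  proof -
    have "d * c \<le> 1" using mult_mono[OF d(2) c(2)] c d by simp
    then have "B0 * (d * c) \<le> B0 * 3" using B0(2) by (intro mult_left_mono) auto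
    then show ?thesis using c d by (simp add: B_def pos_le_divide_eq mult.commute)
  qed
  note der = L_solution_derivatives[OF sol assms(3)]
  define E where "E = (\<lambda>x t. p + Complex x (\<phi> x + t))"
  have EG: "E x t \<in> G" if "x \<in> {-r..r}" "t \<in> {0<..r}" for x t
    unfolding E_def by (rule inside) (use that in auto)
  have Ecl: "E x t \<in> closure G" if "x \<in> {-r..r}" "t \<in> {0..r}" for x t
  proof (cases "t = 0")
    case True
    then show ?thesis using on[of x] that by (auto simp: E_def frontier_def)
  next
    case False
    then show ?thesis using EG[of x t] that closure_subset by auto
  qed
  have lip: "\<bar>\<phi> x - \<phi> y\<bar> \<le> \<bar>x - y\<bar>" if "x \<in> {-2*r..2*r}" "y \<in> {-2*r..2*r}" for x y
  proof -
    have "norm (\<phi> x - \<phi> y) \<le> 1 * norm (x - y)"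
      by (rule field_differentiable_bound[of "{-2*r..2*r}" \<phi> \<phi>'])
        (use \<phi>der \<phi>slope that in \<open>auto intro: has_field_derivative_at_within\<close>)
    then show ?thesis by simp
  qed
  \<comment> \<open>As the graph has slope at most 1, its distance from a point at height \<open>t\<close> is more than \<open>t / 3\<close>.\<close>
  have ball: "cball (E x t) (t / 3) \<subseteq> G" if x: "x \<in> {-r..r}" and t: "t \<in> {0<..r}" for x t
  proof
    fix z assume z: "z \<in> cball (E x t) (t / 3)"
    define x' y' where "x' = Re (z - p)" and "y' = Im (z - p)"
    have dx: "\<bar>x' - x\<bar> \<le> t / 3" and dy: "\<bar>y' - (\<phi> x + t)\<bar> \<le> t / 3"
    proof -
      have "norm (z - E x t) \<le> t / 3" using z by (simp add: dist_norm norm_minus_commute)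
      moreover have "Re (z - E x t) = x' - x" "Im (z - E x t) = y' - (\<phi> x + t)"
        by (simp_all add: E_def x'_def y'_def)
      ultimately show "\<bar>x' - x\<bar> \<le> t / 3" "\<bar>y' - (\<phi> x + t)\<bar> \<le> t / 3"
        using abs_Re_le_cmod[of "z - E x t"] abs_Im_le_cmod[of "z - E x t"] by linarith+
    qed
    have x': "x' \<in> {-2*r..2*r}"
      using dx x t unfolding atLeastAtMost_iff greaterThanAtMost_iff abs_le_iff by linarith
    have "x \<in> {-2*r..2*r}" using x r_pos by auto
    from lip[OF x' this] have "\<bar>\<phi> x' - \<phi> x\<bar> \<le> t / 3" using dx by linarith
    then have "y' - \<phi> x' \<in> {0<..2*r}"
      using dy t unfolding greaterThanAtMost_iff abs_le_iff by linarith
    from inside[OF x' this] have "p + Complex x' y' \<in> G" by simp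
    moreover have "p + Complex x' y' = z" by (simp add: x'_def y'_def complex_eq_iff)
    ultimately show "z \<in> G" by simp
  qed
  have cE: "continuous_on (T \<times> {-r..r}) (\<lambda>q. E (snd q) (fst q))" for T
    unfolding E_def
    by (intro continuous_intros continuous_on_compose2[OF continuous_graph]) (use r_pos in auto)
  have cG: "continuous_on ({0<..r} \<times> {-r..r}) (\<lambda>(t,x). h (E x t))" if "continuous_on G h" for h :: "complex \<Rightarrow> complex"
    unfolding split_beta by (rule continuous_on_compose2[OF that cE]) (use EG in auto)
  have E_x: "((\<lambda>x. E x t) has_vector_derivative Complex 1 (\<phi>' x)) (at x within {-r..r})" if "x \<in> {-r..r}" for x t
  proof -
    have "(\<phi> has_real_derivative \<phi>' x) (at x within {-r..r})"
      by (rule has_field_derivative_at_within[OF \<phi>der]) (use that in auto)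
    then have "((\<lambda>x. Complex x (\<phi> x + t)) has_vector_derivative Complex 1 (\<phi>' x)) (at x within {-r..r})"
      by (intro has_vector_derivative_Complex) (auto intro!: derivative_eq_intros)
    from has_vector_derivative_add[OF has_vector_derivative_const this] show ?thesis by (simp add: E_def)
  qed
  have E_t: "((\<lambda>t. E x t) has_vector_derivative Complex 0 1) (at t within {0<..r})" for x t
  proof -
    have "((\<lambda>t. Complex x (\<phi> x + t)) has_vector_derivative Complex 0 1) (at t within {0<..r})"
      by (intro has_vector_derivative_Complex) (auto intro!: derivative_eq_intros)
    from has_vector_derivative_add[OF has_vector_derivative_const this] show ?thesis by (simp add: E_def)
  qed
  have Vb: "norm (dbar f (E x t)) \<le> b / (d * c * (t / 3))"
    if "x \<in> {-r..r}" "t \<in> {0<..r}" "\<And>z. z \<in> cball (E x t) (t / 3) \<Longrightarrow> norm (f z - k) \<le> b" for x t k b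
    using dbar_bound[OF sol assms(3) tau ball[OF that(1,2)] _ that(3)] that(2) by (simp add: c_def d_eq)
  have small: "\<exists>\<delta>>0. \<forall>x\<in>{-r..r}. \<forall>t\<in>{0<..<\<delta>}. t \<le> r \<longrightarrow> t * norm (dbar f (E x t)) \<le> \<epsilon>" if "0 < \<epsilon>" for \<epsilon>
  proof -
    have "uniformly_continuous_on (closure G) f"
      using cf assms(4) by (intro compact_uniformly_continuous) (auto simp: compact_closure)
    moreover have e: "0 < \<epsilon> * (d * c) / 3" using that c d by simp
    ultimately obtain \<eta> where \<eta>: "0 < \<eta>"
      "\<And>z z'. z \<in> closure G \<Longrightarrow> z' \<in> closure G \<Longrightarrow> dist z' z < \<eta> \<Longrightarrow> dist (f z') (f z) < \<epsilon> * (d * c) / 3"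
      unfolding uniformly_continuous_on_def by blast
    have "t * norm (dbar f (E x t)) \<le> \<epsilon>" if x: "x \<in> {-r..r}" and t: "t \<in> {0<..<\<eta>}" "t \<le> r" for x t
    proof -
      have t': "t \<in> {0<..r}" using t by auto
      have "norm (f z - f (E x t)) \<le> \<epsilon> * (d * c) / 3" if z: "z \<in> cball (E x t) (t / 3)" for z
      proof -
        have "z \<in> closure G" using ball[OF x t'] z closure_subset by blast
        moreover have "dist z (E x t) < \<eta>" using z t by (simp add: dist_commute)
        ultimately show ?thesis using \<eta>(2)[OF Ecl[OF x], of t z] t' by (auto simp: dist_norm)
      qed
      from Vb[OF x t' this] have "norm (dbar f (E x t)) \<le> \<epsilon> / t" using c d t' by simp
      then show ?thesis using t' by (simp add: pos_le_divide_eq mult.commute)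
    qed
    then show ?thesis using \<eta>(1) by blast
  qed
  \<comment> \<open>The solution has the chosen boundary values, so the flux estimate applies to the test integral.\<close>
  have bound: "norm (integral {-r..r} (\<lambda>x. boundary_weight c d x * (cnj (boundary_weight c d x) * log_bump r x) / Complex x (\<phi> x + s) / 2))
      \<le> flux_bound \<beta> B" if s: "0 < s" for s
  proof -
    interpret K: boundary_kernel \<phi> \<phi>' \<alpha> C r c \<beta> s
      by unfold_locales (use c \<beta> d s in \<open>auto simp: d_def\<close>)
    interpret S: boundary_solution \<phi> \<phi>' \<alpha> C r c \<beta> s "\<lambda>x t. f (E x t)" "\<lambda>x t. partial_x f (E x t)"
      "\<lambda>x t. partial_y f (E x t)" "\<lambda>x t. dbar f (E x t)" "\<lambda>x t. dbar_x f (E x t)" "\<lambda>x t. dbar_y f (E x t)" B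
    proof unfold_locales
      show "continuous_on ({0..r} \<times> {-r..r}) (\<lambda>(t, x). f (E x t))"
        unfolding split_beta by (rule continuous_on_compose2[OF cf cE]) (use Ecl in auto)
      show "((\<lambda>x. f (E x t)) has_vector_derivative partial_x f (E x t) + complex_of_real (\<phi>' x) * partial_y f (E x t)) (at x within {-r..r})"
        if "x \<in> {-r..r}" "t \<in> {0<..r}" for x t
        using has_grad_along_curve[where c="\<lambda>x. E x t", OF der(1)[OF EG[OF that]] E_x[OF that(1)]]
        by (simp add: scaleR_conv_of_real)
      show "((\<lambda>t. f (E x t)) has_vector_derivative partial_y f (E x t)) (at t within {0<..r})"
        if "x \<in> {-r..r}" "t \<in> {0<..r}" for x t
        using has_grad_along_curve[where c="\<lambda>t. E x t", OF der(1)[OF EG[OF that]] E_t] by simp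
      show "((\<lambda>x. dbar f (E x t)) has_vector_derivative dbar_x f (E x t) + complex_of_real (\<phi>' x) * dbar_y f (E x t)) (at x within {-r..r})"
        if "x \<in> {-r..r}" "t \<in> {0<..r}" for x t
        using has_grad_along_curve[where c="\<lambda>x. E x t", OF der(2)[OF EG[OF that]] E_x[OF that(1)]]
        by (simp add: scaleR_conv_of_real)
      show "((\<lambda>t. dbar f (E x t)) has_vector_derivative dbar_y f (E x t)) (at t within {0<..r})"
        if "x \<in> {-r..r}" "t \<in> {0<..r}" for x t
        using has_grad_along_curve[where c="\<lambda>t. E x t", OF der(2)[OF EG[OF that]] E_t] by simp
      show "dbar f (E x t) = (partial_x f (E x t) + \<i> * partial_y f (E x t)) / 2" for x t
        by (rule dbar_def)
      have "continuous_on G (dbar f)"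
        using der(2) has_grad_imp_continuous by (blast intro: continuous_at_imp_continuous_on)
      then show "continuous_on ({0<..r} \<times> {-r..r}) (\<lambda>(t, x). dbar f (E x t))" by (rule cG)
      show "continuous_on ({0<..r} \<times> {-r..r}) (\<lambda>(t, x). partial_y f (E x t))" by (rule cG[OF der(5)])
      show "continuous_on ({0<..r} \<times> {-r..r}) (\<lambda>(t, x). dbar_y f (E x t))" by (rule cG[OF der(7)])
      show "complex_of_real (c * (1 + \<beta>)) * dbar_x f (E x t) + \<i> * complex_of_real c * dbar_y f (E x t) = 0"
        if "x \<in> {-r..r}" "t \<in> {0<..r}" for x t
        using der(3)[OF EG[OF that]] unfolding d_def[symmetric] d_eq by (simp add: c_def)
      show "norm (f (E x t)) \<le> B" if "x \<in> {-r..r}" "t \<in> {0..r}" for x t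
        using B0(1)[OF Ecl[OF that]] B by simp
      show "norm (dbar f (E x t)) \<le> B / t" if "x \<in> {-r..r}" "t \<in> {0<..r}" for x t
      proof -
        have "norm (f z - 0) \<le> B0" if "z \<in> cball (E x t) (t / 3)" for z
          using B0(1)[of z] subsetD[OF ball[OF \<open>x \<in> {-r..r}\<close> \<open>t \<in> {0<..r}\<close>] that] closure_subset[of G]
          by (simp add: subset_iff)
        from Vb[OF that this] have "norm (dbar f (E x t)) \<le> B0 / (d * c * (t / 3))" .
        also have "\<dots> = B / t" by (simp add: B_def)
        finally show ?thesis .
      qed
    qed (rule small)
    have "boundary_weight c d x * (cnj (boundary_weight c d x) * log_bump r x) / Complex x (\<phi> x + s) / 2
      = (\<i> - \<phi>' x) * (f (E x 0) * (c / K.\<zeta> x 0 + \<i> * d * \<phi>' x / K.\<omega> x 0)) / 2" if x: "x \<in> {-r..r}" for x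
    proof -
      have "f (E x 0) = P x" using bdry[of "E x 0"] on[of x] x by (auto simp: E_def \<psi>_def)
      moreover have "K.\<zeta> x 0 = Complex x (\<phi> x + s)" "K.\<omega> x 0 = Complex x (\<phi> x + s)"
        by (simp_all add: K.\<zeta>_def K.\<omega>_def)
      moreover have "complex_of_real c / Complex x (\<phi> x + s) + \<i> * d * \<phi>' x / Complex x (\<phi> x + s)
         = (c + \<i> * d * \<phi>' x) / Complex x (\<phi> x + s)" by (simp add: add_divide_distrib)
      ultimately show ?thesis by (simp add: P_def boundary_weight_def)
    qed
    then have "integral {-r..r} (\<lambda>x. boundary_weight c d x * (cnj (boundary_weight c d x) * log_bump r x) / Complex x (\<phi> x + s) / 2) = S.J0 0"
      unfolding S.J0_def d_def by (intro integral_cong) (simp add: d_def)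
    then show ?thesis using S.norm_J0_le by simp
  qed
  obtain s where "0 < s" "flux_bound \<beta> B < norm (integral {-r..r}
      (\<lambda>x. boundary_weight c d x * (cnj (boundary_weight c d x) * log_bump r x) / Complex x (\<phi> x + s) / 2))"
    using boundary_functional_unbounded[OF c(1) \<phi>0] by blast
  then show False using bound by force
qed

theorem theorem1:
  fixes \<alpha> :: real and G :: "complex set"
  assumes "0 < \<alpha>" and "\<alpha> < 1"
    and "jordan_domain G"
    and "C1_holder_curve \<alpha> (frontier G)"
  shows "\<forall>\<tau>::real. 0 \<le> \<tau> \<and> \<tau> < 1 \<longrightarrow> \<not> L_regular \<tau> G"
proof -
  obtain \<Gamma> where \<Gamma>: "jordan_curve \<Gamma>" "G \<in> components (- \<Gamma>)" "bounded G"
    using assms(3) by (auto simp: jordan_domain_def)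
  have "compact \<Gamma>"
    using \<Gamma>(1) homeomorphic_compactness[of \<Gamma> "sphere (0::complex) 1"] by (simp add: jordan_curve_def)
  then have "open (- \<Gamma>)" by (simp add: compact_imp_closed open_Compl)
  then have "open G" using \<Gamma>(2) open_components by blast
  moreover have "G \<noteq> {}" "connected G"
    using \<Gamma>(2) in_components_nonempty in_components_connected by blast+
  ultimately show ?thesis
    using C1_holder_domain_not_regular[OF assms(1,2) _ \<Gamma>(3) _ _ assms(4)] by blast
qed

end
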